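(* Let $(\mathfrak X,+,\mathcal A)$ be a measurable Abelian semigroup with zero element. Let $d,n\in\mathbb N$ and $\ell\in\{0,\dots,n\}$. For $j\in\{1,\dots,n\}$ and $r\in\{1,\dots,d\}$ let $p_j,q_{j,r}\in[0,1]$ with $\sum_{r=1}^d q_{j,r}=1$ and $\lambda_r:=\sum_{j=1}^n p_jq_{j,r}>0$, let $\lambda=\sum_{j=1}^n p_j$, and let $U_r$ be a probability measure on $(\mathfrak X,\mathcal A)$. Set $$Q_j=\sum_{r=1}^d q_{j,r}U_r,\quad Q=\frac1\lambda\sum_{j=1}^n p_jQ_j,\quad R_j=p_j(Q_j-\delta_0),\quad F_j=\delta_0+R_j,$$ $$V_j=F_je^{-R_j}-\delta_0,\quad F=\prod_{j=1}^n F_j.$$ For $k\in\{0,\dots,n\}$ let $$M_k=\sum_{J\subseteq\{1,\dots,n\}:\,|J|=k}\ \prod_{j\in J}V_j,\qquad H_k=M_k\exp(\lambda(Q-\delta_0)),$$ and set $G_\ell=\sum_{k=0}^\ell H_k$. Let $$\beta_1=\sum_{j=1}^n p_j^2\sum_{r=1}^d q_{j,r}\min\Bigl\{\frac{q_{j,r}}{\lambda_r},\,1\Bigr\}.$$ Let the constants $D_k'$, $k\in\mathbb N$, be as defined in the context, and for $x\in[0,\infty)$ let $h_1(x)=\sum_{k=\ell+1}^\infty D_k'x^k\in[0,\infty]$ and $h_2(x)=2+\sum_{k=1}^\ell D_k'x^k$. Then the equation $h_1(x)=h_2(x)$ has a unique positive solution $x_\ell\in(0,\infty)$, and with $c_\ell=\frac{h_2(x_\ell)}{x_\ell^{\ell+1}}$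 we have, without any restrictions, $$\|F-G_\ell\|\le c_\ell\,\beta_1^{\ell+1}.$$ In particular, $c_0\le15.6$, $c_1\le113.0$, $c_2\le633.8$, $c_3\le3204.8$, $c_4\le15945.6$.
   Context: A measurable Abelian semigroup with zero element $(\mathfrak X,+,\mathcal A)$ is a commutative semigroup $(\mathfrak X,+)$ with identity element $0$ and a $\sigma$-algebra $\mathcal A$ on $\mathfrak X$ such that $(x,y)\mapsto x+y$ is measurable from $(\mathfrak X\times\mathfrak X,\mathcal A\otimes\mathcal A)$ to $(\mathfrak X,\mathcal A)$. $\delta_x$ is the Dirac measure at $x\in\mathfrak X$. Products and powers of finite signed measures on $(\mathfrak X,\mathcal A)$ are convolutions, $VW(A)=\int_{\mathfrak X}V(\{y\in\mathfrak X: x+y\in A\})\,dW(x)$, with empty products and zeroth powers equal to $\delta_0$; $e^V=\exp(V)=\sum_{m=0}^\infty V^m/m!$. $\|V\|=V^+(\mathfrak X)+V^-(\mathfrak X)$ is the total variation norm, where $V=V^+-V^-$ is the Hahn-Jordan decomposition. $|J|$ is the cardinality of a finite set $J$; empty sums are $0$. Constants: let $g(z)=2\sum_{m=2}^\infty\frac{m-1}{m!}z^{m-2}$, so $g(z)=\frac{2e^z}{z^2}(e^{-z}-1+z)$ for $z\neq0$. Let $D_1=4.342$, $D_2=10.784$, $D_3=21.721$, $D_4=40.687$, $D_5=74.672$, $D_6=125.448$, $D_7=186.872$, $D_8=253.020$, $D_9=305.314$, and $D_k=\frac{\sqrt{(2k)!}}{k!}$ for $k\ge10$. Set $D_1'=3.11$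 and $D_k'=D_k\bigl(\frac{g(2)}2\bigr)^k$ for $k\in\{2,3,4,\dots\}$. The functions $h_1,h_2$ (and hence $x_\ell$, $c_\ell$) depend only on $\ell$. *)

theory Defs
  imports "HOL-Probability.Probability" "HOL-Algebra.FiniteProduct"
begin

section \<open>Measurable Abelian semigroups with zero element\<close>

text \<open>
  The semigroup is an abelian monoid in the sense of HOL-Algebra, hence written multiplicatively:
  \<open>x \<otimes>\<^bsub>G\<^esub> y\<close> stands for \<open>x + y\<close> and \<open>\<one>\<^bsub>G\<^esub>\<close> for the zero element. Only the space and the sigma-algebra
  of \<open>M\<close> matter; the measure carried by \<open>M\<close> is irrelevant.
\<close>

locale measurable_abelian_semigroup = comm_monoid G
  for G :: "('a, 'b) monoid_scheme" (structure) and M :: "'a measure" +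
  assumes space_eq_carrier: "space M = carrier G"
    and measurable_add: "(\<lambda>(x, y). x \<otimes> y) \<in> measurable (M \<Otimes>\<^sub>M M) M"


section \<open>Finite signed measures\<close>

text \<open>
  A finite signed measure is a countably additive real set function on \<open>sets M\<close>. As for
  \<^const>\<open>measure\<close>, it is \<open>0\<close> by convention outside \<open>sets M\<close>, so that equality of
  signed measures is equality of functions, and \<open>measure N\<close> is itself a signed measure for
  every finite measure \<open>N\<close> with \<open>sets N = sets M\<close>.
\<close>

definition finite_signed_measure :: "'a measure \<Rightarrow> ('a set \<Rightarrow> real) \<Rightarrow> bool" where
  "finite_signed_measure M V \<longleftrightarrow>
     V {} = 0 \<and>
     (\<forall>A :: nat \<Rightarrow> 'a set. range A \<subseteq> sets M \<longrightarrow> disjoint_family A \<longrightarrow>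
        (\<lambda>i. V (A i)) sums V (\<Union>i. A i)) \<and>
     (\<forall>A. A \<notin> sets M \<longrightarrow> V A = 0)"

definition is_hahn_set :: "'a measure \<Rightarrow> ('a set \<Rightarrow> real) \<Rightarrow> 'a set \<Rightarrow> bool" where
  "is_hahn_set M V P \<longleftrightarrow>
     P \<in> sets M \<and>
     (\<forall>B\<in>sets M. B \<subseteq> P \<longrightarrow> 0 \<le> V B) \<and>
     (\<forall>B\<in>sets M. B \<subseteq> space M - P \<longrightarrow> V B \<le> 0)"

text \<open>
  A Hahn set exists for every finite signed measure, and the measures \<open>V\<^sup>+\<close> and \<open>V\<^sup>-\<close> below do not
  depend on the one that is chosen.
\<close>

definition hahn_set :: "'a measure \<Rightarrow> ('a set \<Rightarrow> real) \<Rightarrow> 'a set" where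
  "hahn_set M V = (SOME P. is_hahn_set M V P)"

definition jordan_pos :: "'a measure \<Rightarrow> ('a set \<Rightarrow> real) \<Rightarrow> 'a measure" where
  "jordan_pos M V =
     measure_of (space M) (sets M) (\<lambda>A. ennreal (V (A \<inter> hahn_set M V)))"

definition jordan_neg :: "'a measure \<Rightarrow> ('a set \<Rightarrow> real) \<Rightarrow> 'a measure" where
  "jordan_neg M V =
     measure_of (space M) (sets M) (\<lambda>A. ennreal (- V (A - hahn_set M V)))"

definition tv_norm :: "'a measure \<Rightarrow> ('a set \<Rightarrow> real) \<Rightarrow> real" where
  "tv_norm M V = measure (jordan_pos M V) (space M) + measure (jordan_neg M V) (space M)"

definition signed_integral :: "'a measure \<Rightarrow> ('a set \<Rightarrow> real) \<Rightarrow> ('a \<Rightarrow> real) \<Rightarrow> real" where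
  "signed_integral M W f = integral\<^sup>L (jordan_pos M W) f - integral\<^sup>L (jordan_neg M W) f"


section \<open>Convolution\<close>

definition convolve ::
    "('a, 'b) monoid_scheme \<Rightarrow> 'a measure \<Rightarrow> ('a set \<Rightarrow> real) \<Rightarrow> ('a set \<Rightarrow> real) \<Rightarrow> 'a set \<Rightarrow> real" where
  "convolve G M V W =
     (\<lambda>A. if A \<in> sets M
          then signed_integral M W (\<lambda>x. V {y \<in> space M. x \<otimes>\<^bsub>G\<^esub> y \<in> A})
          else 0)"

definition dirac :: "'a measure \<Rightarrow> 'a \<Rightarrow> 'a set \<Rightarrow> real" where
  "dirac M x = measure (return M x)"

text \<open>
  Products \<^const>\<open>finprod\<close> and powers \<open>[^]\<close> of signed measures are those of the
  following commutative monoid; in particular, empty products and zeroth powers are \<open>\<delta>\<^sub>0\<close>.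
\<close>

definition conv_monoid :: "('a, 'b) monoid_scheme \<Rightarrow> 'a measure \<Rightarrow> ('a set \<Rightarrow> real) monoid" where
  "conv_monoid G M =
     \<lparr>carrier = {V. finite_signed_measure M V},
      mult = convolve G M,
      one = dirac M \<one>\<^bsub>G\<^esub>\<rparr>"

text \<open>
  The exponential series converges in total variation norm, so its sum can be computed setwise.
\<close>

definition conv_exp :: "('a, 'b) monoid_scheme \<Rightarrow> 'a measure \<Rightarrow> ('a set \<Rightarrow> real) \<Rightarrow> 'a set \<Rightarrow> real" where
  "conv_exp G M V = (\<lambda>A. \<Sum>m. (V [^]\<^bsub>conv_monoid G M\<^esub> (m::nat)) A / fact m)"


section \<open>Constants\<close>

text \<open>The summation index \<open>m\<close> of the series for \<open>g\<close>, starting at \<open>2\<close>, is shifted by \<open>2\<close>.\<close>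

definition g_fun :: "real \<Rightarrow> real" where
  "g_fun z = 2 * (\<Sum>m. (real (m + 2) - 1) / fact (m + 2) * z ^ m)"

text \<open>Only the values at \<open>k \<ge> 1\<close> are meaningful, here and for \<open>D'\<close> below.\<close>

definition D_const :: "nat \<Rightarrow> real" where
  "D_const k =
     (if k = 1 then 4.342
      else if k = 2 then 10.784
      else if k = 3 then 21.721
      else if k = 4 then 40.687
      else if k = 5 then 74.672
      else if k = 6 then 125.448
      else if k = 7 then 186.872
      else if k = 8 then 253.020
      else if k = 9 then 305.314
      else sqrt (fact (2 * k)) / fact k)"

definition D'_const :: "nat \<Rightarrow> real" where
  "D'_const k = (if k = 1 then 3.11 else D_const k * (g_fun 2 / 2) ^ k)"

text \<open>\<open>h\<^sub>1\<close> may be infinite; its summation index, starting at \<open>l + 1\<close>, is shifted by \<open>l + 1\<close>.\<close>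

definition h1 :: "nat \<Rightarrow> real \<Rightarrow> ennreal" where
  "h1 l x = (\<Sum>k. ennreal (D'_const (k + (l + 1)) * x ^ (k + (l + 1))))"

definition h2 :: "nat \<Rightarrow> real \<Rightarrow> real" where
  "h2 l x = 2 + (\<Sum>k = 1..l. D'_const k * x ^ k)"

definition x_sol :: "nat \<Rightarrow> real" where
  "x_sol l = (THE x. 0 < x \<and> h1 l x = ennreal (h2 l x))"

definition c_const :: "nat \<Rightarrow> real" where
  "c_const l = h2 l (x_sol l) / x_sol l ^ (l + 1)"

end

theory Submission
  imports Defs
begin

text \<open>
  All measures of the theorem are images of elements of one commutative Banach algebra under a
  norm-decreasing homomorphism: the algebra of summable functions on the finite multisets of
  \<open>{1, \<dots>, d}\<close>, the generator \<open>r\<close> being mapped to \<open>U\<^sub>r\<close>. In this algebra \<open>F = (\<Sum>k\<le>n. H\<^sub>k)\<close>, and the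
  crucial estimate is \<open>\<parallel>H\<^sub>k\<parallel> \<le> D'\<^sub>k \<beta>\<^sub>1\<^sup>k\<close>. If \<open>\<beta>\<^sub>1 \<le> x\<^sub>l\<close>, it bounds \<open>F - G\<^sub>l\<close> by \<open>h\<^sub>1(\<beta>\<^sub>1)\<close>; otherwise it
  bounds \<open>F - G\<^sub>l\<close> by \<open>1 + \<parallel>G\<^sub>l\<parallel> \<le> h\<^sub>2(\<beta>\<^sub>1)\<close>.

  To estimate \<open>H\<^sub>k\<close>, the exponential \<open>exp (\<lambda>(Q - \<delta>\<^sub>0))\<close> lends a factor \<open>exp (3/5 R\<^sub>j)\<close> to each of the
  \<open>k\<close> factors \<open>V\<^sub>j\<close>, which turns \<open>V\<^sub>j\<close> into \<open>R\<^sub>j\<^sup>2\<close> times an element of norm less than \<open>0.6864\<close>; the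
  intensities of the Poisson law that remains are at least \<open>2/5 \<lambda>\<^sub>r\<close>. Then \<open>R\<^sub>j\<close> is
  split into the part with \<open>q\<^sub>j\<^sub>r \<le> \<lambda>\<^sub>r\<close>, which is estimated in the \<open>L\<^sup>2\<close> space of the Poisson law by
  means of creation and annihilation operators, and the rest, which is estimated by its norm.
\<close>

section \<open>Summable functions on a commutative monoid\<close>

text \<open>The multisets form the free commutative semigroup on the types: multiplicities are
  visible there, so the Poisson law has independent coordinates on which operators can act, whereas
  the \<open>U r\<close> themselves may overlap.

  The constants for \<open>10 \<le> k\<close> show the origin of each factor: the \<open>L^2\<close>
  norm of \<open>2 k\<close> creation operators gives \<open>sqrt (fact (2 * k))\<close>, the sum
  over the sets of size \<open>k\<close> gives \<open>1 / fact k\<close>, and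
  \<open>g_fun 2 / 2\<close> equals \<open>kappa 0\<close>, the constant of the factor estimate when
  no exponential is lent. With nothing lent, the part with \<open>q j r \<le> lam r\<close> alone
  would consume this constant. Lending 3/5 costs only \<open>kappa (3/5) * 5/2 < 1.717\<close>
  against \<open>g_fun 2 / 2 > 2.097\<close>, and the surplus pays for the remaining part.

  That part is the obstacle: the minimum in \<open>beta\<close> caps \<open>q j r / lam r\<close> at
  1, so an inner product weighted by \<open>1 / lam r\<close> is too large there. The mixed bound
  for the square of \<open>R j\<close> still has to be linear in \<open>m j\<close>, which produces
  the summand 4 in the base \<open>5/2 * s + 4\<close>; here \<open>s\<close> stands for the root of
  order \<open>2 k\<close> of \<open>fact (2 * k)\<close>.\<close>

no_notation Infinite_Set_Sum.abs_summable_on (infix \<open>abs'_summable'_on\<close> 50)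

lemma summable_on_diff:
  fixes f g :: "'a \<Rightarrow> real"
  assumes "f summable_on A" and "g summable_on A"
  shows "(\<lambda>a. f a - g a) summable_on A"
  using summable_on_add[OF assms(1), of "\<lambda>a. - g a"] assms(2) by (simp add: summable_on_uminus)

text \<open>For real functions \<open>summable_on\<close> is unconditional and hence absolute
  summability, so this is the space \<open>l^1\<close>.\<close>

typedef 'i l1 = "{f :: 'i \<Rightarrow> real. f summable_on UNIV}"
  morphisms coeff Abs_l1
  by (rule exI[of _ "\<lambda>_. 0"]) simp

setup_lifting type_definition_l1

lemma coeff_summable: "coeff f summable_on UNIV"
  using coeff by auto

lemma coeff_abs_summable: "(\<lambda>a. \<bar>coeff f a\<bar>) summable_on UNIV"
  using summable_on_iff_abs_summable_on_real[THEN iffD1, OF coeff_summable[of f]] by simp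

lemma l1_eqI: "(\<And>a. coeff f a = coeff g a) \<Longrightarrow> f = g"
  by transfer auto

instantiation l1 :: (type) real_vector
begin
lift_definition zero_l1 :: "'a l1" is "\<lambda>_. 0" by simp
lift_definition plus_l1 :: "'a l1 \<Rightarrow> 'a l1 \<Rightarrow> 'a l1" is "\<lambda>f g a. f a + g a"
  by (simp add: summable_on_add)
lift_definition minus_l1 :: "'a l1 \<Rightarrow> 'a l1 \<Rightarrow> 'a l1" is "\<lambda>f g a. f a - g a"
  by (rule summable_on_diff)
lift_definition uminus_l1 :: "'a l1 \<Rightarrow> 'a l1" is "\<lambda>f a. - f a"
  by (simp add: summable_on_uminus)
lift_definition scaleR_l1 :: "real \<Rightarrow> 'a l1 \<Rightarrow> 'a l1" is "\<lambda>c f a. c * f a"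
  by (simp add: summable_on_cmult_right)
instance
  by standard (simp_all add: coeff_inject[symmetric] zero_l1.rep_eq plus_l1.rep_eq minus_l1.rep_eq
      uminus_l1.rep_eq scaleR_l1.rep_eq algebra_simps)
end

lemmas coeff_simps [simp] =
  zero_l1.rep_eq plus_l1.rep_eq minus_l1.rep_eq uminus_l1.rep_eq scaleR_l1.rep_eq

instantiation l1 :: (type) real_normed_vector
begin
definition norm_l1 :: "'a l1 \<Rightarrow> real" where "norm f = (\<Sum>\<^sub>\<infinity>a. \<bar>coeff f a\<bar>)"
definition dist_l1 :: "'a l1 \<Rightarrow> 'a l1 \<Rightarrow> real" where "dist_l1 f g = norm (f - g)"
definition sgn_l1 :: "'a l1 \<Rightarrow> 'a l1" where "sgn_l1 f = f /\<^sub>R norm f"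
definition uniformity_l1 :: "('a l1 \<times> 'a l1) filter" where
  "uniformity_l1 = (INF e\<in>{0<..}. principal {(x, y). dist x y < e})"
definition open_l1 :: "'a l1 set \<Rightarrow> bool" where
  "open_l1 U \<longleftrightarrow> (\<forall>x\<in>U. eventually (\<lambda>(x', y). x' = x \<longrightarrow> y \<in> U) uniformity)"
instance
proof
  fix f g :: "'a l1" and c :: real and U :: "'a l1 set"
  show "dist f g = norm (f - g)" by (rule dist_l1_def)
  show "sgn f = f /\<^sub>R norm f" by (rule sgn_l1_def)
  show "uniformity = (INF e\<in>{0<..}. principal {(x, y :: 'a l1). dist x y < e})"
    by (rule uniformity_l1_def)
  show "open U \<longleftrightarrow> (\<forall>x\<in>U. eventually (\<lambda>(x', y). x' = x \<longrightarrow> y \<in> U) uniformity)"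
    by (rule open_l1_def)
  show "norm f = 0 \<longleftrightarrow> f = 0"
  proof
    assume "norm f = 0"
    then have "\<bar>coeff f a\<bar> = 0" for a
      using nonneg_infsum_le_0D[of "\<lambda>a. \<bar>coeff f a\<bar>" UNIV a] coeff_abs_summable[of f]
      by (simp add: norm_l1_def)
    then show "f = 0" by (intro l1_eqI) simp
  qed (simp add: norm_l1_def)
  have "norm (f + g) \<le> (\<Sum>\<^sub>\<infinity>a. \<bar>coeff f a\<bar> + \<bar>coeff g a\<bar>)"
    unfolding norm_l1_def
    by (rule infsum_mono[OF coeff_abs_summable summable_on_add[OF coeff_abs_summable coeff_abs_summable]]) simp
  also have "\<dots> = norm f + norm g"
    unfolding norm_l1_def by (rule infsum_add[OF coeff_abs_summable coeff_abs_summable])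
  finally show "norm (f + g) \<le> norm f + norm g" .
  show "norm (c *\<^sub>R f) = \<bar>c\<bar> * norm f"
    unfolding norm_l1_def by (simp only: scaleR_l1.rep_eq abs_mult infsum_cmult_right')
qed
end

lemma finite_sum_le_norm_l1: "finite F \<Longrightarrow> (\<Sum>a\<in>F. \<bar>coeff f a\<bar>) \<le> norm f"
  unfolding norm_l1_def
  by (rule finite_sum_le_infsum[OF coeff_abs_summable]) simp_all

lemma abs_coeff_le_norm: "\<bar>coeff f a\<bar> \<le> norm f"
  using finite_sum_le_norm_l1[of "{a}" f] by simp

lemma norm_l1_le:
  assumes "\<And>F. finite F \<Longrightarrow> (\<Sum>a\<in>F. \<bar>coeff f a\<bar>) \<le> B"
  shows "norm f \<le> B"
  unfolding norm_l1_def using assms by (intro infsum_le_finite_sums coeff_abs_summable) auto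

instance l1 :: (type) banach
proof
  fix X :: "nat \<Rightarrow> 'a l1"
  assume X: "Cauchy X"
  have "convergent (\<lambda>n. coeff (X n) a)" for a
  proof -
    have "Cauchy (\<lambda>n. coeff (X n) a)"
    proof (rule metric_CauchyI)
      fix e :: real assume "0 < e"
      then obtain N where N: "\<And>m n. m \<ge> N \<Longrightarrow> n \<ge> N \<Longrightarrow> dist (X m) (X n) < e"
        using metric_CauchyD[OF X] by blast
      have "dist (coeff (X m) a) (coeff (X n) a) < e" if "m \<ge> N" "n \<ge> N" for m n
        using abs_coeff_le_norm[of "X m - X n" a] N[OF that] by (simp add: dist_norm)
      then show "\<exists>M. \<forall>m\<ge>M. \<forall>n\<ge>M. dist (coeff (X m) a) (coeff (X n) a) < e"
        by blast
    qed
    then show ?thesis by (simp add: Cauchy_convergent)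
  qed
  then obtain L where L: "\<And>a. (\<lambda>n. coeff (X n) a) \<longlonglongrightarrow> L a"
    unfolding convergent_def by metis
  \<comment> \<open>Bounds on finite partial sums survive pointwise limits. This single estimate
    yields both the summability of \<open>L\<close> and the convergence in norm.\<close>
  have lim: "(\<Sum>a\<in>F. \<bar>coeff (X n) a - L a\<bar>) \<le> e"
    if N: "\<And>m n. m \<ge> N \<Longrightarrow> n \<ge> N \<Longrightarrow> dist (X m) (X n) < e" and "n \<ge> N" and F: "finite F" for N n e F
  proof (rule tendsto_upperbound[OF _ _ sequentially_bot])
    show "(\<lambda>m. \<Sum>a\<in>F. \<bar>coeff (X n) a - coeff (X m) a\<bar>) \<longlonglongrightarrow> (\<Sum>a\<in>F. \<bar>coeff (X n) a - L a\<bar>)"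
      by (intro tendsto_intros L)
    have "(\<Sum>a\<in>F. \<bar>coeff (X n) a - coeff (X m) a\<bar>) \<le> e" if "m \<ge> N" for m
      using finite_sum_le_norm_l1[OF F, of "X n - X m"] N[OF \<open>n \<ge> N\<close> that] by (simp add: dist_norm)
    then show "\<forall>\<^sub>F m in sequentially. (\<Sum>a\<in>F. \<bar>coeff (X n) a - coeff (X m) a\<bar>) \<le> e"
      by (auto simp: eventually_sequentially)
  qed
  have "L summable_on UNIV"
  proof -
    obtain N where N: "\<And>m n. m \<ge> N \<Longrightarrow> n \<ge> N \<Longrightarrow> dist (X m) (X n) < 1"
      using metric_CauchyD[OF X zero_less_one] by blast
    have "(\<lambda>a. coeff (X N) a - L a) abs_summable_on UNIV"
      unfolding abs_summable_iff_bdd_above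
    proof (rule bdd_aboveI2)
      fix F :: "'a set" assume "F \<in> {F. F \<subseteq> UNIV \<and> finite F}"
      then show "(\<Sum>a\<in>F. norm (coeff (X N) a - L a)) \<le> 1"
        using lim[of N 1 N F] N by simp
    qed
    from summable_on_diff[OF coeff_summable[of "X N"] summable_on_iff_abs_summable_on_real[THEN iffD2, OF this]]
    show ?thesis by simp
  qed
  then have L': "coeff (Abs_l1 L) = L" by (simp add: Abs_l1_inverse)
  have "X \<longlonglongrightarrow> Abs_l1 L"
  proof (rule metric_LIMSEQ_I)
    fix e :: real assume "0 < e"
    then obtain N where N: "\<And>m n. m \<ge> N \<Longrightarrow> n \<ge> N \<Longrightarrow> dist (X m) (X n) < e / 2"
      using metric_CauchyD[OF X half_gt_zero] by blast
    have "dist (X n) (Abs_l1 L) \<le> e / 2" if "n \<ge> N" for n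
      unfolding dist_norm by (rule norm_l1_le) (use lim[OF N that] in \<open>simp add: L'\<close>)
    then show "\<exists>N. \<forall>n\<ge>N. dist (X n) (Abs_l1 L) < e"
      using \<open>0 < e\<close> by (intro exI[of _ N]) (smt (verit) field_sum_of_halves)
  qed
  then show "convergent X" by (auto simp: convergent_def)
qed

section \<open>Duality with bounded functions and the convolution product\<close>

definition pairing :: "'i l1 \<Rightarrow> ('i \<Rightarrow> real) \<Rightarrow> real" where
  "pairing f h = (\<Sum>\<^sub>\<infinity>a. coeff f a * h a)"

lemma pairing_abs_summable:
  assumes "\<And>a. \<bar>h a\<bar> \<le> B"
  shows "(\<lambda>a. \<bar>coeff f a * h a\<bar>) summable_on UNIV"
proof -
  have "(\<lambda>a. coeff f a * h a) abs_summable_on UNIV"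
  proof (rule Infinite_Sum.abs_summable_on_comparison_test)
    show "(\<lambda>a. coeff f a * B) abs_summable_on UNIV"
      using summable_on_cmult_left[OF coeff_abs_summable[of f], of "\<bar>B\<bar>"]
      by (simp add: abs_mult)
    show "norm (coeff f a * h a) \<le> norm (coeff f a * B)" for a
      using assms[of a] by (auto simp: abs_mult intro!: mult_left_mono)
  qed
  then show ?thesis by simp
qed

lemma pairing_summable:
  assumes "\<And>a. \<bar>h a\<bar> \<le> B"
  shows "(\<lambda>a. coeff f a * h a) summable_on UNIV"
  by (rule summable_on_iff_abs_summable_on_real[THEN iffD2]) (simp add: pairing_abs_summable[of h, OF assms])

lemma abs_pairing_le:
  assumes "\<And>a. \<bar>h a\<bar> \<le> B"
  shows "\<bar>pairing f h\<bar> \<le> B * norm f"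
proof -
  have "\<bar>pairing f h\<bar> \<le> (\<Sum>\<^sub>\<infinity>a. \<bar>coeff f a * h a\<bar>)"
    unfolding pairing_def using norm_infsum_bound[of "\<lambda>a. coeff f a * h a" UNIV]
      pairing_abs_summable[of h, OF assms] by simp
  also have "\<dots> \<le> (\<Sum>\<^sub>\<infinity>a. B * \<bar>coeff f a\<bar>)"
    using assms pairing_abs_summable[of h, OF assms]
    by (intro infsum_mono summable_on_cmult_right coeff_abs_summable)
       (auto simp: abs_mult mult.commute intro!: mult_right_mono)
  also have "\<dots> = B * norm f" by (simp add: norm_l1_def infsum_cmult_right')
  finally show ?thesis .
qed

lemma bounded_linear_pairing:
  fixes h :: "'i \<Rightarrow> real"
  assumes "\<And>a. \<bar>h a\<bar> \<le> B"
  shows "bounded_linear (\<lambda>f. pairing f h)"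
proof (rule bounded_linear_intro[of _ B])
  fix f g :: "'i l1" and c :: real
  show "pairing (f + g) h = pairing f h + pairing g h"
    unfolding pairing_def using pairing_summable[of h, OF assms]
    by (subst infsum_add[symmetric]) (auto simp: algebra_simps)
  show "pairing (c *\<^sub>R f) h = c *\<^sub>R pairing f h"
    unfolding pairing_def by (simp add: mult.assoc infsum_cmult_right')
  show "norm (pairing f h) \<le> norm f * B"
    using abs_pairing_le[of h, OF assms] by (simp add: mult.commute)
qed

lemma bounded_linear_coeff: "bounded_linear (\<lambda>f. coeff f a)"
  by (rule bounded_linear_intro[of _ 1]) (auto simp: abs_coeff_le_norm)

lemma pairing_indicator: "pairing f (\<lambda>b. of_bool (b = a)) = coeff f a"
proof -
  have "pairing f (\<lambda>b. of_bool (b = a)) = (\<Sum>\<^sub>\<infinity>b\<in>{a}. coeff f b)"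
    unfolding pairing_def by (rule infsum_cong_neutral) auto
  then show ?thesis by simp
qed

lemma summable_l1_product: "(\<lambda>(a, b). coeff f a * coeff g b) summable_on UNIV"
proof -
  have "(\<lambda>(a, b). coeff f a * coeff g b) abs_summable_on (UNIV \<times> UNIV)"
    by (rule Infinite_Sum.abs_summable_on_Sigma_iff[THEN iffD2])
      (auto simp: abs_mult infsum_cmult_right' coeff_abs_summable intro!: summable_on_cmult_right summable_on_cmult_left
        infsum_nonneg mult_nonneg_nonneg)
  then show ?thesis by (subst summable_on_iff_abs_summable_on_real) simp
qed


text \<open>Regrouping of a double series by the value of \<open>a + b\<close>: the map
  \<open>?e\<close> tags each pair with its sum and thus exhibits the fibres as a partition of all
  pairs.\<close>

lemma
  fixes K :: "'i::comm_monoid_add \<times> 'i \<Rightarrow> real"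
  assumes "K summable_on UNIV"
  shows summable_on_antidiagonals: "(\<lambda>c. \<Sum>\<^sub>\<infinity>(a, b)\<in>{(a, b). a + b = c}. K (a, b)) summable_on UNIV"
    and infsum_antidiagonals:
      "(\<Sum>\<^sub>\<infinity>c. \<Sum>\<^sub>\<infinity>(a, b)\<in>{(a, b). a + b = c}. K (a, b)) = (\<Sum>\<^sub>\<infinity>p. K p)"
proof -
  let ?S = "Sigma UNIV (\<lambda>c :: 'i. {(a, b). a + b = c})"
  let ?e = "\<lambda>p :: 'i \<times> 'i. (fst p + snd p, p)"
  have img: "?S = range ?e" by (force simp: image_iff)
  have inj: "inj ?e" by (rule injI) simp
  have "(\<lambda>(c, p). K p) summable_on ?S"
    unfolding img by (subst summable_on_reindex[OF inj]) (use assms in \<open>simp add: o_def\<close>)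
  moreover have "infsum (\<lambda>(c, p). K p) ?S = infsum K UNIV"
    unfolding img by (subst infsum_reindex[OF inj]) (simp add: o_def)
  ultimately show "(\<lambda>c. \<Sum>\<^sub>\<infinity>(a, b)\<in>{(a, b). a + b = c}. K (a, b)) summable_on UNIV"
    and "(\<Sum>\<^sub>\<infinity>c. \<Sum>\<^sub>\<infinity>(a, b)\<in>{(a, b). a + b = c}. K (a, b)) = (\<Sum>\<^sub>\<infinity>p. K p)"
    using summable_on_Sigma_banach[of "\<lambda>c. K" UNIV "\<lambda>c. {(a, b). a + b = c}"]
      infsum_Sigma'_banach[of "\<lambda>c. K" UNIV "\<lambda>c. {(a, b). a + b = c}"] by simp_all
qed

lift_definition single :: "'i \<Rightarrow> 'i l1" is "\<lambda>a b. of_bool (b = a)"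
proof -
  fix a :: 'i
  have "(\<lambda>b. of_bool (b = a) :: real) summable_on {a}" by simp
  then show "(\<lambda>b. of_bool (b = a) :: real) summable_on UNIV"
    by (rule summable_on_cong_neutral[THEN iffD1, rotated -1]) auto
qed

lemma pairing_single [simp]: "pairing (single a) h = h a"
proof -
  have "pairing (single a) h = (\<Sum>\<^sub>\<infinity>b\<in>{a}. h b)"
    unfolding pairing_def by (rule infsum_cong_neutral) (auto simp: single.rep_eq)
  then show ?thesis by simp
qed

lemma norm_single [simp]: "norm (single a) = 1"
proof -
  have "norm (single a) = (\<Sum>\<^sub>\<infinity>b\<in>{a}. 1)"
    unfolding norm_l1_def by (rule infsum_cong_neutral) (auto simp: single.rep_eq)
  then show ?thesis by simp
qed

text \<open>Bounded functions separate points. Together with \<open>pairing_times\<close> this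
  reduces associativity, distributivity and the unit law to iterated pairings, without rearranging
  convolution sums.\<close>

lemma pairing_eqI:
  assumes "\<And>h. (\<And>a. \<bar>h a\<bar> \<le> 1) \<Longrightarrow> pairing f h = pairing g h"
  shows "f = g"
proof (rule l1_eqI)
  fix a
  show "coeff f a = coeff g a"
    using assms[of "\<lambda>b. of_bool (b = a)"] by (simp add: pairing_indicator)
qed

lemma norm_eq_pairing: "norm f = pairing f (\<lambda>a. sgn (coeff f a))"
  by (simp add: norm_l1_def pairing_def abs_sgn)

instantiation l1 :: (comm_monoid_add) "{one, times}"
begin
definition one_l1 :: "'a l1" where "one_l1 = single 0"
lift_definition times_l1 :: "'a l1 \<Rightarrow> 'a l1 \<Rightarrow> 'a l1" is
  "\<lambda>f g c. \<Sum>\<^sub>\<infinity>(a, b)\<in>{(a, b). a + b = c}. f a * g b"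
proof -
  fix f g :: "'a \<Rightarrow> real"
  assume "f summable_on UNIV" and "g summable_on UNIV"
  then show "(\<lambda>c. \<Sum>\<^sub>\<infinity>(a, b)\<in>{(a, b). a + b = c}. f a * g b) summable_on UNIV"
    using summable_on_antidiagonals[OF summable_l1_product[of "Abs_l1 f" "Abs_l1 g"]]
    by (simp add: Abs_l1_inverse)
qed
instance ..
end

text \<open>Fubini's theorem: \<open>f * g\<close> is the image of the product of \<open>f\<close>
  and \<open>g\<close> under addition, and the bound on \<open>h\<close> makes the double series
  absolutely summable.\<close>

lemma pairing_times:
  assumes h: "\<And>a. \<bar>h a\<bar> \<le> B"
  shows "pairing (f * g) h = pairing f (\<lambda>a. pairing g (\<lambda>b. h (a + b)))"
proof -
  have "(\<lambda>(a, b). coeff f a * coeff g b * h (a + b)) abs_summable_on UNIV"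
  proof (rule Infinite_Sum.abs_summable_on_comparison_test)
    show "(\<lambda>p. B * (case p of (a, b) \<Rightarrow> coeff f a * coeff g b)) abs_summable_on UNIV"
      by (rule summable_on_iff_abs_summable_on_real[THEN iffD1])
        (intro summable_on_cmult_right summable_l1_product)
    show "norm (case p of (a, b) \<Rightarrow> coeff f a * coeff g b * h (a + b))
        \<le> norm (B * (case p of (a, b) \<Rightarrow> coeff f a * coeff g b))" for p
    proof (cases p)
      case (Pair a b)
      have "0 \<le> B" using h[of "a + b"] by linarith
      then show ?thesis
        using mult_left_mono[OF h[of "a + b"], of "\<bar>coeff f a * coeff g b\<bar>"]
        by (simp add: Pair abs_mult mult.commute[of B])
    qed
  qed
  then have sm: "(\<lambda>(a, b). coeff f a * coeff g b * h (a + b)) summable_on UNIV"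
    by (rule summable_on_iff_abs_summable_on_real[THEN iffD2])
  have "pairing (f * g) h = (\<Sum>\<^sub>\<infinity>c. \<Sum>\<^sub>\<infinity>(a, b)\<in>{(a, b). a + b = c}. coeff f a * coeff g b * h (a + b))"
    unfolding pairing_def times_l1.rep_eq infsum_cmult_left'[symmetric]
    by (intro infsum_cong) auto
  also have "\<dots> = (\<Sum>\<^sub>\<infinity>(a, b)\<in>UNIV. coeff f a * coeff g b * h (a + b))"
    using infsum_antidiagonals[OF sm] by simp
  also have "\<dots> = (\<Sum>\<^sub>\<infinity>a. \<Sum>\<^sub>\<infinity>b. coeff f a * coeff g b * h (a + b))"
    using infsum_Sigma'_banach[of "\<lambda>a b. coeff f a * coeff g b * h (a + b)" UNIV "\<lambda>_. UNIV"] sm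
    by simp
  also have "\<dots> = pairing f (\<lambda>a. pairing g (\<lambda>b. h (a + b)))"
    unfolding pairing_def mult.assoc infsum_cmult_right' ..
  finally show ?thesis .
qed

lemma pairing_add_left: "(\<And>a. \<bar>h a\<bar> \<le> B) \<Longrightarrow> pairing (f + g) h = pairing f h + pairing g h"
  by (rule linear_add[OF bounded_linear.linear[OF bounded_linear_pairing]])

lemma pairing_scaleR_left: "(\<And>a. \<bar>h a\<bar> \<le> B) \<Longrightarrow> pairing (c *\<^sub>R f) h = c * pairing f h"
  using linear_scale[OF bounded_linear.linear[OF bounded_linear_pairing]] by simp blast

lemma l1_mult_commute: "f * g = g * (f :: 'i::comm_monoid_add l1)"
proof (rule l1_eqI)
  fix c :: 'i
  have "bij_betw prod.swap {(a, b). a + b = c} {(a, b). a + b = c}"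
    by (rule bij_betw_byWitness[of _ prod.swap]) (auto simp: add.commute)
  from infsum_reindex_bij_betw[OF this, of "\<lambda>(a, b). coeff g a * coeff f b"]
  show "coeff (f * g) c = coeff (g * f) c"
    by (simp add: times_l1.rep_eq case_prod_unfold mult.commute)
qed

instance l1 :: (comm_monoid_add) comm_ring_1
proof
  fix f g k :: "'a l1"
  show "f * g = g * f" by (rule l1_mult_commute)
  show "f * g * k = f * (g * k)"
  proof (rule pairing_eqI)
    fix h :: "'a \<Rightarrow> real" assume h: "\<And>a. \<bar>h a\<bar> \<le> 1"
    have "pairing (f * g * k) h = pairing (f * g) (\<lambda>c. pairing k (\<lambda>d. h (c + d)))"
      by (rule pairing_times[OF h])
    also have "\<dots> = pairing f (\<lambda>a. pairing g (\<lambda>b. pairing k (\<lambda>d. h (a + b + d))))"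
      by (rule pairing_times[of _ "1 * norm k"]) (rule abs_pairing_le[OF h])
    also have "\<dots> = pairing f (\<lambda>a. pairing (g * k) (\<lambda>e. h (a + e)))"
      by (subst pairing_times[of _ 1]) (auto simp: h add.assoc)
    also have "\<dots> = pairing (f * (g * k)) h"
      by (rule pairing_times[OF h, symmetric])
    finally show "pairing (f * g * k) h = pairing (f * (g * k)) h" .
  qed
  show "1 * f = f"
    by (rule pairing_eqI) (subst pairing_times[of _ 1], auto simp: one_l1_def)
  show "(f + g) * k = f * k + g * k"
  proof (rule pairing_eqI)
    fix h :: "'a \<Rightarrow> real" assume h: "\<And>a. \<bar>h a\<bar> \<le> 1"
    show "pairing ((f + g) * k) h = pairing (f * k + g * k) h"
      by (simp only: pairing_times[OF h] pairing_add_left[of h, OF h]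
          pairing_add_left[of "\<lambda>a. pairing k (\<lambda>b. h (a + b))", OF abs_pairing_le[OF h]])
  qed
  show "(0 :: 'a l1) \<noteq> 1"
    by (metis norm_single norm_zero one_l1_def zero_neq_one)
qed

instance l1 :: (comm_monoid_add) real_normed_algebra_1
proof
  fix c :: real and f g :: "'a l1"
  show sl: "c *\<^sub>R f * g = c *\<^sub>R (f * g)" for f g :: "'a l1"
  proof (rule pairing_eqI)
    fix h :: "'a \<Rightarrow> real" assume h: "\<And>a. \<bar>h a\<bar> \<le> 1"
    show "pairing (c *\<^sub>R f * g) h = pairing (c *\<^sub>R (f * g)) h"
      by (simp only: pairing_times[OF h] pairing_scaleR_left[of h, OF h]
          pairing_scaleR_left[of "\<lambda>a. pairing g (\<lambda>b. h (a + b))", OF abs_pairing_le[OF h]])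
  qed
  show "f * c *\<^sub>R g = c *\<^sub>R (f * g)"
    using sl[of g f] by (simp only: mult.commute)
  show "norm (1 :: 'a l1) = 1" by (simp add: one_l1_def)
  \<comment> \<open>The sign of the product is the bounded function at which its norm is attained,
    so two applications of \<open>abs_pairing_le\<close> give submultiplicativity.\<close>
  have s: "\<bar>sgn (coeff (f * g) a)\<bar> \<le> 1" for a by (simp add: sgn_real_def)
  have "norm (f * g) = pairing f (\<lambda>a. pairing g (\<lambda>b. sgn (coeff (f * g) (a + b))))"
    unfolding norm_eq_pairing[of "f * g"] by (rule pairing_times[OF s])
  also have "\<dots> \<le> (1 * norm g) * norm f"
    by (rule order_trans[OF abs_ge_self]) (intro abs_pairing_le s)
  finally show "norm (f * g) \<le> norm f * norm g" by (simp add: mult.commute)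
qed

lemma single_zero: "single 0 = 1"
  by (simp add: one_l1_def)

section \<open>Poisson weights on finite multisets\<close>

lemma coeff_single_times:
  "coeff (single b * f) a = (if b \<subseteq># a then coeff f (a - b) else 0)" for a b :: "'r multiset"
proof -
  have "coeff (single b * f) a = pairing f (\<lambda>c. of_bool (b + c = a))"
    unfolding pairing_indicator[symmetric]
    by (subst pairing_times[of _ 1]) auto
  also have "(\<lambda>c. of_bool (b + c = a)) = (\<lambda>c. of_bool (b \<subseteq># a) * of_bool (c = a - b) :: real)"
    by (auto simp: fun_eq_iff)
  finally show ?thesis
    by (auto simp: pairing_indicator) (simp add: pairing_def)
qed

lemma coeff_single_singleton_times:
  "coeff (single {#r#} * f) a = (if r \<in># a then coeff f (a - {#r#}) else 0)"
  by (simp add: coeff_single_times)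

lemma coeff_sum: "coeff (sum f A) a = (\<Sum>i\<in>A. coeff (f i) a)"
  by (induction A rule: infinite_finite_induct) auto

locale poisson_weights =
  fixes D :: "'r set" and lam :: "'r \<Rightarrow> real"
  assumes finite_D: "finite D" and lam_pos: "r \<in> D \<Longrightarrow> 0 < lam r"
begin

definition W :: "'r multiset \<Rightarrow> real" where
  "W a = of_bool (set_mset a \<subseteq> D) * (\<Prod>r\<in>D. lam r ^ count a r / fact (count a r))"

lemma W_nonneg: "0 \<le> W a"
  using lam_pos by (simp add: W_def prod_nonneg less_imp_le)

text \<open>The Poisson recursion \<open>(k + 1) P(k + 1) = lam P(k)\<close> in the coordinate
  \<open>r\<close>. It lies behind the multinomial formula below as well as the duality of the
  operators.\<close>

lemma W_add_mset:
  assumes "r \<in> D"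
  shows "W (add_mset r a) * (count a r + 1) = lam r * W a"
proof -
  define P where "P = (\<Prod>s\<in>D - {r}. lam s ^ count a s / fact (count a s))"
  have "(\<Prod>s\<in>D - {r}. lam s ^ count (add_mset r a) s / fact (count (add_mset r a) s)) = P"
    unfolding P_def by (rule prod.cong) auto
  then have 1: "W (add_mset r a) = of_bool (set_mset a \<subseteq> D) * (lam r ^ Suc (count a r) / fact (Suc (count a r)) * P)"
    unfolding W_def prod.remove[OF finite_D assms] using assms by simp
  have 2: "W a = of_bool (set_mset a \<subseteq> D) * (lam r ^ count a r / fact (count a r) * P)"
    unfolding W_def prod.remove[OF finite_D assms] P_def ..
  have 3: "lam r ^ Suc (count a r) / fact (Suc (count a r)) * (real (count a r) + 1)
      = lam r * (lam r ^ count a r / fact (count a r))"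
    by (simp add: divide_simps add.commute)
  have "u * (x * P) * n = l * (u * (y * P))" if "x * n = l * y" for u x n l y :: real
    using that by algebra
  from this[OF 3] show ?thesis by (simp only: 1 2 of_nat_add of_nat_1)
qed

lemma W_remove:
  assumes "r \<in> D" "r \<in># a"
  shows "lam r * W (a - {#r#}) = count a r * W a"
proof -
  have "1 \<le> count a r" using assms(2) by (simp add: Suc_leI)
  then show ?thesis
    using W_add_mset[OF assms(1), of "a - {#r#}"] assms(2) by (simp add: of_nat_diff mult.commute)
qed

text \<open>The multinomial theorem: on multisets of size \<open>n\<close>,
  \<open>fact n * W a\<close> is the multinomial coefficient times the powers of the intensities. In
  the induction each summand becomes \<open>count a r * W a\<close>, and the counts add up to the
  size of \<open>a\<close>.\<close>

lemma coeff_power_sum_single: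
  "coeff ((\<Sum>r\<in>D. lam r *\<^sub>R single {#r#}) ^ n) a = of_bool (size a = n) * (fact n * W a)"
proof (induction n arbitrary: a)
  case 0
  show ?case
    by (cases "a = {#}") (auto simp: single_zero[symmetric] single.rep_eq W_def)
next
  case (Suc n)
  let ?x = "\<Sum>r\<in>D. lam r *\<^sub>R single {#r#}"
  have "coeff (?x ^ Suc n) a = (\<Sum>r\<in>D. lam r * (if r \<in># a then coeff (?x ^ n) (a - {#r#}) else 0))"
    by (simp add: sum_distrib_right coeff_sum coeff_single_singleton_times)
  also have "\<dots> = (\<Sum>r\<in>D. of_bool (size a = Suc n) * fact n * W a * count a r)"
  proof (rule sum.cong)
    fix r assume r: "r \<in> D"
    show "lam r * (if r \<in># a then coeff (?x ^ n) (a - {#r#}) else 0)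
        = of_bool (size a = Suc n) * fact n * W a * count a r"
    proof (cases "r \<in># a")
      case True
      then obtain b where b: "a = add_mset r b" by (auto dest: multi_member_split)
      have "lam r * coeff (?x ^ n) (a - {#r#})
          = of_bool (size a = Suc n) * fact n * (lam r * W (a - {#r#}))"
        by (simp add: Suc.IH b)
      then show ?thesis using True W_remove[OF r True] by simp
    next
      case False
      then have "count a r = 0" by (simp add: not_in_iff)
      then show ?thesis using False by simp
    qed
  qed simp
  also have "\<dots> = of_bool (size a = Suc n) * fact n * W a * (\<Sum>r\<in>D. count a r)"
    by (simp add: sum_distrib_left)
  also have "\<dots> = of_bool (size a = Suc n) * (fact (Suc n) * W a)"
  proof (cases "set_mset a \<subseteq> D")
    case True
    then have "(\<Sum>r\<in>D. count a r) = size a"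
      unfolding size_multiset_overloaded_eq using finite_D
      by (intro sum.mono_neutral_right) (auto simp: not_in_iff)
    then show ?thesis by auto
  qed (simp add: W_def)
  finally show ?case .
qed

lemma coeff_exp_sum_single: "coeff (exp (\<Sum>r\<in>D. lam r *\<^sub>R single {#r#})) a = W a"
proof -
  let ?x = "\<Sum>r\<in>D. lam r *\<^sub>R single {#r#}"
  have "(\<lambda>n. coeff (?x ^ n /\<^sub>R fact n) a) sums coeff (exp ?x) a"
    by (rule bounded_linear.sums[OF bounded_linear_coeff exp_converges])
  also have "(\<lambda>n. coeff (?x ^ n /\<^sub>R fact n) a) = (\<lambda>n. if n = size a then W a else 0)"
    by (auto simp: coeff_power_sum_single fun_eq_iff)
  finally show ?thesis
    using sums_single[of "size a" "\<lambda>_. W a"] sums_unique2 by blast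
qed

text \<open>The law of a random multiset whose multiplicities are independent Poisson variables with
  means \<open>lam r\<close>; the \<open>w\<close> below is its mass function.\<close>

definition E :: "'r multiset l1" where
  "E = exp (\<Sum>r\<in>D. lam r *\<^sub>R (single {#r#} - 1))"

definition w :: "'r multiset \<Rightarrow> real" where "w a = exp (- sum lam D) * W a"

lemma E_eq: "E = exp (- sum lam D) *\<^sub>R exp (\<Sum>r\<in>D. lam r *\<^sub>R single {#r#})"
proof -
  have "(\<Sum>r\<in>D. lam r *\<^sub>R (single {#r#} - 1)) = (\<Sum>r\<in>D. lam r *\<^sub>R single {#r#}) + of_real (- sum lam D)"
    by (simp add: scaleR_diff_right sum_subtractf scaleR_left.sum of_real_def scaleR_sum_left)
  then have "E = exp ((\<Sum>r\<in>D. lam r *\<^sub>R single {#r#}) + of_real (- sum lam D))"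
    by (simp only: E_def)
  also have "\<dots> = exp (\<Sum>r\<in>D. lam r *\<^sub>R single {#r#}) * exp (of_real (- sum lam D))"
    by (rule exp_add_commuting) (rule mult.commute)
  finally show ?thesis
    by (simp only: exp_of_real scaleR_conv_of_real mult.commute)
qed

lemma coeff_E: "coeff E a = w a"
  by (simp add: E_eq coeff_exp_sum_single w_def)

lemma norm_E_le: "norm E \<le> 1"
proof -
  have "norm (\<Sum>r\<in>D. lam r *\<^sub>R single {#r#}) \<le> sum lam D"
    by (rule order_trans[OF norm_sum]) (simp add: lam_pos less_imp_le cong: sum.cong)
  then have "norm (exp (\<Sum>r\<in>D. lam r *\<^sub>R single {#r#})) \<le> exp (sum lam D)"
    by (meson norm_exp exp_le_cancel_iff order_trans)
  then show ?thesis by (simp add: E_eq exp_minus field_simps)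
qed

lemma w_nonneg: "0 \<le> w a"
  by (simp add: w_def W_nonneg)

lemma w_add_mset: "r \<in> D \<Longrightarrow> w (add_mset r a) * (count a r + 1) = lam r * w a"
  using W_add_mset[of r a] by (simp add: w_def mult.assoc mult.left_commute)

section \<open>Integrability under the Poisson law\<close>

lemma summable_w_power: "0 < K \<Longrightarrow> (\<lambda>a. w a * K ^ size a) summable_on UNIV"
proof -
  assume "0 < K"
  \<comment> \<open>Multiplying all intensities by \<open>K\<close> multiplies the weight of
    \<open>a\<close> by \<open>K ^ size a\<close>, so the claim is again the summability of an
    exponential in the algebra.\<close>
  interpret K: poisson_weights D "\<lambda>r. K * lam r"
    by standard (use finite_D lam_pos \<open>0 < K\<close> in auto)
  have "K.W a = W a * K ^ size a" for a
  proof (cases "set_mset a \<subseteq> D")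
    case True
    then have "(\<Sum>r\<in>D. count a r) = size a"
      unfolding size_multiset_overloaded_eq using finite_D
      by (intro sum.mono_neutral_right) (auto simp: not_in_iff)
    then have "(\<Prod>r\<in>D. K ^ count a r) = K ^ size a"
      by (simp add: power_sum[symmetric])
    then show ?thesis
      by (simp add: W_def K.W_def power_mult_distrib prod.distrib times_divide_eq_right[symmetric]
          mult.commute del: times_divide_eq_right)
  qed (simp add: W_def K.W_def)
  then have "coeff (exp (- sum lam D) *\<^sub>R exp (\<Sum>r\<in>D. (K * lam r) *\<^sub>R single {#r#})) a = w a * K ^ size a" for a
    by (simp add: w_def K.coeff_exp_sum_single)
  then show ?thesis using coeff_summable by (metis (no_types, lifting) summable_on_cong)
qed

text \<open>A class of integrable functions closed under products, shifts and multiplication by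
  counts, hence under the operators below; integrability then follows from the form of an
  expression. The condition \<open>1 \<le> K\<close> makes the bound monotone in the size.\<close>

definition exp_bounded :: "('r multiset \<Rightarrow> real) \<Rightarrow> bool" where
  "exp_bounded c \<longleftrightarrow> (\<exists>C K. 1 \<le> K \<and> (\<forall>a. \<bar>c a\<bar> \<le> C * K ^ size a))"

lemma exp_boundedI: "1 \<le> K \<Longrightarrow> (\<And>a. \<bar>c a\<bar> \<le> C * K ^ size a) \<Longrightarrow> exp_bounded c"
  by (auto simp: exp_bounded_def)

lemma exp_boundedE:
  assumes "exp_bounded c"
  obtains C K where "1 \<le> K" "0 \<le> C" "\<And>a. \<bar>c a\<bar> \<le> C * K ^ size a"
proof -
  obtain C K where K: "1 \<le> K" "\<And>a. \<bar>c a\<bar> \<le> C * K ^ size a"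
    using assms by (auto simp: exp_bounded_def)
  moreover have "0 \<le> C" using K(2)[of "{#}"] by simp
  ultimately show ?thesis using that by blast
qed

lemma summable_w_exp_bounded: "exp_bounded c \<Longrightarrow> (\<lambda>a. w a * c a) summable_on UNIV"
proof -
  assume "exp_bounded c"
  then obtain C K where K: "1 \<le> K" "0 \<le> C" "\<And>a. \<bar>c a\<bar> \<le> C * K ^ size a"
    by (rule exp_boundedE) blast
  have "(\<lambda>a. w a * c a) abs_summable_on UNIV"
  proof (rule Infinite_Sum.abs_summable_on_comparison_test)
    show "(\<lambda>a. C * (w a * K ^ size a)) abs_summable_on UNIV"
      by (rule summable_on_iff_abs_summable_on_real[THEN iffD1])
        (use K(1) in \<open>intro summable_on_cmult_right summable_w_power, simp\<close>)
    show "norm (w a * c a) \<le> norm (C * (w a * K ^ size a))" for a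
      using mult_left_mono[OF K(3)[of a] w_nonneg[of a]] K(1,2) w_nonneg[of a]
      by (simp add: abs_mult mult.left_commute)
  qed
  then show ?thesis by (rule summable_on_iff_abs_summable_on_real[THEN iffD2])
qed

lemma exp_bounded_const: "exp_bounded (\<lambda>_. c)"
  by (rule exp_boundedI[of 1 _ "\<bar>c\<bar>"]) auto

lemma exp_bounded_add:
  assumes "exp_bounded c" "exp_bounded d"
  shows "exp_bounded (\<lambda>a. c a + d a)"
proof -
  obtain C K where K: "1 \<le> K" "0 \<le> C" "\<And>a. \<bar>c a\<bar> \<le> C * K ^ size a"
    using assms(1) by (rule exp_boundedE) blast
  obtain C' K' where K': "1 \<le> K'" "0 \<le> C'" "\<And>a. \<bar>d a\<bar> \<le> C' * K' ^ size a"
    using assms(2) by (rule exp_boundedE) blast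
  show ?thesis
  proof (rule exp_boundedI)
    show "1 \<le> max K K'" using K(1) by simp
    fix a :: "'r multiset"
    have "C * K ^ size a \<le> C * max K K' ^ size a" "C' * K' ^ size a \<le> C' * max K K' ^ size a"
      using K K' by (auto intro!: mult_left_mono power_mono)
    then show "\<bar>c a + d a\<bar> \<le> (C + C') * max K K' ^ size a"
      using K(3)[of a] K'(3)[of a] by (simp add: distrib_right)
  qed
qed

lemma exp_bounded_mult:
  assumes "exp_bounded c" "exp_bounded d"
  shows "exp_bounded (\<lambda>a. c a * d a)"
proof -
  obtain C K where K: "1 \<le> K" "0 \<le> C" "\<And>a. \<bar>c a\<bar> \<le> C * K ^ size a"
    using assms(1) by (rule exp_boundedE) blast
  obtain C' K' where K': "1 \<le> K'" "0 \<le> C'" "\<And>a. \<bar>d a\<bar> \<le> C' * K' ^ size a"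
    using assms(2) by (rule exp_boundedE) blast
  show ?thesis
  proof (rule exp_boundedI)
    show "1 \<le> K * K'" using mult_mono[OF K(1) K'(1)] K(1) by simp
    fix a :: "'r multiset"
    have "\<bar>c a * d a\<bar> \<le> (C * K ^ size a) * (C' * K' ^ size a)"
      unfolding abs_mult using K K' by (intro mult_mono) auto
    then show "\<bar>c a * d a\<bar> \<le> (C * C') * (K * K') ^ size a"
      by (simp add: power_mult_distrib mult_ac)
  qed
qed

lemma exp_bounded_cmult: "exp_bounded c \<Longrightarrow> exp_bounded (\<lambda>a. x * c a)"
  by (rule exp_bounded_mult[OF exp_bounded_const])

lemma exp_bounded_diff: "exp_bounded c \<Longrightarrow> exp_bounded d \<Longrightarrow> exp_bounded (\<lambda>a. c a - d a)"
  using exp_bounded_add[of c "\<lambda>a. (-1) * d a"] exp_bounded_cmult[of d "-1"] by simp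

lemma exp_bounded_sum:
  "(\<And>i. i \<in> I \<Longrightarrow> exp_bounded (c i)) \<Longrightarrow> exp_bounded (\<lambda>a. \<Sum>i\<in>I. c i a)"
  by (induction I rule: infinite_finite_induct) (auto intro: exp_bounded_const exp_bounded_add)

lemma exp_bounded_abs: "exp_bounded c \<Longrightarrow> exp_bounded (\<lambda>a. \<bar>c a\<bar>)"
  by (simp add: exp_bounded_def)

lemma exp_bounded_add_mset:
  assumes "exp_bounded c"
  shows "exp_bounded (\<lambda>a. c (add_mset r a))"
proof -
  obtain C K where K: "1 \<le> K" "0 \<le> C" "\<And>a. \<bar>c a\<bar> \<le> C * K ^ size a"
    using assms by (rule exp_boundedE) blast
  show ?thesis
    by (rule exp_boundedI[OF K(1), of _ "C * K"]) (use K(3)[of "add_mset r _"] in \<open>simp add: mult_ac\<close>)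
qed

lemma exp_bounded_remove:
  assumes "exp_bounded c"
  shows "exp_bounded (\<lambda>a. c (a - {#r#}))"
proof -
  obtain C K where K: "1 \<le> K" "0 \<le> C" "\<And>a. \<bar>c a\<bar> \<le> C * K ^ size a"
    using assms by (rule exp_boundedE) blast
  show ?thesis
  proof (rule exp_boundedI[OF K(1)])
    fix a :: "'r multiset"
    have "C * K ^ size (a - {#r#}) \<le> C * K ^ size a"
      using K(1,2) by (intro mult_left_mono power_increasing size_mset_mono) auto
    then show "\<bar>c (a - {#r#})\<bar> \<le> C * K ^ size a" using K(3)[of "a - {#r#}"] by linarith
  qed
qed

lemma exp_bounded_count: "exp_bounded (\<lambda>a. real (count a r))"
proof (rule exp_boundedI[of 2 _ 1])
  fix a
  have "count a r \<le> size a" by (rule count_le_size)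
  also have "\<dots> < 2 ^ size a" by (rule less_exp)
  finally have "real (count a r) < real (2 ^ size a)" by (simp only: of_nat_less_iff)
  then show "\<bar>real (count a r)\<bar> \<le> 1 * 2 ^ size a" by simp
qed simp

section \<open>Creation and annihilation operators\<close>

definition creation :: "('r \<Rightarrow> real) \<Rightarrow> ('r multiset \<Rightarrow> real) \<Rightarrow> 'r multiset \<Rightarrow> real" where
  "creation v c a = (\<Sum>r\<in>D. v r * (count a r / lam r * c (a - {#r#}) - c a))"

definition annihilation :: "('r \<Rightarrow> real) \<Rightarrow> ('r multiset \<Rightarrow> real) \<Rightarrow> 'r multiset \<Rightarrow> real" where
  "annihilation v c a = (\<Sum>r\<in>D. v r * (c (add_mset r a) - c a))"

definition ip :: "('r \<Rightarrow> real) \<Rightarrow> ('r \<Rightarrow> real) \<Rightarrow> real" where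
  "ip v v' = (\<Sum>r\<in>D. v r * v' r / lam r)"

definition Ex :: "('r multiset \<Rightarrow> real) \<Rightarrow> real" where
  "Ex c = (\<Sum>\<^sub>\<infinity>a. w a * c a)"

lemma exp_bounded_creation: "exp_bounded c \<Longrightarrow> exp_bounded (creation v c)"
  unfolding creation_def divide_inverse
  by (intro exp_bounded_sum exp_bounded_cmult exp_bounded_diff exp_bounded_mult exp_bounded_count
      exp_bounded_const exp_bounded_remove) auto

lemma Ex_add: "exp_bounded c \<Longrightarrow> exp_bounded d \<Longrightarrow> Ex (\<lambda>a. c a + d a) = Ex c + Ex d"
  unfolding Ex_def distrib_left by (intro infsum_add summable_w_exp_bounded)

lemma Ex_cmult: "Ex (\<lambda>a. x * c a) = x * Ex c"
  unfolding Ex_def mult.left_commute[of _ x] by (rule infsum_cmult_right')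

lemma Ex_diff: "exp_bounded c \<Longrightarrow> exp_bounded d \<Longrightarrow> Ex (\<lambda>a. c a - d a) = Ex c - Ex d"
  using Ex_add[of c "\<lambda>a. (-1) * d a"] exp_bounded_cmult[of d "-1"] Ex_cmult[of "-1" d] by simp

lemma Ex_sum:
  "(\<And>i. i \<in> I \<Longrightarrow> exp_bounded (c i)) \<Longrightarrow> Ex (\<lambda>a. \<Sum>i\<in>I. c i a) = (\<Sum>i\<in>I. Ex (c i))"
proof (induction I rule: infinite_finite_induct)
  case (insert i I)
  then show ?case by (simp add: Ex_add exp_bounded_sum)
qed (simp_all add: Ex_def)

text \<open>Mecke's formula for the Poisson law. Multisets without \<open>r\<close> are removed by
  the factor \<open>count a r\<close>; all others are \<open>add_mset r\<close> of a unique
  multiset, and the recursion for \<open>w\<close> cancels the quotient.\<close>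

lemma Ex_shift:
  assumes r: "r \<in> D"
  shows "Ex (\<lambda>a. count a r / lam r * c (a - {#r#}) * h a) = Ex (\<lambda>a. c a * h (add_mset r a))"
proof -
  have "Ex (\<lambda>a. count a r / lam r * c (a - {#r#}) * h a)
      = (\<Sum>\<^sub>\<infinity>a\<in>range (add_mset r). w a * (count a r / lam r * c (a - {#r#}) * h a))"
    unfolding Ex_def
  proof (rule infsum_cong_neutral)
    fix a assume "a \<in> UNIV - range (add_mset r)"
    then have "r \<notin># a" by (auto dest: multi_member_split)
    then show "w a * (count a r / lam r * c (a - {#r#}) * h a) = 0" by (simp add: not_in_iff)
  qed auto
  also have "\<dots> = (\<Sum>\<^sub>\<infinity>a. w (add_mset r a) * ((count a r + 1) / lam r * c a * h (add_mset r a)))"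
    by (subst infsum_reindex) (auto simp: inj_on_def o_def add.commute)
  also have "\<dots> = (\<Sum>\<^sub>\<infinity>a. w a * (c a * h (add_mset r a)))"
  proof (rule infsum_cong)
    fix a :: "'r multiset"
    have "w (add_mset r a) * ((count a r + 1) / lam r * c a * h (add_mset r a))
        = (w (add_mset r a) * (count a r + 1)) / lam r * (c a * h (add_mset r a))" by simp
    also have "\<dots> = w a * (c a * h (add_mset r a))"
      unfolding w_add_mset[OF r] using lam_pos[OF r] by simp
    finally show "w (add_mset r a) * ((count a r + 1) / lam r * c a * h (add_mset r a))
        = w a * (c a * h (add_mset r a))" .
  qed
  finally show ?thesis by (simp add: Ex_def)
qed

text \<open>Creation and annihilation are adjoint in \<open>L^2\<close> of the Poisson law, by
  Mecke's formula applied to each type.\<close>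

lemma Ex_creation:
  assumes c: "exp_bounded c" and h: "exp_bounded h"
  shows "Ex (\<lambda>a. creation v c a * h a) = Ex (\<lambda>a. c a * annihilation v h a)"
proof -
  note eb = exp_bounded_cmult exp_bounded_diff exp_bounded_mult exp_bounded_count
      exp_bounded_const exp_bounded_remove exp_bounded_add_mset c h
  have "Ex (\<lambda>a. creation v c a * h a)
      = Ex (\<lambda>a. \<Sum>r\<in>D. v r * (count a r / lam r * c (a - {#r#}) * h a - c a * h a))"
    by (rule arg_cong[of _ _ Ex])
      (simp add: fun_eq_iff creation_def sum_distrib_left sum_distrib_right algebra_simps)
  also have "\<dots> = (\<Sum>r\<in>D. v r * (Ex (\<lambda>a. count a r / lam r * c (a - {#r#}) * h a) - Ex (\<lambda>a. c a * h a)))"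
    unfolding divide_inverse
    by (subst Ex_sum, (intro eb)[1]) (intro sum.cong refl, simp only: Ex_cmult, subst Ex_diff, (intro eb)+, simp)
  also have "\<dots> = (\<Sum>r\<in>D. v r * (Ex (\<lambda>a. c a * h (add_mset r a)) - Ex (\<lambda>a. c a * h a)))"
    by (intro sum.cong refl) (simp only: Ex_shift)
  also have "\<dots> = Ex (\<lambda>a. \<Sum>r\<in>D. v r * (c a * h (add_mset r a) - c a * h a))"
    by (subst Ex_sum, (intro eb)[1]) (intro sum.cong refl, simp only: Ex_cmult, subst Ex_diff, (intro eb)+, simp)
  also have "\<dots> = Ex (\<lambda>a. c a * annihilation v h a)"
    by (rule arg_cong[of _ _ Ex])
      (simp add: fun_eq_iff annihilation_def sum_distrib_left algebra_simps)
  finally show ?thesis .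
qed

text \<open>The canonical commutation relation. Adding \<open>s\<close> changes the count of
  \<open>r\<close> only if \<open>r = s\<close>, so apart from the swapped operators only a diagonal
  sum survives, and that is \<open>ip v v'\<close>.\<close>

lemma annihilation_creation:
  "annihilation v' (creation v c) a = creation v (annihilation v' c) a + ip v v' * c a"
proof -
  have *: "(count (add_mset s a) r / lam r * c (add_mset s a - {#r#}) - c (add_mset s a)
        - (count a r / lam r * c (a - {#r#}) - c a))
      = (count a r / lam r * (c (add_mset s (a - {#r#})) - c (a - {#r#})) - (c (add_mset s a) - c a))
        + of_bool (r = s) / lam r * c a" for r s
  proof (cases "r \<in># a")
    case True
    then obtain b where "a = add_mset r b" by (auto dest: multi_member_split)
    then show ?thesis
      by (cases "r = s") (auto simp: algebra_simps add_divide_distrib diff_divide_distrib)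
  next
    case False
    \<comment> \<open>Removing \<open>r\<close> from \<open>a\<close> leaves \<open>a\<close>
      unchanged here, but that value is multiplied by a zero count.\<close>
    then have "count a r = 0" by (simp add: not_in_iff)
    then show ?thesis by (auto simp: algebra_simps)
  qed
  have "annihilation v' (creation v c) a
      = (\<Sum>s\<in>D. \<Sum>r\<in>D. v' s * v r * (count (add_mset s a) r / lam r * c (add_mset s a - {#r#}) - c (add_mset s a)
        - (count a r / lam r * c (a - {#r#}) - c a)))"
    unfolding annihilation_def creation_def sum_subtractf[symmetric] sum_distrib_left
    by (intro sum.cong refl) (simp add: right_diff_distrib mult.assoc)
  also have "\<dots> = (\<Sum>s\<in>D. \<Sum>r\<in>D. v' s * v r *
        (count a r / lam r * (c (add_mset s (a - {#r#})) - c (a - {#r#})) - (c (add_mset s a) - c a)))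
      + (\<Sum>s\<in>D. \<Sum>r\<in>D. v' s * v r * (of_bool (r = s) / lam r * c a))"
    unfolding * distrib_left sum.distrib ..
  also have "(\<Sum>s\<in>D. \<Sum>r\<in>D. v' s * v r *
        (count a r / lam r * (c (add_mset s (a - {#r#})) - c (a - {#r#})) - (c (add_mset s a) - c a)))
      = creation v (annihilation v' c) a"
    unfolding annihilation_def creation_def sum_distrib_left sum_subtractf[symmetric]
    by (subst sum.swap) (intro sum.cong refl, simp add: right_diff_distrib mult_ac)
  also have "(\<Sum>s\<in>D. \<Sum>r\<in>D. v' s * v r * (of_bool (r = s) / lam r * c a)) = ip v v' * c a"
  proof -
    have "(\<Sum>r\<in>D. v' s * v r * (of_bool (r = s) / lam r * c a)) = v s * v' s / lam s * c a"
      if "s \<in> D" for s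
    proof -
      have "(\<Sum>r\<in>D. v' s * v r * (of_bool (r = s) / lam r * c a))
          = (\<Sum>r\<in>D. if r = s then v s * v' s / lam s * c a else 0)"
        by (rule sum.cong) auto
      then show ?thesis using that finite_D by simp
    qed
    then show ?thesis by (simp add: ip_def sum_distrib_right cong: sum.cong)
  qed
  finally show ?thesis .
qed


text \<open>Iterated creation applied to the constant 1. For a single type and equal vectors these
  are, up to normalization, the Charlier polynomials.\<close>

fun creations :: "('r \<Rightarrow> real) list \<Rightarrow> 'r multiset \<Rightarrow> real" where
  "creations [] = (\<lambda>_. 1)"
| "creations (v # vs) = creation v (creations vs)"

lemma exp_bounded_creations: "exp_bounded (creations vs)"
  by (induction vs) (auto intro: exp_bounded_const exp_bounded_creation)

lemma creation_sum: "creation v (\<lambda>a. \<Sum>i\<in>I. x i * c i a) = (\<lambda>a. \<Sum>i\<in>I. x i * creation v (c i) a)"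
  unfolding creation_def fun_eq_iff sum_distrib_left sum_subtractf[symmetric]
  by (subst sum.swap) (auto intro!: sum.cong simp: algebra_simps)

text \<open>The annihilation operator is commuted through the list: each position contributes one
  inner product, and the constant 1 at the end is annihilated.\<close>

lemma annihilation_creations:
  "annihilation v (creations vs) a
    = (\<Sum>i<length vs. ip (vs ! i) v * creations (take i vs @ drop (Suc i) vs) a)"
proof (induction vs arbitrary: a)
  case Nil
  show ?case by (simp add: annihilation_def)
next
  case (Cons v' vs)
  have IH: "annihilation v (creations vs)
      = (\<lambda>a. \<Sum>i<length vs. ip (vs ! i) v * creations (take i vs @ drop (Suc i) vs) a)"
    by (rule ext) (rule Cons.IH)
  show ?case
    by (simp add: annihilation_creation IH creation_sum sum.lessThan_Suc_shift del: sum.lessThan_Suc)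
qed

lemma ip_self_nonneg: "0 \<le> ip v v"
  unfolding ip_def using lam_pos by (auto intro!: sum_nonneg divide_nonneg_pos)

lemma abs_ip_le: "\<bar>ip v v'\<bar> \<le> sqrt (ip v v) * sqrt (ip v' v')"
proof -
  have "(\<Sum>r\<in>D. (v r / sqrt (lam r)) * (v' r / sqrt (lam r))) = ip v v'"
    unfolding ip_def using lam_pos by (intro sum.cong) (auto simp: less_imp_le)
  moreover have "(\<Sum>r\<in>D. (v r / sqrt (lam r))\<^sup>2) = ip v v" for v
    unfolding ip_def using lam_pos by (intro sum.cong) (auto simp: less_imp_le power2_eq_square)
  ultimately have "(ip v v')\<^sup>2 \<le> ip v v * ip v' v'"
    using Cauchy_Schwarz_ineq_sum[of "\<lambda>r. v r / sqrt (lam r)" "\<lambda>r. v' r / sqrt (lam r)" D] by simp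
  then show ?thesis
    by (metis real_sqrt_abs real_sqrt_le_mono real_sqrt_mult)
qed

text \<open>The left-hand side is the permanent of the matrix of the inner products of the vectors.\<close>

lemma abs_Ex_creations_le:
  assumes "length us = length vs"
  shows "\<bar>Ex (\<lambda>a. creations us a * creations vs a)\<bar>
    \<le> fact (length us) * (\<Prod>v\<leftarrow>us. sqrt (ip v v)) * (\<Prod>v\<leftarrow>vs. sqrt (ip v v))"
  using assms
proof (induction us arbitrary: vs)
  case Nil
  have "Ex (\<lambda>a. 1) = norm E"
    by (simp add: Ex_def norm_l1_def coeff_E w_nonneg)
  then show ?case using Nil norm_E_le by simp
next
  case (Cons u us)
  let ?n = "\<lambda>v. sqrt (ip v v)"
  let ?P = "\<lambda>vs. \<Prod>v\<leftarrow>vs. ?n v"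
  have P0: "0 \<le> ?P vs" for vs
    by (rule prod_list_nonneg) (auto simp: ip_self_nonneg)
  have len: "length vs = Suc (length us)" using Cons.prems by simp
  have "Ex (\<lambda>a. creations (u # us) a * creations vs a)
      = Ex (\<lambda>a. creations us a * annihilation u (creations vs) a)"
    by (simp add: Ex_creation exp_bounded_creations)
  also have "\<dots> = Ex (\<lambda>a. \<Sum>i<length vs. ip (vs ! i) u * (creations us a * creations (take i vs @ drop (Suc i) vs) a))"
    by (simp add: annihilation_creations sum_distrib_left mult_ac)
  also have "\<dots> = (\<Sum>i<length vs. ip (vs ! i) u * Ex (\<lambda>a. creations us a * creations (take i vs @ drop (Suc i) vs) a))"
    by (subst Ex_sum) (simp_all only: Ex_cmult exp_bounded_cmult exp_bounded_mult exp_bounded_creations)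
  finally have "\<bar>Ex (\<lambda>a. creations (u # us) a * creations vs a)\<bar>
      \<le> (\<Sum>i<length vs. \<bar>ip (vs ! i) u\<bar> * \<bar>Ex (\<lambda>a. creations us a * creations (take i vs @ drop (Suc i) vs) a)\<bar>)"
    by (simp only: abs_mult[symmetric] sum_abs)
  \<comment> \<open>Expanding the permanent along the row of \<open>u\<close> leaves
    \<open>Suc (length us)\<close> terms with a common bound; their number supplies the next factor
    of the factorial.\<close>
  also have "\<dots> \<le> (\<Sum>i<length vs. fact (length us) * (?n u * ?P us) * ?P vs)"
  proof (rule sum_mono)
    fix i assume "i \<in> {..<length vs}"
    then have i: "i < length vs" by simp
    let ?vs = "take i vs @ drop (Suc i) vs"
    have "length us = length ?vs" using i len by simp
    from Cons.IH[OF this] have "\<bar>ip (vs ! i) u\<bar> * \<bar>Ex (\<lambda>a. creations us a * creations ?vs a)\<bar>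
        \<le> (?n (vs ! i) * ?n u) * (fact (length us) * ?P us * ?P ?vs)"
      by (intro mult_mono abs_ip_le) (auto simp: ip_self_nonneg)
    also have "\<dots> = fact (length us) * (?n u * ?P us) * ?P (take i vs @ vs ! i # drop (Suc i) vs)"
      by (simp add: mult_ac)
    also have "take i vs @ vs ! i # drop (Suc i) vs = vs"
      using i by (rule id_take_nth_drop[symmetric])
    finally show "\<bar>ip (vs ! i) u\<bar> * \<bar>Ex (\<lambda>a. creations us a * creations ?vs a)\<bar>
        \<le> fact (length us) * (?n u * ?P us) * ?P vs" .
  qed
  finally show ?case by (simp add: len mult_ac)
qed

section \<open>Norms of products of steps under the Poisson law\<close>

definition step :: "('r \<Rightarrow> real) \<Rightarrow> 'r multiset l1" where
  "step v = (\<Sum>r\<in>D. v r *\<^sub>R (single {#r#} - 1))"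

text \<open>The origin of the formula for \<open>creation\<close>: convolution with
  \<open>single {#r#}\<close> shifts the Poisson weights, and
  \<open>w (a - {#r#}) / w a = count a r / lam r\<close> where \<open>w a\<close> is positive and
  \<open>r\<close> occurs in \<open>a\<close>. Thus a step acts on densities as a creation
  operator.\<close>

lemma coeff_step_times:
  assumes "\<And>a. coeff f a = w a * c a"
  shows "coeff (step v * f) a = w a * creation v c a"
proof -
  have "coeff (step v * f) a = (\<Sum>r\<in>D. v r * (coeff (single {#r#} * f) a - coeff f a))"
    by (simp add: step_def sum_distrib_right coeff_sum left_diff_distrib)
  also have "\<dots> = (\<Sum>r\<in>D. w a * (v r * (count a r / lam r * c (a - {#r#}) - c a)))"
  proof (rule sum.cong)
    fix r assume r: "r \<in> D"
    have "coeff (single {#r#} * f) a = w a * (count a r / lam r * c (a - {#r#}))"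
    proof (cases "r \<in># a")
      case True
      then obtain b where b: "a = add_mset r b" by (auto dest: multi_member_split)
      have "coeff (single {#r#} * f) a = (lam r * w b) / lam r * c b"
        using lam_pos[OF r] by (simp add: coeff_single_singleton_times assms b)
      then show ?thesis unfolding w_add_mset[OF r, symmetric] by (simp add: b add.commute)
    next
      case False
      then have "count a r = 0" by (simp add: not_in_iff)
      then show ?thesis using False by (simp add: coeff_single_singleton_times)
    qed
    then show "v r * (coeff (single {#r#} * f) a - coeff f a)
        = w a * (v r * (count a r / lam r * c (a - {#r#}) - c a))"
      by (simp add: assms algebra_simps)
  qed simp
  finally show ?thesis by (simp add: creation_def sum_distrib_left)
qed

lemma coeff_steps_E: "coeff ((\<Prod>v\<leftarrow>vs. step v) * E) a = w a * creations vs a"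
proof (induction vs arbitrary: a)
  case (Cons v vs)
  show ?case using coeff_step_times[OF Cons.IH] by (simp add: mult.assoc)
qed (simp add: coeff_E)

text \<open>By the Cauchy--Schwarz inequality, the norm of a signed measure with density \<open>c\<close> with respect to
  a Poisson distribution is at most the \<open>L\<^sup>2\<close> norm of \<open>c\<close>.\<close>

lemma norm_steps_E_le:
  "norm ((\<Prod>v\<leftarrow>vs. step v) * E) \<le> sqrt (fact (length vs)) * (\<Prod>v\<leftarrow>vs. sqrt (ip v v))"
proof -
  let ?c = "creations vs" and ?P = "\<Prod>v\<leftarrow>vs. sqrt (ip v v)"
  define N where "N = norm ((\<Prod>v\<leftarrow>vs. step v) * E)"
  have P0: "0 \<le> ?P" by (rule prod_list_nonneg) (auto simp: ip_self_nonneg)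
  note eb = exp_bounded_creations exp_bounded_mult exp_bounded_cmult exp_bounded_const exp_bounded_abs
    exp_bounded_add exp_bounded_diff
  have N: "N = Ex (\<lambda>a. \<bar>?c a\<bar>)"
    unfolding N_def norm_l1_def Ex_def by (simp add: coeff_steps_E abs_mult w_nonneg)
  have one: "Ex (\<lambda>_. 1) \<le> 1"
    using norm_E_le by (simp add: Ex_def norm_l1_def coeff_E w_nonneg)
  \<comment> \<open>The Cauchy--Schwarz inequality in the form of a nonnegative second moment about
    \<open>N\<close>; as the total mass is at most 1, it gives
    \<open>N\<^sup>2 \<le> Ex (\<lambda>a. ?c a * ?c a)\<close>.\<close>
  have "0 \<le> Ex (\<lambda>a. (\<bar>?c a\<bar> - N)\<^sup>2)"
    unfolding Ex_def by (rule infsum_nonneg) (simp add: w_nonneg)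
  also have "(\<lambda>a. (\<bar>?c a\<bar> - N)\<^sup>2) = (\<lambda>a. (?c a * ?c a - (2 * N) * \<bar>?c a\<bar>) + N\<^sup>2 * 1)"
    by (simp add: fun_eq_iff power2_eq_square algebra_simps)
  also have "Ex \<dots> = Ex (\<lambda>a. ?c a * ?c a) - 2 * N * N + N\<^sup>2 * Ex (\<lambda>_. 1)"
    unfolding N by (subst Ex_add, (intro eb)+, subst Ex_diff, (intro eb)+, simp only: Ex_cmult)
  also have "\<dots> \<le> Ex (\<lambda>a. ?c a * ?c a) - 2 * N * N + N\<^sup>2 * 1"
    by (intro add_left_mono mult_left_mono one) simp
  finally have "N\<^sup>2 \<le> Ex (\<lambda>a. ?c a * ?c a)" by (simp add: power2_eq_square)
  also have "\<dots> \<le> fact (length vs) * ?P * ?P"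
    using abs_Ex_creations_le[of vs vs] by simp
  also have "\<dots> = (sqrt (fact (length vs)) * ?P)\<^sup>2"
    by (simp add: power_mult_distrib) (simp add: power2_eq_square)
  finally show ?thesis
    unfolding N_def[symmetric] by (rule power2_le_imp_le) (simp add: P0)
qed

lemma norm_prod_step_E_le:
  assumes "finite I"
  shows "norm ((\<Prod>i\<in>I. step (v i)) * E) \<le> sqrt (fact (card I)) * (\<Prod>i\<in>I. sqrt (ip (v i) (v i)))"
proof -
  obtain xs where xs: "set xs = I" "distinct xs"
    using finite_distinct_list[OF assms] by blast
  then show ?thesis
    using norm_steps_E_le[of "map v xs"]
    by (simp add: prod.distinct_set_conv_list[of xs, simplified xs(1)] distinct_card[symmetric] o_def)
qed

end

section \<open>Kerstan's method\<close>

lemma l1_exp_add: "exp (f + g) = exp f * exp (g :: 'i::comm_monoid_add l1)"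
  by (rule exp_add_commuting) (rule mult.commute)

lemma l1_exp_sum: "exp (sum f A) = (\<Prod>i\<in>A. exp (f i :: 'i::comm_monoid_add l1))"
  by (induction A rule: infinite_finite_induct) (auto simp: l1_exp_add)

lemma norm_prod_le_l1: "norm (prod f A) \<le> (\<Prod>i\<in>A. norm (f i :: 'i::comm_monoid_add l1))"
proof (induction A rule: infinite_finite_induct)
  case (insert i A)
  then show ?case
    using norm_mult_ineq[of "f i" "prod f A"] mult_left_mono[of "norm (prod f A)" _ "norm (f i)"]
    by fastforce
qed auto

text \<open>Splitting off the scalar \<open>exp (- s)\<close> compensates the growth
  \<open>exp s\<close> of the remaining exponential, as for a compound Poisson law.\<close>

lemma norm_exp_scaleR_diff_one_le:
  fixes Q :: "'i::comm_monoid_add l1"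
  assumes "norm Q \<le> 1" "0 \<le> s"
  shows "norm (exp (s *\<^sub>R (Q - 1))) \<le> 1"
proof -
  have "s *\<^sub>R (Q - 1) = s *\<^sub>R Q + of_real (- s)"
    by (simp add: algebra_simps of_real_def)
  then have "exp (s *\<^sub>R (Q - 1)) = exp (- s) *\<^sub>R exp (s *\<^sub>R Q)"
    by (simp only: l1_exp_add exp_of_real) (simp add: scaleR_conv_of_real mult.commute)
  moreover have "norm (exp (s *\<^sub>R Q)) \<le> exp s"
    using norm_exp[of "s *\<^sub>R Q"] mult_left_mono[OF assms] assms(2)
    by (smt (verit) exp_le_cancel_iff mult_cancel_left2 norm_scaleR)
  ultimately show ?thesis by (simp add: exp_minus field_simps)
qed

text \<open>The integral of \<open>t exp (2 max {t - e, 0})\<close> over \<open>[0, 1]\<close>.\<close>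

definition kappa :: "real \<Rightarrow> real" where
  "kappa e = e\<^sup>2 / 2 + exp (2 * (1 - e)) / 4 - (e / 2 - 1 / 4)"

lemma kappa_1: "kappa 1 = 1 / 2"
  by (simp add: kappa_def)

text \<open>The fifth power of \<open>exp (4/5)\<close> is the fourth power of \<open>exp 1\<close>,
  so a decimal bound for \<open>e\<close> and rational arithmetic suffice.\<close>

lemma kappa_3_5_le: "kappa (3/5) \<le> 0.6864"
proof -
  have "exp 1 \<le> (2.7182819 :: real)" using e_approx_32[unfolded abs_le_iff] by simp
  then have "exp (4/5 :: real) ^ 5 \<le> 2.7182819 ^ 4"
    using power_mono[of "exp 1" "2.7182819 :: real" 4] by (simp add: exp_of_nat_mult[symmetric])
  also have "\<dots> \<le> (2.2256 :: real) ^ 5" by (simp add: power_divide)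
  finally have "exp (4/5 :: real) \<le> 2.2256"
    by (rule power_le_imp_le_base[of _ 4, simplified]) simp
  then show ?thesis by (simp add: kappa_def power2_eq_square)
qed

lemma kappa_3_5_nonneg: "0 \<le> kappa (3/5)"
  using exp_ge_add_one_self[of "4/5 :: real"] by (simp add: kappa_def power2_eq_square)

text \<open>The path \<open>t \<mapsto> (1 + t R) exp ((e - t) R) X\<close> has derivative \<open>- t R\<^sup>2 exp ((e - t) R) X\<close>;
  the mean value inequality is applied on \<open>[0, e]\<close>, where \<open>exp ((e - t) R)\<close> is a contraction,
  and on \<open>[e, 1]\<close>.\<close>

lemma norm_kerstan_factor_le:
  fixes R X :: "'i::comm_monoid_add l1"
  assumes contr: "\<And>s. 0 \<le> s \<Longrightarrow> norm (exp (s *\<^sub>R R)) \<le> 1" and R: "norm R \<le> 2"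
    and e: "0 < e" "e \<le> 1"
  shows "norm (((1 + R) * exp (- R) - 1) * exp (e *\<^sub>R R) * X) \<le> kappa e * norm (R\<^sup>2 * X)"
proof -
  define Y where "Y = exp (e *\<^sub>R R) * X"
  define f where "f t = (1 + t *\<^sub>R R) * exp (t *\<^sub>R (- R)) * Y" for t :: real
  define f' where "f' t = (- t) *\<^sub>R (exp ((e - t) *\<^sub>R R) * (R\<^sup>2 * X))" for t :: real
  define N where "N = norm (R\<^sup>2 * X)"
  have ex: "exp (t *\<^sub>R (- R)) * exp (e *\<^sub>R R) = exp ((e - t) *\<^sub>R R)" for t
    unfolding l1_exp_add[symmetric] by (simp add: algebra_simps)
  have deriv: "(f has_vector_derivative f' t) (at t)" for t
  proof -
    have "(f has_vector_derivative
        ((1 + t *\<^sub>R R) * (exp (t *\<^sub>R (- R)) * (- R)) + R * exp (t *\<^sub>R (- R))) * Y) (at t)"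
      unfolding f_def
      by (rule derivative_eq_intros exp_scaleR_has_vector_derivative_right refl)+ simp
    also have "((1 + t *\<^sub>R R) * (exp (t *\<^sub>R (- R)) * (- R)) + R * exp (t *\<^sub>R (- R))) * Y
        = (- t) *\<^sub>R (exp (t *\<^sub>R (- R)) * exp (e *\<^sub>R R) * (R\<^sup>2 * X))"
      by (simp add: Y_def algebra_simps power2_eq_square)
    finally show ?thesis by (simp only: ex f'_def)
  qed
  have cont: "continuous_on S f" for S
    by (rule continuous_on_vector_derivative) (rule has_vector_derivative_at_within[OF deriv])
  have nf: "norm (f' t) \<le> t * B * N" if "0 \<le> t" "norm (exp ((e - t) *\<^sub>R R)) \<le> B" for t B
  proof -
    have "norm (f' t) \<le> t * (norm (exp ((e - t) *\<^sub>R R)) * N)"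
      unfolding f'_def N_def norm_scaleR using that(1) by (simp add: norm_mult_ineq mult_left_mono)
    also have "\<dots> \<le> t * (B * N)"
      using that by (intro mult_left_mono mult_right_mono) (auto simp: N_def)
    finally show ?thesis by (simp add: mult.assoc)
  qed
  have 1: "norm (f e - f 0) \<le> e\<^sup>2 / 2 * N - 0\<^sup>2 / 2 * N"
  proof (rule differentiable_bound_general[OF e(1) cont, where \<phi> = "\<lambda>t. t\<^sup>2 / 2 * N" and \<phi>' = "\<lambda>t. t * N"])
    show "continuous_on {0..e} (\<lambda>t. t\<^sup>2 / 2 * N)" by (intro continuous_intros) auto
    show "((\<lambda>t. t\<^sup>2 / 2 * N) has_vector_derivative t * N) (at t)" for t
      by (auto intro!: derivative_eq_intros simp: has_real_derivative_iff_has_vector_derivative[symmetric])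
    show "norm (f' t) \<le> t * N" if "0 < t" "t < e" for t
      using nf[of t 1] contr[of "e - t"] that by simp
  qed (rule deriv)
  \<comment> \<open>\<open>psi\<close> is an antiderivative of \<open>t * exp (2 * (t - e))\<close>.
    Beyond \<open>e\<close> the exponent \<open>e - t\<close> is negative, and
    \<open>norm R \<le> 2\<close> bounds the exponential by
    \<open>exp (2 * (t - e))\<close>.\<close>
  define psi where "psi t = exp (2 * (t - e)) * (t / 2 - 1 / 4)" for t
  have 2: "norm (f 1 - f e) \<le> psi 1 * N - psi e * N"
  \<comment> \<open>For \<open>e = 1\<close> the second interval degenerates, while the mean value
    inequality asks for a proper one.\<close>
  proof (cases "e = 1")
    case False
    then have "e < 1" using e by simp
    then show ?thesis
    proof (rule differentiable_bound_general[OF _ cont, where \<phi>' = "\<lambda>t. t * exp (2 * (t - e)) * N"])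
      show "continuous_on {e..1} (\<lambda>t. psi t * N)" unfolding psi_def by (intro continuous_intros) auto
      show "((\<lambda>t. psi t * N) has_vector_derivative t * exp (2 * (t - e)) * N) (at t)" for t
        unfolding psi_def
        by (auto intro!: derivative_eq_intros
            simp: has_real_derivative_iff_has_vector_derivative[symmetric] algebra_simps)
      show "norm (f' t) \<le> t * exp (2 * (t - e)) * N" if t: "e < t" "t < 1" for t
      proof (rule nf)
        have "norm ((e - t) *\<^sub>R R) \<le> 2 * (t - e)"
          using mult_left_mono[OF R, of "t - e"] t by (simp add: mult.commute)
        then show "norm (exp ((e - t) *\<^sub>R R)) \<le> exp (2 * (t - e))"
          by (meson norm_exp exp_le_cancel_iff order_trans)
      qed (use t e in simp)
    qed (rule deriv)
  qed simp
  have "f 1 - f 0 = ((1 + R) * exp (- R) - 1) * exp (e *\<^sub>R R) * X"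
    by (simp add: f_def Y_def algebra_simps)
  then have "norm (((1 + R) * exp (- R) - 1) * exp (e *\<^sub>R R) * X) \<le> norm (f e - f 0) + norm (f 1 - f e)"
    unfolding \<open>f 1 - f 0 = _\<close>[symmetric] using norm_triangle_ineq[of "f e - f 0" "f 1 - f e"] by simp
  also have "\<dots> \<le> kappa e * N"
    using 1 2 by (simp add: kappa_def psi_def algebra_simps)
  finally show ?thesis by (simp add: N_def)
qed

text \<open>The factors are treated one at a time, all others being absorbed into the free element
  \<open>X\<close>. For this reason the estimate of a single factor is relative to
  \<open>R\<^sup>2 * X\<close>: the squares stay together with \<open>X\<close> and can be estimated
  jointly.\<close>

lemma norm_prod_kerstan_factors_le:
  fixes R :: "'j \<Rightarrow> 'i::comm_monoid_add l1"
  assumes "finite J"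
    and "\<And>j s. j \<in> J \<Longrightarrow> 0 \<le> s \<Longrightarrow> norm (exp (s *\<^sub>R R j)) \<le> 1"
    and "\<And>j. j \<in> J \<Longrightarrow> norm (R j) \<le> 2"
    and e: "0 < e" "e \<le> 1" and k: "0 \<le> kappa e"
  shows "norm ((\<Prod>j\<in>J. ((1 + R j) * exp (- R j) - 1) * exp (e *\<^sub>R R j)) * X)
    \<le> kappa e ^ card J * norm ((\<Prod>j\<in>J. (R j)\<^sup>2) * X)"
  using assms(1-3)
proof (induction J arbitrary: X)
  case (insert j J)
  let ?V = "\<lambda>j. ((1 + R j) * exp (- R j) - 1) * exp (e *\<^sub>R R j)"
  have "norm (prod ?V (insert j J) * X) = norm (?V j * (prod ?V J * X))"
    using insert.hyps by (simp add: mult.assoc)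
  also have "\<dots> \<le> kappa e * norm ((R j)\<^sup>2 * (prod ?V J * X))"
    by (rule norm_kerstan_factor_le[OF _ _ e]) (use insert.prems in auto)
  also have "(R j)\<^sup>2 * (prod ?V J * X) = prod ?V J * ((R j)\<^sup>2 * X)" by (rule mult.left_commute)
  also have "kappa e * norm \<dots> \<le> kappa e * (kappa e ^ card J * norm ((\<Prod>j\<in>J. (R j)\<^sup>2) * ((R j)\<^sup>2 * X)))"
    by (intro mult_left_mono insert.IH k) (use insert.prems in auto)
  also have "\<dots> = kappa e ^ card (insert j J) * norm ((\<Prod>j\<in>insert j J. (R j)\<^sup>2) * X)"
    using insert.hyps by (simp add: mult_ac)
  finally show ?case .
qed simp

text \<open>In the expanded product the factors \<open>A\<close> stay next to \<open>E\<close>,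
  since smoothing by \<open>E\<close> is what makes them small, while the factors \<open>B\<close>
  are split off by submultiplicativity. As the bound for each \<open>S\<close> is again a product,
  the expansion recombines.\<close>

lemma norm_prod_add_times_le:
  fixes A B X :: "_ \<Rightarrow> 'i::comm_monoid_add l1"
  assumes "finite I"
    and a: "\<And>S. S \<subseteq> I \<Longrightarrow> norm (prod A S * E) \<le> prod a S"
  shows "norm ((\<Prod>i\<in>I. A i + B i) * E) \<le> (\<Prod>i\<in>I. a i + norm (B i))"
proof -
  have "norm ((\<Prod>i\<in>I. A i + B i) * E) \<le> (\<Sum>S\<in>Pow I. norm (prod A S * prod B (I - S) * E))"
    unfolding prod_add[OF assms(1)] sum_distrib_right by (rule norm_sum)
  also have "\<dots> \<le> (\<Sum>S\<in>Pow I. prod a S * (\<Prod>i\<in>I - S. norm (B i)))"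
  proof (rule sum_mono)
    fix S assume "S \<in> Pow I"
    have "norm (prod A S * prod B (I - S) * E) \<le> norm (prod A S * E) * norm (prod B (I - S))"
      using norm_mult_ineq[of "prod A S * E" "prod B (I - S)"] by (simp add: mult_ac)
    also have "\<dots> \<le> prod a S * (\<Prod>i\<in>I - S. norm (B i))"
    proof (rule mult_mono)
      show S: "norm (prod A S * E) \<le> prod a S" using a \<open>S \<in> Pow I\<close> by simp
      show "0 \<le> prod a S" using order_trans[OF norm_ge_zero S] .
    qed (simp_all add: norm_prod_le_l1)
    finally show "norm (prod A S * prod B (I - S) * E) \<le> prod a S * (\<Prod>i\<in>I - S. norm (B i))" .
  qed
  also have "\<dots> = (\<Prod>i\<in>I. a i + norm (B i))"
    by (rule prod_add[OF assms(1), symmetric])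
  finally show ?thesis .
qed

text \<open>Every product over \<open>k\<close> distinct indices occurs \<open>fact k\<close> times
  in the expanded power of the sum. The induction distinguishes whether a set contains the new
  index.\<close>

lemma elementary_symmetric_le:
  fixes x :: "'j \<Rightarrow> real"
  assumes "finite N" and "\<And>j. j \<in> N \<Longrightarrow> 0 \<le> x j"
  shows "(\<Sum>J | J \<subseteq> N \<and> card J = k. prod x J) \<le> sum x N ^ k / fact k"
  using assms
proof (induction N arbitrary: k)
  case empty
  show ?case
  proof (cases k)
    case 0
    have "{J :: 'j set. J \<subseteq> {} \<and> card J = 0} = {{}}" by auto
    then show ?thesis by (simp add: 0)
  next
    case (Suc m)
    have "{J :: 'j set. J \<subseteq> {} \<and> card J = Suc m} = {}" by auto
    then show ?thesis by (simp only: Suc) simp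
  qed
next
  case (insert i N)
  have sub: "finite J" "i \<notin> J" if "J \<subseteq> N" for J
    using that insert.hyps finite_subset by auto
  have x: "0 \<le> sum x N" using insert.prems by (intro sum_nonneg) auto
  show ?case
  proof (cases k)
    case 0
    have "{J. J \<subseteq> insert i N \<and> card J = 0} = {{}}"
      using finite_subset[of _ "insert i N"] insert.hyps by fastforce
    then show ?thesis by (simp add: 0)
  next
    case (Suc k')
    have split: "{J. J \<subseteq> insert i N \<and> card J = k}
        = {J. J \<subseteq> N \<and> card J = k} \<union> insert i ` {J. J \<subseteq> N \<and> card J = k'}"
    proof (intro Set.set_eqI iffI)
      fix J assume J: "J \<in> {J. J \<subseteq> insert i N \<and> card J = k}"
      show "J \<in> {J. J \<subseteq> N \<and> card J = k} \<union> insert i ` {J. J \<subseteq> N \<and> card J = k'}"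
      proof (cases "i \<in> J")
        case True
        then have "J = insert i (J - {i})" "J - {i} \<subseteq> N" "card (J - {i}) = k'"
          using J Suc by auto
        then show ?thesis by blast
      qed (use J in auto)
    next
      fix J assume "J \<in> {J. J \<subseteq> N \<and> card J = k} \<union> insert i ` {J. J \<subseteq> N \<and> card J = k'}"
      then show "J \<in> {J. J \<subseteq> insert i N \<and> card J = k}"
        using Suc by (auto simp: sub)
    qed
    have fin: "finite {J. J \<subseteq> N \<and> card J = m}" for m
      using insert.hyps by (auto intro: finite_subset[of _ "Pow N"])
    have "(\<Sum>J | J \<subseteq> insert i N \<and> card J = k. prod x J)
        = (\<Sum>J | J \<subseteq> N \<and> card J = k. prod x J) + (\<Sum>J | J \<subseteq> N \<and> card J = k'. prod x (insert i J))"
      unfolding split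
    proof (subst sum.union_disjoint)
      have "inj_on (insert i) {J. J \<subseteq> N \<and> card J = k'}"
      proof (rule inj_onI)
        fix J J' assume "J \<in> {J. J \<subseteq> N \<and> card J = k'}" "J' \<in> {J. J \<subseteq> N \<and> card J = k'}"
        then have "i \<notin> J" "i \<notin> J'" using insert.hyps by auto
        moreover assume "insert i J = insert i J'"
        ultimately show "J = J'" by (simp add: insert_ident)
      qed
      then show "sum (prod x) {J. J \<subseteq> N \<and> card J = k} + sum (prod x) (insert i ` {J. J \<subseteq> N \<and> card J = k'})
          = sum (prod x) {J. J \<subseteq> N \<and> card J = k} + (\<Sum>J | J \<subseteq> N \<and> card J = k'. prod x (insert i J))"
        by (simp add: sum.reindex)
    qed (use fin insert.hyps in auto)
    also have "(\<Sum>J | J \<subseteq> N \<and> card J = k'. prod x (insert i J))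
        = x i * (\<Sum>J | J \<subseteq> N \<and> card J = k'. prod x J)"
      unfolding sum_distrib_left
      by (rule sum.cong) (auto simp: sub)
    also have "(\<Sum>J | J \<subseteq> N \<and> card J = k. prod x J) + \<dots>
        \<le> sum x N ^ k / fact k + x i * (sum x N ^ k' / fact k')"
      using insert.prems by (intro add_mono mult_left_mono insert.IH) auto
    also have "\<dots> = (sum x N ^ k + k * x i * sum x N ^ (k - 1)) / fact k"
      by (simp add: Suc add_divide_distrib del: of_nat_Suc)
    \<comment> \<open>The first two terms of the binomial expansion, all terms being
      nonnegative.\<close>
    also have "sum x N ^ k + k * x i * sum x N ^ (k - 1) \<le> (sum x N + x i) ^ k"
      unfolding Suc using x insert.prems
    proof (induction k')
      case (Suc m)
      have "sum x N ^ Suc (Suc m) + Suc (Suc m) * x i * sum x N ^ (Suc (Suc m) - 1)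
          \<le> (sum x N + x i) * (sum x N ^ Suc m + Suc m * x i * sum x N ^ (Suc m - 1))"
        using Suc.prems by (simp add: algebra_simps)
      also have "\<dots> \<le> (sum x N + x i) * (sum x N + x i) ^ Suc m"
        using Suc by (intro mult_left_mono) auto
      finally show ?case by simp
    qed simp
    finally show ?thesis
      using insert.hyps by (simp add: divide_right_mono add.commute)
  qed
qed

text \<open>The root of order \<open>i\<close> of \<open>fact i\<close> grows with \<open>i\<close>,
  so one \<open>s\<close> serves all smaller factorials. If \<open>i\<close> exceeds
  \<open>s\<close>, then so does every factor of \<open>fact m\<close> beyond
  \<open>fact i\<close>.\<close>

lemma fact_le_power_mono:
  assumes "fact m \<le> s ^ m" "i \<le> m" "0 < (s :: real)"
  shows "fact i \<le> s ^ i"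
proof (cases "real i \<le> s")
  case True
  have "(fact i :: real) \<le> real i ^ i"
    using fact_le_power[of i] by simp
  also have "\<dots> \<le> s ^ i" using True by (intro power_mono) auto
  finally show ?thesis .
next
  case False
  have "s ^ (m - i) * fact i \<le> fact m"
    using assms(2)
  proof (induction m rule: dec_induct)
    case (step k)
    have "s ^ (Suc k - i) * fact i = s * (s ^ (k - i) * fact i)"
      using step by (simp add: Suc_diff_le)
    also have "\<dots> \<le> real (Suc k) * fact k"
      using False step assms(3) by (intro mult_mono) auto
    finally show ?case by simp
  qed simp
  also have "\<dots> \<le> s ^ (m - i) * s ^ i"
    using assms(1,2) by (simp add: power_add[symmetric])
  finally show ?thesis using assms(3) by simp
qed

section \<open>The expansion in the algebra\<close>

locale kerstan =
  fixes N :: "'j set" and D :: "'r set" and p :: "'j \<Rightarrow> real" and q :: "'j \<Rightarrow> 'r \<Rightarrow> real"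
  assumes finite_N: "finite N" and finite_D: "finite D"
    and p_nonneg: "j \<in> N \<Longrightarrow> 0 \<le> p j" and p_le_1: "j \<in> N \<Longrightarrow> p j \<le> 1"
    and q_nonneg: "j \<in> N \<Longrightarrow> r \<in> D \<Longrightarrow> 0 \<le> q j r"
    and q_sum: "j \<in> N \<Longrightarrow> (\<Sum>r\<in>D. q j r) = 1"
    and lam_pos: "r \<in> D \<Longrightarrow> 0 < (\<Sum>j\<in>N. p j * q j r)"
begin

definition lam :: "'r \<Rightarrow> real" where "lam r = (\<Sum>j\<in>N. p j * q j r)"
definition Q :: "'j \<Rightarrow> 'r multiset l1" where "Q j = (\<Sum>r\<in>D. q j r *\<^sub>R single {#r#})"
definition R :: "'j \<Rightarrow> 'r multiset l1" where "R j = p j *\<^sub>R (Q j - 1)"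
definition V :: "'j \<Rightarrow> 'r multiset l1" where "V j = (1 + R j) * exp (- R j) - 1"
definition H :: "nat \<Rightarrow> 'r multiset l1" where
  "H k = (\<Sum>J | J \<subseteq> N \<and> card J = k. \<Prod>j\<in>J. V j) * exp (\<Sum>j\<in>N. R j)"
definition m :: "'j \<Rightarrow> real" where "m j = (\<Sum>r\<in>D. q j r * min (q j r / lam r) 1)"
definition beta :: real where "beta = (\<Sum>j\<in>N. (p j)\<^sup>2 * m j)"

lemma norm_Q: "j \<in> N \<Longrightarrow> norm (Q j) \<le> 1"
  unfolding Q_def
  by (rule order_trans[OF norm_sum]) (simp add: q_nonneg q_sum cong: sum.cong)

lemma norm_exp_R: "j \<in> N \<Longrightarrow> 0 \<le> s \<Longrightarrow> norm (exp (s *\<^sub>R R j)) \<le> 1"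
  using norm_exp_scaleR_diff_one_le[of "Q j" "s * p j"] by (simp add: R_def norm_Q p_nonneg)

lemma norm_R: "j \<in> N \<Longrightarrow> norm (R j) \<le> 2 * p j"
  using norm_triangle_ineq4[of "Q j" 1] norm_Q[of j] p_nonneg[of j] mult_left_mono[of "norm (Q j - 1)" 2 "p j"]
  by (simp add: R_def mult.commute)

lemma norm_R_2: "j \<in> N \<Longrightarrow> norm (R j) \<le> 2"
  using norm_R[of j] p_le_1[of j] by linarith

lemma norm_F: "norm (\<Prod>j\<in>N. 1 + R j) \<le> 1"
proof -
  have "norm (1 + R j) \<le> 1" if j: "j \<in> N" for j
  proof -
    have "1 + R j = (1 - p j) *\<^sub>R 1 + p j *\<^sub>R Q j" by (simp add: R_def algebra_simps)
    then have "norm (1 + R j) \<le> (1 - p j) + p j * norm (Q j)"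
      using norm_triangle_ineq[of "(1 - p j) *\<^sub>R (1 :: 'r multiset l1)" "p j *\<^sub>R Q j"] p_nonneg[OF j] p_le_1[OF j]
      by simp
    also have "\<dots> \<le> 1" using mult_left_mono[OF norm_Q[OF j] p_nonneg[OF j]] by simp
    finally show ?thesis .
  qed
  then have "(\<Prod>j\<in>N. norm (1 + R j)) \<le> 1" by (intro prod_le_1) auto
  then show ?thesis using norm_prod_le_l1[of "\<lambda>j. 1 + R j" N] by linarith
qed

text \<open>Since \<open>1 + R j = (1 + V j) * exp (R j)\<close>, expanding over the subsets of
  \<open>N\<close> and grouping by cardinality gives a finite identity without remainder.\<close>

lemma prod_F: "(\<Prod>j\<in>N. 1 + R j) = (\<Sum>k\<le>card N. H k)"
proof -
  have "(\<Prod>j\<in>N. 1 + R j) = (\<Prod>j\<in>N. (V j + 1) * exp (R j))"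
    by (rule prod.cong) (auto simp: V_def mult.assoc exp_minus_inverse mult.commute[of "exp (- R _)"])
  also have "\<dots> = (\<Sum>J\<in>Pow N. \<Prod>j\<in>J. V j) * exp (\<Sum>j\<in>N. R j)"
    by (simp add: prod.distrib l1_exp_sum prod_add[OF finite_N])
  also have "(\<Sum>J\<in>Pow N. \<Prod>j\<in>J. V j) = (\<Sum>k\<le>card N. \<Sum>J | J \<in> Pow N \<and> card J = k. \<Prod>j\<in>J. V j)"
    by (rule sum.group[symmetric]) (use finite_N in \<open>auto intro: card_mono\<close>)
  finally show ?thesis by (simp add: H_def sum_distrib_right Pow_def)
qed

lemma m_nonneg: "j \<in> N \<Longrightarrow> 0 \<le> m j"
  unfolding m_def lam_def by (intro sum_nonneg mult_nonneg_nonneg) (auto simp: q_nonneg lam_pos less_imp_le)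

lemma beta_nonneg: "0 \<le> beta"
  unfolding beta_def by (intro sum_nonneg mult_nonneg_nonneg) (auto simp: m_nonneg)

lemma norm_exp_sum_R: "norm (exp (\<Sum>j\<in>N. R j)) \<le> 1"
proof -
  have "norm (exp (R j)) \<le> 1" if "j \<in> N" for j using norm_exp_R[OF that, of 1] by simp
  then have "(\<Prod>j\<in>N. norm (exp (R j))) \<le> 1" by (intro prod_le_1) auto
  then show ?thesis using norm_prod_le_l1[of "\<lambda>j. exp (R j)" N] by (simp add: l1_exp_sum)
qed

lemma norm_H_0: "norm (H 0) \<le> 1"
proof -
  have "{J. J \<subseteq> N \<and> card J = 0} = {{}}" using finite_subset[OF _ finite_N] by fastforce
  then show ?thesis by (simp add: H_def norm_exp_sum_R)
qed

lemma R_eq: "j \<in> N \<Longrightarrow> R j = (\<Sum>r\<in>D. (p j * q j r) *\<^sub>R (single {#r#} - 1))"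
  by (simp add: R_def Q_def scaleR_diff_right sum_subtractf scaleR_sum_right scaleR_sum_left[symmetric]
      sum_distrib_left[symmetric] q_sum)

text \<open>The exponential of \<open>\<lambda>(Q - 1)\<close> lends \<open>exp (3/5 R\<^sub>j)\<close> to each \<open>j \<in> J\<close> at the price of a factor
  at most \<open>5/2\<close> in the inverse Poisson intensities.\<close>

definition mu :: "'j set \<Rightarrow> 'r \<Rightarrow> real" where
  "mu J r = lam r - 3/5 * (\<Sum>j\<in>J. p j * q j r)"

lemma mu_ge: "J \<subseteq> N \<Longrightarrow> r \<in> D \<Longrightarrow> 2/5 * lam r \<le> mu J r"
  using sum_mono2[of N J "\<lambda>j. p j * q j r"] finite_N
  by (auto simp: mu_def lam_def p_nonneg q_nonneg)

lemma poisson_mu: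
  assumes "J \<subseteq> N"
  shows "poisson_weights D (mu J)"
proof
  show "0 < mu J r" if "r \<in> D" for r
    using mu_ge[OF assms that] lam_pos[OF that] by (simp add: lam_def[symmetric])
qed (rule finite_D)

lemma norm_prod_V_le:
  assumes J: "J \<subseteq> N"
  shows "norm ((\<Prod>j\<in>J. V j) * exp (\<Sum>j\<in>N. R j))
    \<le> kappa (3/5) ^ card J * norm ((\<Prod>j\<in>J. (R j)\<^sup>2) * poisson_weights.E D (mu J))"
proof -
  interpret P: poisson_weights D "mu J" by (rule poisson_mu[OF J])
  have fin: "finite J" using J finite_N by (rule finite_subset)
  have "(\<Sum>j\<in>A. R j) = (\<Sum>r\<in>D. (\<Sum>j\<in>A. p j * q j r) *\<^sub>R (single {#r#} - 1))" if "A \<subseteq> N" for A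
  proof -
    have "(\<Sum>j\<in>A. R j) = (\<Sum>j\<in>A. \<Sum>r\<in>D. (p j * q j r) *\<^sub>R (single {#r#} - 1))"
      by (rule sum.cong) (use that R_eq in auto)
    then show ?thesis by (subst (asm) sum.swap) (simp only: scaleR_sum_left)
  qed
  from this[of N] this[OF J]
  have "(\<Sum>j\<in>N. R j) = (\<Sum>j\<in>J. (3/5) *\<^sub>R R j) + (\<Sum>r\<in>D. mu J r *\<^sub>R (single {#r#} - 1))"
    by (simp add: mu_def lam_def scaleR_left_diff_distrib sum_subtractf scaleR_sum_right[symmetric])
      (simp add: scaleR_sum_right)
  then have "(\<Prod>j\<in>J. V j) * exp (\<Sum>j\<in>N. R j) = (\<Prod>j\<in>J. V j * exp ((3/5) *\<^sub>R R j)) * P.E"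
    by (simp add: P.E_def l1_exp_add l1_exp_sum prod.distrib mult.assoc)
  also have "norm \<dots> \<le> kappa (3/5) ^ card J * norm ((\<Prod>j\<in>J. (R j)\<^sup>2) * P.E)"
    unfolding V_def using J norm_exp_R norm_R_2 kappa_3_5_nonneg
    by (intro norm_prod_kerstan_factors_le fin) auto
  finally show ?thesis .
qed

section \<open>Splitting \<open>R\<close> according to the minimum in \<open>beta\<close>\<close>

definition va :: "'j \<Rightarrow> 'r \<Rightarrow> real" where "va j r = p j * q j r * of_bool (q j r \<le> lam r)"
definition B :: "'j \<Rightarrow> 'r multiset l1" where
  "B j = (\<Sum>r\<in>D. (p j * q j r * of_bool (lam r < q j r)) *\<^sub>R (single {#r#} - 1))"
definition ma :: "'j \<Rightarrow> real" where "ma j = (\<Sum>r\<in>D. of_bool (q j r \<le> lam r) * (q j r)\<^sup>2 / lam r)"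
definition mb :: "'j \<Rightarrow> real" where "mb j = (\<Sum>r\<in>D. of_bool (lam r < q j r) * q j r)"

lemma ma_nonneg: "0 \<le> ma j"
  unfolding ma_def using lam_pos by (intro sum_nonneg divide_nonneg_nonneg) (auto simp: lam_def less_imp_le)

lemma mb_nonneg: "j \<in> N \<Longrightarrow> 0 \<le> mb j"
  unfolding mb_def by (intro sum_nonneg) (auto simp: q_nonneg)

lemma mb_le_1: "j \<in> N \<Longrightarrow> mb j \<le> 1"
  unfolding mb_def q_sum[symmetric] by (intro sum_mono) (auto simp: q_nonneg)

text \<open>The cut at \<open>q j r = lam r\<close> is where the minimum changes its branch: below
  it the branch is a squared norm in the inner product weighted by \<open>1 / lam r\<close>, above
  it a total variation.\<close>

lemma m_eq: "m j = ma j + mb j"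
  unfolding m_def ma_def mb_def sum.distrib[symmetric]
proof (rule sum.cong)
  fix r assume "r \<in> D"
  then have "0 < lam r" using lam_pos by (simp add: lam_def)
  then show "q j r * min (q j r / lam r) 1
      = of_bool (q j r \<le> lam r) * (q j r)\<^sup>2 / lam r + of_bool (lam r < q j r) * q j r"
    by (auto simp: min_def divide_simps power2_eq_square)
qed simp

lemma norm_B: 
  assumes "j \<in> N"
  shows "norm (B j) \<le> 2 * p j * mb j"
proof -
  have "norm (B j) \<le> (\<Sum>r\<in>D. (p j * q j r * of_bool (lam r < q j r)) * 2)"
    unfolding B_def
  proof (rule order_trans[OF norm_sum], rule sum_mono)
    fix r assume "r \<in> D"
    have "norm (single {#r#} - (1 :: 'r multiset l1)) \<le> 2"
      using norm_triangle_ineq4[of "single {#r#}" "1 :: 'r multiset l1"] by simp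
    then show "norm ((p j * q j r * of_bool (lam r < q j r)) *\<^sub>R (single {#r#} - (1 :: 'r multiset l1)))
        \<le> (p j * q j r * of_bool (lam r < q j r)) * 2"
      using p_nonneg[OF assms] q_nonneg[OF assms \<open>r \<in> D\<close>] by (simp add: abs_mult mult_left_mono)
  qed
  then show ?thesis by (simp add: mb_def sum_distrib_left mult_ac)
qed

lemma R_eq_add: 
  assumes "j \<in> N"
  shows "R j = (\<Sum>r\<in>D. va j r *\<^sub>R (single {#r#} - 1)) + B j"
  unfolding R_eq[OF assms] B_def va_def sum.distrib[symmetric] scaleR_left.add[symmetric]
  by (rule sum.cong) auto

lemma ip_va: 
  assumes J: "J \<subseteq> N" and j: "j \<in> J"
  shows "poisson_weights.ip D (mu J) (va j) (va j) \<le> (p j)\<^sup>2 * (5/2 * ma j)"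
proof -
  interpret P: poisson_weights D "mu J" by (rule poisson_mu[OF J])
  have "P.ip (va j) (va j) \<le> (\<Sum>r\<in>D. (p j)\<^sup>2 * (5/2 * (of_bool (q j r \<le> lam r) * (q j r)\<^sup>2 / lam r)))"
    unfolding P.ip_def
  proof (rule sum_mono)
    fix r assume r: "r \<in> D"
    then have l: "0 < lam r" using lam_pos by (simp add: lam_def)
    have "va j r * va j r / mu J r \<le> va j r * va j r / (2/5 * lam r)"
      using mu_ge[OF J r] l by (intro divide_left_mono) auto
    also have "\<dots> = (p j)\<^sup>2 * (5/2 * (of_bool (q j r \<le> lam r) * (q j r)\<^sup>2 / lam r))"
      using l by (auto simp: va_def power2_eq_square field_simps)
    finally show "va j r * va j r / mu J r \<le> (p j)\<^sup>2 * (5/2 * (of_bool (q j r \<le> lam r) * (q j r)\<^sup>2 / lam r))" .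
  qed
  then show ?thesis by (simp add: ma_def sum_distrib_left)
qed

lemma va_B_bounds:
  assumes J: "J \<subseteq> N" and j: "j \<in> J"
  shows "sqrt (poisson_weights.ip D (mu J) (va j) (va j)) \<le> p j * sqrt (5/2 * ma j)"
    and "norm (B j) \<le> p j * (2 * mb j)"
proof -
  have jN: "j \<in> N" using J j by blast
  have "sqrt (poisson_weights.ip D (mu J) (va j) (va j)) \<le> sqrt ((p j)\<^sup>2 * (5/2 * ma j))"
    using ip_va[OF assms] by (rule real_sqrt_le_mono)
  then show "sqrt (poisson_weights.ip D (mu J) (va j) (va j)) \<le> p j * sqrt (5/2 * ma j)"
    using p_nonneg[OF jN] by (simp only: real_sqrt_mult real_sqrt_abs abs_of_nonneg)
  show "norm (B j) \<le> p j * (2 * mb j)" using norm_B[OF jN] by (simp add: mult_ac)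
qed

text \<open>A set \<open>S\<close> of steps costs \<open>sqrt (fact (card S))\<close>, which is not
  multiplicative. Replacing it by \<open>sqrt s ^ card S\<close> makes the bound a product, so that
  the expansion over all choices of a step or a \<open>B\<close> for each factor recombines into one
  square for each \<open>j\<close>.\<close>

lemma norm_prod_R_power2_le:
  assumes J: "J \<subseteq> N" and s: "0 < s" "fact (2 * card J) \<le> s ^ (2 * card J)"
  shows "norm ((\<Prod>j\<in>J. (R j)\<^sup>2) * poisson_weights.E D (mu J))
    \<le> (5/2 * s + 4) ^ card J * (\<Prod>j\<in>J. (p j)\<^sup>2 * m j)"
proof -
  interpret P: poisson_weights D "mu J" by (rule poisson_mu[OF J])
  let ?n = "\<lambda>j. sqrt (P.ip (va j) (va j))"
  have fin: "finite J" using J finite_N by (rule finite_subset)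
  \<comment> \<open>The boolean labels the two copies of each \<open>R j\<close> in its
    square.\<close>
  let ?I = "J \<times> (UNIV :: bool set)"
  have square: "(\<Prod>i\<in>?I. f (fst i)) = (\<Prod>j\<in>J. (f j)\<^sup>2)" for f :: "'j \<Rightarrow> 'c::comm_monoid_mult"
    using prod.cartesian_product[of "\<lambda>j _. f j" "UNIV :: bool set" J] by (simp add: case_prod_unfold)
  have "(\<Prod>j\<in>J. (R j)\<^sup>2) = (\<Prod>j\<in>J. (P.step (va j) + B j)\<^sup>2)"
    using J by (intro prod.cong refl) (auto simp: R_eq_add P.step_def)
  also have "\<dots> = (\<Prod>i\<in>?I. P.step (va (fst i)) + B (fst i))"
    by (rule square[symmetric])
  finally have "norm ((\<Prod>j\<in>J. (R j)\<^sup>2) * P.E)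
      = norm ((\<Prod>i\<in>?I. P.step (va (fst i)) + B (fst i)) * P.E)" by simp
  also have "\<dots> \<le> (\<Prod>i\<in>?I. sqrt s * ?n (fst i) + norm (B (fst i)))"
  proof (rule norm_prod_add_times_le)
    fix S assume S: "S \<subseteq> ?I"
    have finI: "finite ?I" using fin by simp
    have finS: "finite S" using S finI by (rule finite_subset)
    have "card S \<le> 2 * card J"
      using card_mono[OF finI S] by (simp add: card_cartesian_product mult.commute)
    then have "sqrt (fact (card S)) \<le> sqrt s ^ card S"
      using fact_le_power_mono[OF s(2) _ s(1)] by (simp add: real_sqrt_power[symmetric])
    moreover have "0 \<le> (\<Prod>i\<in>S. ?n (fst i))"
      by (intro prod_nonneg) (simp add: P.ip_self_nonneg)
    ultimately have "sqrt (fact (card S)) * (\<Prod>i\<in>S. ?n (fst i)) \<le> sqrt s ^ card S * (\<Prod>i\<in>S. ?n (fst i))"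
      by (rule mult_right_mono)
    then show "norm ((\<Prod>i\<in>S. P.step (va (fst i))) * P.E) \<le> (\<Prod>i\<in>S. sqrt s * ?n (fst i))"
      using P.norm_prod_step_E_le[OF finS, of "\<lambda>i. va (fst i)"] by (simp add: prod.distrib)
  qed (use fin in simp)
  also have "\<dots> = (\<Prod>j\<in>J. (sqrt s * ?n j + norm (B j))\<^sup>2)"
    by (rule square)
  also have "\<dots> \<le> (\<Prod>j\<in>J. (5/2 * s + 4) * ((p j)\<^sup>2 * m j))"
  proof (rule prod_mono, intro conjI)
    fix j assume j: "j \<in> J"
    then have jN: "j \<in> N" using J by blast
    have ab: "0 \<le> ma j" "0 \<le> mb j" "mb j \<le> 1"
      using jN by (auto simp: ma_nonneg mb_nonneg mb_le_1)
    define x where "x = sqrt (5/2 * s * ma j)"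
    have x: "0 \<le> x" "x\<^sup>2 = 5/2 * s * ma j" using s(1) ab by (auto simp: x_def)
    have "sqrt s * ?n j + norm (B j) \<le> sqrt s * (p j * sqrt (5/2 * ma j)) + p j * (2 * mb j)"
      using va_B_bounds[OF J j] s(1) by (intro add_mono mult_left_mono) auto
    also have "\<dots> = p j * (x + 2 * mb j)"
      unfolding x_def by (simp add: real_sqrt_mult[symmetric] algebra_simps)
    finally have "(sqrt s * ?n j + norm (B j))\<^sup>2 \<le> (p j * (x + 2 * mb j))\<^sup>2"
      using s(1) by (intro power_mono) (auto simp: P.ip_self_nonneg)
    also have "\<dots> = (p j)\<^sup>2 * (5/2 * s * ma j + mb j * (4 * x) + 4 * (mb j * mb j))"
      unfolding x(2)[symmetric] by (simp add: power2_eq_square algebra_simps)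
    also have "\<dots> \<le> (p j)\<^sup>2 * ((5/2 * s + 4) * m j)"
    proof (rule mult_left_mono)
      \<comment> \<open>Arithmetic and geometric mean of \<open>5/2 * s\<close> and
        \<open>4 * ma j\<close>, whose product is \<open>x\<^sup>2 * 4\<close>. With
        \<open>mb j \<le> 1\<close> the mixed term and the square of \<open>mb j\<close> become
        linear in \<open>ma j\<close> and \<open>mb j\<close>; this creates the summand 4.\<close>
      have "(4 * x)\<^sup>2 \<le> (5/2 * s + 4 * ma j)\<^sup>2"
        using zero_le_power2[of "5/2 * s - 4 * ma j"] x(2) by (simp add: power2_eq_square algebra_simps)
      then have "4 * x \<le> 5/2 * s + 4 * ma j"
        by (rule power2_le_imp_le) (use s(1) ab in simp)
      then have "mb j * (4 * x) \<le> mb j * (5/2 * s + 4 * ma j)" using ab by (intro mult_left_mono)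
      moreover have "mb j * mb j \<le> mb j * 1" using ab by (intro mult_left_mono)
      moreover have "mb j * ma j \<le> 1 * ma j" using ab by (intro mult_right_mono)
      ultimately show "5/2 * s * ma j + mb j * (4 * x) + 4 * (mb j * mb j) \<le> (5/2 * s + 4) * m j"
        unfolding m_eq by (simp add: algebra_simps)
    qed simp
    finally show "(sqrt s * ?n j + norm (B j))\<^sup>2 \<le> (5/2 * s + 4) * ((p j)\<^sup>2 * m j)"
      by (simp add: mult_ac)
  qed simp
  also have "\<dots> = (5/2 * s + 4) ^ card J * (\<Prod>j\<in>J. (p j)\<^sup>2 * m j)"
    by (simp add: prod.distrib)
  finally show ?thesis .
qed

section \<open>Bounds for the terms of the expansion\<close>

lemma norm_H_le_sum:
  assumes "\<And>J. J \<subseteq> N \<Longrightarrow> card J = k \<Longrightarrow>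
    norm ((\<Prod>j\<in>J. V j) * exp (\<Sum>j\<in>N. R j)) \<le> C * (\<Prod>j\<in>J. (p j)\<^sup>2 * m j)" and "0 \<le> C"
  shows "norm (H k) \<le> C * (beta ^ k / fact k)"
proof -
  have "norm (H k) \<le> (\<Sum>J | J \<subseteq> N \<and> card J = k. C * (\<Prod>j\<in>J. (p j)\<^sup>2 * m j))"
    unfolding H_def sum_distrib_right
    by (rule order_trans[OF norm_sum]) (auto intro!: sum_mono assms(1))
  also have "\<dots> \<le> C * (beta ^ k / fact k)"
    unfolding sum_distrib_left[symmetric] beta_def
    by (intro mult_left_mono elementary_symmetric_le finite_N assms(2)) (auto simp: m_nonneg)
  finally show ?thesis .
qed

lemma norm_H_le:
  assumes "0 < s" "fact (2 * k) \<le> s ^ (2 * k)"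
  shows "norm (H k) \<le> (kappa (3/5) * (5/2 * s + 4)) ^ k / fact k * beta ^ k"
proof -
  have "norm (H k) \<le> (kappa (3/5) * (5/2 * s + 4)) ^ k * (beta ^ k / fact k)"
  proof (rule norm_H_le_sum)
    fix J assume J: "J \<subseteq> N" and k: "card J = k"
    have "norm ((\<Prod>j\<in>J. V j) * exp (\<Sum>j\<in>N. R j))
        \<le> kappa (3/5) ^ card J * norm ((\<Prod>j\<in>J. (R j)\<^sup>2) * poisson_weights.E D (mu J))"
      by (rule norm_prod_V_le[OF J])
    also have "\<dots> \<le> kappa (3/5) ^ card J * ((5/2 * s + 4) ^ card J * (\<Prod>j\<in>J. (p j)\<^sup>2 * m j))"
      using assms k by (intro mult_left_mono norm_prod_R_power2_le J zero_le_power kappa_3_5_nonneg) auto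
    finally show "norm ((\<Prod>j\<in>J. V j) * exp (\<Sum>j\<in>N. R j))
        \<le> (kappa (3/5) * (5/2 * s + 4)) ^ k * (\<Prod>j\<in>J. (p j)\<^sup>2 * m j)"
      by (simp add: k power_mult_distrib)
  qed (use assms(1) kappa_3_5_nonneg in simp)
  then show ?thesis by simp
qed

text \<open>For large \<open>m j\<close> the crude estimate by half of
  \<open>(norm (R j))\<^sup>2\<close>, at most \<open>2 * (p j)\<^sup>2\<close>, suffices. The
  opposite case thereby gains the constraint \<open>m j \<le> 2 / 3.11\<close>.\<close>

lemma norm_V_large:
  assumes j: "j \<in> N" and m: "2 \<le> 3.11 * m j"
  shows "norm (V j * exp (\<Sum>i\<in>N. R i)) \<le> 3.11 * ((p j)\<^sup>2 * m j)"
proof -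
  define X where "X = (\<Prod>i\<in>N - {j}. exp (R i))"
  have "norm (exp (R i)) \<le> 1" if "i \<in> N" for i using norm_exp_R[OF that, of 1] by simp
  then have "(\<Prod>i\<in>N - {j}. norm (exp (R i))) \<le> 1" by (intro prod_le_1) auto
  then have X: "norm X \<le> 1" using norm_prod_le_l1[of "\<lambda>i. exp (R i)" "N - {j}"] by (simp add: X_def)
  have "V j * exp (\<Sum>i\<in>N. R i) = V j * exp (1 *\<^sub>R R j) * X"
    by (simp add: l1_exp_sum prod.remove[OF finite_N j] X_def mult.assoc)
  also have "norm \<dots> \<le> kappa 1 * norm ((R j)\<^sup>2 * X)"
    unfolding V_def by (rule norm_kerstan_factor_le) (auto simp: norm_exp_R norm_R_2 j)
  also have "\<dots> \<le> 1/2 * ((norm (R j))\<^sup>2 * 1)"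
    unfolding kappa_1 using X
    by (intro mult_left_mono order_trans[OF norm_mult_ineq] mult_mono norm_power_ineq) auto
  also have "\<dots> \<le> 1/2 * ((2 * p j)\<^sup>2 * 1)"
    by (intro mult_left_mono mult_right_mono power_mono norm_R[OF j]) auto
  also have "\<dots> = (p j)\<^sup>2 * 2" by (simp add: power2_eq_square)
  also have "\<dots> \<le> (p j)\<^sup>2 * (3.11 * m j)" by (intro mult_left_mono m) simp
  finally show ?thesis by simp
qed

text \<open>For one index the square is expanded explicitly: two steps cost \<open>sqrt 2\<close>,
  but the mixed term has a single step, which costs 1. A common \<open>s\<close> for all terms would
  be wasteful.\<close>

lemma norm_V_small:
  assumes j: "j \<in> N" and m: "3.11 * m j \<le> 2"
  shows "norm (V j * exp (\<Sum>i\<in>N. R i)) \<le> 3.11 * ((p j)\<^sup>2 * m j)"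
proof -
  have J: "{j} \<subseteq> N" using j by simp
  interpret P: poisson_weights D "mu {j}" by (rule poisson_mu[OF J])
  let ?A = "P.step (va j)" and ?n = "sqrt (P.ip (va j) (va j))"
  define a b where "a = ma j" and "b = mb j"
  define x where "x = sqrt (5/2 * a)"
  have a: "0 \<le> a" and b: "0 \<le> b" and x: "0 \<le> x" "x\<^sup>2 = 5/2 * a"
    using j by (auto simp: ma_nonneg mb_nonneg a_def b_def x_def)
  have nA: "?n \<le> p j * x" and nB: "norm (B j) \<le> p j * (2 * b)"
    using va_B_bounds[OF J, of j] by (auto simp: x_def a_def b_def)
  have s2: "sqrt 2 \<le> 1.41422" by (rule real_le_lsqrt) (auto simp: power2_eq_square)
  have A2: "norm (?A * ?A * P.E) \<le> sqrt 2 * (?n * ?n)"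
    using P.norm_steps_E_le[of "[va j, va j]"] by (simp add: mult.assoc)
  have A1: "norm (?A * P.E) \<le> ?n"
    using P.norm_steps_E_le[of "[va j]"] by simp
  have "(R j)\<^sup>2 * P.E = ?A * ?A * P.E + 2 *\<^sub>R (?A * P.E * B j) + B j * B j * P.E"
    unfolding R_eq_add[OF j] P.step_def[symmetric]
    by (simp add: power2_eq_square algebra_simps scaleR_2)
  then have "norm ((R j)\<^sup>2 * P.E)
      \<le> norm (?A * ?A * P.E) + 2 * norm (?A * P.E * B j) + norm (B j * B j * P.E)"
    using norm_triangle_ineq[of "?A * ?A * P.E + 2 *\<^sub>R (?A * P.E * B j)" "B j * B j * P.E"]
      norm_triangle_ineq[of "?A * ?A * P.E" "2 *\<^sub>R (?A * P.E * B j)"]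
    by simp
  also have "\<dots> \<le> 1.41422 * ((p j * x) * (p j * x)) + 2 * ((p j * x) * (p j * (2 * b)))
      + (p j * (2 * b)) * (p j * (2 * b)) * 1"
  proof (intro add_mono mult_left_mono)
    have "sqrt 2 * (?n * ?n) \<le> 1.41422 * ((p j * x) * (p j * x))"
      using nA p_nonneg[OF j] x(1) by (intro mult_mono s2) (auto simp: P.ip_self_nonneg)
    then show "norm (?A * ?A * P.E) \<le> 1.41422 * ((p j * x) * (p j * x))"
      using A2 by linarith
    show "norm (?A * P.E * B j) \<le> (p j * x) * (p j * (2 * b))"
      by (rule order_trans[OF norm_mult_ineq], rule mult_mono)
        (use A1 nA nB p_nonneg[OF j] x(1) in auto)
    have "norm (B j * B j * P.E) \<le> norm (B j) * norm (B j) * norm P.E"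
      by (intro order_trans[OF norm_mult_ineq] mult_right_mono norm_mult_ineq) auto
    also have "\<dots> \<le> (p j * (2 * b)) * (p j * (2 * b)) * 1"
      using nB p_nonneg[OF j] b by (intro mult_mono P.norm_E_le) auto
    finally show "norm (B j * B j * P.E) \<le> (p j * (2 * b)) * (p j * (2 * b)) * 1" .
  qed simp
  also have "\<dots> = (p j)\<^sup>2 * (1.41422 * (5/2 * a) + b * (4 * x) + 4 * (b * b))"
    unfolding x(2)[symmetric] by (simp add: power2_eq_square algebra_simps)
  finally have R2: "norm ((R j)\<^sup>2 * P.E) \<le> (p j)\<^sup>2 * (1.41422 * (5/2 * a) + b * (4 * x) + 4 * (b * b))" .
  have num: "0.6864 * (1.41422 * (5/2 * a) + b * (4 * x) + 4 * (b * b)) \<le> 3.11 * (a + b)"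
  proof -
    have ab: "3.11 * (a + b) \<le> 2" using m by (simp add: m_eq a_def b_def)
    \<comment> \<open>Here \<open>(4 * x)\<^sup>2\<close> is \<open>40 * a\<close>, and
      \<open>4 * 1.9 * 5.2632\<close> is just above 40.\<close>
    have "(4 * x)\<^sup>2 \<le> (1.9 + 5.2632 * a)\<^sup>2"
      using zero_le_power2[of "1.9 - 5.2632 * a"] x(2) a by (simp add: power2_eq_square algebra_simps)
    then have "4 * x \<le> 1.9 + 5.2632 * a"
      by (rule power2_le_imp_le) (use a in simp)
    then have 1: "b * (4 * x) \<le> b * (1.9 + 5.2632 * a)" using b by (intro mult_left_mono)
    have 2: "(3.11 * (a + b)) * b \<le> 2 * b" using ab b by (intro mult_right_mono)
    have 3: "(3.11 * (a + b)) * a \<le> 2 * a" using ab a by (intro mult_right_mono)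
    have 4: "0 \<le> a * a" "0 \<le> a * b" using a b by auto
    \<comment> \<open>With the monomials replaced by independent unknowns, what remains is linear
      arithmetic.\<close>
    have *: "0.6864 * (1.41422 * (5/2 * a) + u + 4 * bb) \<le> 3.11 * (a + b)"
      if "u \<le> 1.9 * b + 5.2632 * ab" "3.11 * ab + 3.11 * bb \<le> 2 * b" "3.11 * aa + 3.11 * ab \<le> 2 * a"
        "0 \<le> aa" "0 \<le> ab" for u aa ab bb :: real
      using that a b by (simp add: field_simps)
    show ?thesis
      by (rule *[of "b * (4 * x)" "a * b" "b * b" "a * a"]) (use 1 2 3 4 in \<open>simp_all add: algebra_simps\<close>)
  qed
  have "norm (V j * exp (\<Sum>i\<in>N. R i)) \<le> kappa (3/5) * norm ((R j)\<^sup>2 * P.E)"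
    using norm_prod_V_le[OF J] by simp
  also have "\<dots> \<le> 0.6864 * ((p j)\<^sup>2 * (1.41422 * (5/2 * a) + b * (4 * x) + 4 * (b * b)))"
    using R2 by (intro mult_mono kappa_3_5_le) auto
  also have "\<dots> \<le> (p j)\<^sup>2 * (3.11 * (a + b))"
    using mult_left_mono[OF num, of "(p j)\<^sup>2"] by (simp add: mult_ac)
  also have "\<dots> = 3.11 * ((p j)\<^sup>2 * m j)"
    by (simp only: m_eq a_def b_def mult.left_commute)
  finally show ?thesis .
qed

lemma norm_H_1: "norm (H 1) \<le> 3.11 * beta"
proof -
  have "norm (H 1) \<le> 3.11 * (beta ^ 1 / fact 1)"
  proof (rule norm_H_le_sum)
    fix J assume "J \<subseteq> N" "card J = 1"
    then obtain j where "J = {j}" "j \<in> N" by (auto simp: card_1_singleton_iff)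
    then show "norm ((\<Prod>j\<in>J. V j) * exp (\<Sum>j\<in>N. R j)) \<le> 3.11 * (\<Prod>j\<in>J. (p j)\<^sup>2 * m j)"
      using norm_V_large norm_V_small by (cases "3.11 * m j \<le> 2") auto
  qed simp
  then show ?thesis by simp
qed

end

section \<open>The constants\<close>

text \<open>As \<open>(m - 1) / m! = 1 / (m - 1)! - 1 / m!\<close>, the series is a combination of
  two tails of the exponential series. Half of the value is \<open>kappa 0\<close>.\<close>

lemma g_fun_2: "g_fun 2 = (1 + exp 2) / 2"
proof -
  have e: "(\<lambda>n. 2 ^ n / fact n :: real) sums exp 2"
    using exp_converges[of "2 :: real"] by (simp add: divide_inverse mult.commute)
  have 1: "(\<lambda>n. 2 ^ (n + 1) / fact (n + 1) :: real) sums (exp 2 - 1)"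
    using sums_split_initial_segment[OF e, of 1] by simp
  have 2: "(\<lambda>n. 2 ^ (n + 2) / fact (n + 2) :: real) sums (exp 2 - 3)"
    using sums_split_initial_segment[OF e, of 2] by (simp add: numeral_2_eq_2)
  have "(\<lambda>n. 1/2 * (2 ^ (n + 1) / fact (n + 1)) - 1/4 * (2 ^ (n + 2) / fact (n + 2)) :: real)
      sums (1/2 * (exp 2 - 1) - 1/4 * (exp 2 - 3))"
    by (intro sums_diff sums_mult 1 2)
  moreover have "(\<lambda>n. 1/2 * (2 ^ (n + 1) / fact (n + 1)) - 1/4 * (2 ^ (n + 2) / fact (n + 2)))
      = (\<lambda>n. (real (n + 2) - 1) / fact (n + 2) * 2 ^ n)"
    by (rule ext, simp add: divide_simps) (simp add: algebra_simps)
  moreover have "1/2 * (exp 2 - 1) - 1/4 * (exp 2 - 3) = (exp 2 + 1 :: real) / 4"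
    by (simp add: field_simps)
  ultimately have "(\<lambda>n. (real (n + 2) - 1) / fact (n + 2) * 2 ^ n) sums ((exp 2 + 1) / 4)"
    by (simp only:)
  then show ?thesis unfolding g_fun_def by (simp only: sums_unique[symmetric]) simp
qed

lemma half_g_lower: "2.097264024 \<le> g_fun 2 / 2" and half_g_upper: "g_fun 2 / 2 \<le> 2.097264025"
proof -
  have e: "exp 1 \<le> (5837465777 / 2147483648 + 1 / 2 ^ 32 :: real)"
    "(5837465777 / 2147483648 - 1 / 2 ^ 32 :: real) \<le> exp 1"
    using e_approx_32[unfolded abs_le_iff] by (simp_all add: field_simps)
  have sq: "exp 2 = (exp 1 :: real) * exp 1" by (simp add: mult_exp_exp)
  have "exp 2 \<le> (5837465777 / 2147483648 + 1 / 2 ^ 32 :: real) * (5837465777 / 2147483648 + 1 / 2 ^ 32)"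
    unfolding sq using e(1) by (intro mult_mono) auto
  also have "\<dots> \<le> 4 * 2.097264025 - 1" by (simp add: field_simps)
  finally show "g_fun 2 / 2 \<le> 2.097264025" by (simp add: g_fun_2)
  have "4 * 2.097264024 - 1 \<le> (5837465777 / 2147483648 - 1 / 2 ^ 32 :: real) * (5837465777 / 2147483648 - 1 / 2 ^ 32)"
    by (simp add: field_simps)
  also have "\<dots> \<le> exp 2"
    unfolding sq using e(2) by (intro mult_mono) (auto simp: field_simps)
  finally show "2.097264024 \<le> g_fun 2 / 2" by (simp add: g_fun_2)
qed

lemma g_pos: "0 < g_fun 2"
  using half_g_lower by simp

lemma D_const_pos: "0 < D_const k"
  by (simp add: D_const_def)

lemma D'_const_pos: "0 < D'_const k"
  using g_pos by (simp add: D'_const_def D_const_pos)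

lemma D_const_ge_10: "10 \<le> k \<Longrightarrow> D_const k = sqrt (fact (2 * k)) / fact k"
  by (simp add: D_const_def)

lemma D'_const_ge_2: "2 \<le> k \<Longrightarrow> D'_const k = D_const k * (g_fun 2 / 2) ^ k"
  by (simp add: D'_const_def)

text \<open>With \<open>x = k + 3/4\<close> and \<open>u = 1/(4x)\<close>, the exact ratio \<open>2 sqrt ((1 - u) / (1 + u))\<close> of consecutive
  values of \<open>D\<close> is replaced by its Pade approximant \<open>2 (1 - u/2) / (1 + u/2)\<close>.\<close>

definition pade :: "nat \<Rightarrow> real" where "pade k = (8 * real k + 5) / (8 * real k + 7)"

lemma pade_pos: "0 < pade k" and pade_le_1: "pade k \<le> 1"
  by (auto simp: pade_def)

lemma D_const_Suc_le:
  assumes "10 \<le> k"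
  shows "D_const (Suc k) \<le> D_const k * (2 * pade k)"
proof -
  define x where "x = real k"
  have x: "0 \<le> x" by (simp add: x_def)
  \<comment> \<open>After division by \<open>2 * x + 2\<close> both sides are cubics that differ
    only in their constant terms, 49 and 50.\<close>
  have "((2 * x + 2) * (2 * x + 1)) * (8 * x + 7)\<^sup>2 \<le> ((x + 1) * (2 * (8 * x + 5)))\<^sup>2"
    using x by (simp add: power2_eq_square algebra_simps)
  then have "(2 * x + 2) * (2 * x + 1) \<le> ((x + 1) * (2 * (8 * x + 5)))\<^sup>2 / (8 * x + 7)\<^sup>2"
    using x by (subst pos_le_divide_eq) auto
  also have "\<dots> = ((x + 1) * (2 * pade k))\<^sup>2"
    by (simp add: pade_def x_def power_divide[symmetric])
  finally have "sqrt ((2 * x + 2) * (2 * x + 1)) \<le> (x + 1) * (2 * pade k)"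
    using x pade_pos[of k] by (intro real_le_lsqrt) auto
  then have "sqrt ((2 * x + 2) * (2 * x + 1)) / (x + 1) \<le> 2 * pade k"
    using x by (simp add: pos_divide_le_eq mult.commute)
  moreover have "D_const (Suc k) = D_const k * (sqrt ((2 * x + 2) * (2 * x + 1)) / (x + 1))"
  proof -
    have "fact (2 * Suc k) = (2 * x + 2) * (2 * x + 1) * fact (2 * k)" and "fact (Suc k) = (x + 1) * fact k"
      by (simp_all add: x_def algebra_simps)
    moreover have "D_const (Suc k) = sqrt (fact (2 * Suc k)) / fact (Suc k)"
      using assms by (intro D_const_ge_10) simp
    ultimately have "D_const (Suc k) = sqrt ((2 * x + 2) * (2 * x + 1) * fact (2 * k)) / ((x + 1) * fact k)"
      by (simp only:)
    also have "\<dots> = D_const k * (sqrt ((2 * x + 2) * (2 * x + 1)) / (x + 1))"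
      using assms by (simp only: D_const_ge_10 real_sqrt_mult) (simp add: mult_ac)
    finally show ?thesis .
  qed
  ultimately show ?thesis
    using D_const_pos[of k] by (simp only: mult_left_mono less_imp_le)
qed

lemma D'_term_Suc_le:
  assumes "10 \<le> k" "0 \<le> x"
  shows "D'_const (Suc k) * x ^ Suc k \<le> D'_const k * x ^ k * (g_fun 2 * x * pade k)"
proof -
  have "D_const (Suc k) * ((g_fun 2 / 2) ^ Suc k * x ^ Suc k)
      \<le> D_const k * (2 * pade k) * ((g_fun 2 / 2) ^ Suc k * x ^ Suc k)"
    using assms(2) g_pos by (intro mult_right_mono D_const_Suc_le assms(1)) auto
  then show ?thesis using assms(1) by (simp add: D'_const_ge_2 mult_ac)
qed

lemma summable_D':
  assumes "0 \<le> x" "g_fun 2 * x < 1"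
  shows "summable (\<lambda>k. D'_const k * x ^ k)"
proof (rule summable_ratio_test[of "g_fun 2 * x" 10])
  fix k :: nat assume k: "10 \<le> k"
  have nn: "0 \<le> D'_const i * x ^ i" for i using D'_const_pos[of i] assms(1) by simp
  have "D'_const (Suc k) * x ^ Suc k \<le> D'_const k * x ^ k * (g_fun 2 * x * pade k)"
    using k assms(1) by (rule D'_term_Suc_le)
  also have "\<dots> \<le> D'_const k * x ^ k * (g_fun 2 * x * 1)"
    using nn[of k] g_pos assms(1) pade_le_1[of k] by (intro mult_left_mono) auto
  finally show "norm (D'_const (Suc k) * x ^ Suc k) \<le> g_fun 2 * x * norm (D'_const k * x ^ k)"
    using nn[of k] nn[of "Suc k"] by (simp only: real_norm_def abs_of_nonneg) (simp add: mult_ac)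
qed (fact assms(2))

section \<open>The equation for \<open>x_sol\<close>\<close>

abbreviation h_term :: "nat \<Rightarrow> nat \<Rightarrow> real \<Rightarrow> real" where
  "h_term l k x \<equiv> D'_const (k + (l + 1)) * x ^ (k + (l + 1))"

lemma h1_eq_suminf:
  assumes "0 \<le> x" "g_fun 2 * x < 1"
  shows "h1 l x = ennreal (\<Sum>k. h_term l k x)"
  unfolding h1_def
proof (rule suminf_ennreal2)
  show "0 \<le> h_term l k x" for k
    using D'_const_pos[of "k + (l + 1)"] assms(1) by simp
  show "summable (\<lambda>k. h_term l k x)"
    using summable_ignore_initial_segment[OF summable_D'[OF assms], of "l + 1"] .
qed

lemma sum_le_h1: 
  assumes "0 \<le> x"
  shows "ennreal (\<Sum>k<n. h_term l k x) \<le> h1 l x"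
proof -
  have "ennreal (\<Sum>k<n. h_term l k x)
      = (\<Sum>k<n. ennreal (h_term l k x))"
    using assms D'_const_pos by (intro sum_ennreal[symmetric]) (simp add: less_imp_le)
  also have "\<dots> \<le> h1 l x" unfolding h1_def by (rule sum_le_suminf) auto
  finally show ?thesis .
qed

text \<open>The exponents in \<open>h1\<close> are at least \<open>l + 1\<close> and those in
  \<open>h2\<close> at most \<open>l\<close>. Hence division by \<open>x ^ (l + 1)\<close> makes
  \<open>h1\<close> nondecreasing and, by \<open>h2_scale_less\<close>, \<open>h2\<close> strictly
  decreasing; uniqueness and all comparisons with \<open>c_const\<close> rest on this. The
  multiplicative form also covers infinite values.\<close>

lemma h1_scale_le:
  assumes "0 < x" "x \<le> y"
  shows "ennreal ((y / x) ^ (l + 1)) * h1 l x \<le> h1 l y"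
  unfolding h1_def ennreal_suminf_cmult[symmetric]
proof (rule suminf_le)
  fix k
  have "(y / x) ^ (l + 1) * (h_term l k x)
      = D'_const (k + (l + 1)) * (y ^ (l + 1) * x ^ k)"
    using assms(1) by (simp add: power_add power_divide)
  also have "\<dots> \<le> D'_const (k + (l + 1)) * (y ^ (l + 1) * y ^ k)"
    using assms D'_const_pos by (intro mult_left_mono power_mono) (auto simp: less_imp_le)
  also have "\<dots> = h_term l k y" by (simp add: power_add)
  finally show "ennreal ((y / x) ^ (l + 1)) * ennreal (h_term l k x)
      \<le> ennreal (h_term l k y)"
    using assms by (subst ennreal_mult'[symmetric]) (auto intro!: ennreal_leI)
qed auto

lemma h2_scale_less:
  assumes "0 < x" "x < y"
  shows "h2 l y < (y / x) ^ (l + 1) * h2 l x"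
proof -
  have 1: "1 < y / x" using assms by simp
  have "(\<Sum>k = 1..l. D'_const k * y ^ k) \<le> (\<Sum>k = 1..l. (y / x) ^ (l + 1) * (D'_const k * x ^ k))"
  proof (rule sum_mono)
    fix k assume "k \<in> {1..l}"
    then have "(y / x) ^ k \<le> (y / x) ^ (l + 1)" using 1 by (intro power_increasing) auto
    then have "(y / x) ^ k * (D'_const k * x ^ k) \<le> (y / x) ^ (l + 1) * (D'_const k * x ^ k)"
      using D'_const_pos[of k] assms(1) by (intro mult_right_mono) auto
    moreover have "(y / x) ^ k * (D'_const k * x ^ k) = D'_const k * y ^ k"
      using assms(1) by (simp add: power_divide)
    ultimately show "D'_const k * y ^ k \<le> (y / x) ^ (l + 1) * (D'_const k * x ^ k)" by simp
  qed
  moreover have "2 < (y / x) ^ (l + 1) * 2" using one_less_power[OF 1, of "l + 1"] by linarith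
  ultimately show ?thesis by (simp add: h2_def distrib_left sum_distrib_left)
qed

lemma h2_ge_2: "0 \<le> x \<Longrightarrow> 2 \<le> h2 l x"
  unfolding h2_def using D'_const_pos by (auto intro!: sum_nonneg mult_nonneg_nonneg simp: less_imp_le)

lemma h2_mono: "0 \<le> x \<Longrightarrow> x \<le> y \<Longrightarrow> h2 l x \<le> h2 l y"
  unfolding h2_def using D'_const_pos
  by (intro add_left_mono sum_mono mult_left_mono power_mono) (auto simp: less_imp_le)

text \<open>Hence the series \<open>h\<^sub>1\<close> diverges at its radius of convergence \<open>1 / g(2)\<close>.\<close>

lemma D'_radius_ge:
  assumes "10 \<le> k"
  shows "1 / (2 * k) \<le> D'_const k * (1 / g_fun 2) ^ k"
proof -
  have k: "0 < k" using assms by simp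
  \<comment> \<open>For \<open>10 \<le> k\<close> the square of \<open>D_const k\<close> is the
    central binomial coefficient.\<close>
  have "4 ^ k / (2 * real k) \<le> real ((2 * k) choose k)"
    by (rule central_binomial_lower_bound[OF k])
  also have "\<dots> = fact (2 * k) / (fact k * fact k)"
    by (simp add: binomial_fact)
  finally have "sqrt (4 ^ k / (2 * real k)) \<le> sqrt (fact (2 * k) / (fact k * fact k))"
    by (rule real_sqrt_le_mono)
  also have "\<dots> = D_const k"
    using assms by (simp add: D_const_ge_10 real_sqrt_divide)
  finally have "2 ^ k / sqrt (2 * real k) \<le> D_const k"
    by (simp add: real_sqrt_divide real_sqrt_power)
  then have "1 / sqrt (2 * real k) \<le> D_const k / 2 ^ k"
    by (simp add: pos_le_divide_eq)
  also have "\<dots> = D'_const k * (1 / g_fun 2) ^ k"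
    using assms g_pos by (simp add: D'_const_ge_2 power_divide)
  finally have "1 / sqrt (2 * real k) \<le> D'_const k * (1 / g_fun 2) ^ k" .
  moreover have "sqrt (2 * real k) \<le> 2 * real k"
    using k by (intro real_le_lsqrt) (auto simp: power2_eq_square)
  then have "1 / (2 * real k) \<le> 1 / sqrt (2 * real k)"
    using k by (intro divide_left_mono) auto
  ultimately show ?thesis by linarith
qed

text \<open>At the radius the nonnegative series diverges, so some partial sum exceeds
  \<open>c + 1\<close> there; being a polynomial, it still exceeds \<open>c\<close> slightly to the
  left, where the series converges.\<close>

lemma exists_h1_above:
  obtains x where "0 < x" "g_fun 2 * x < 1" "ennreal c \<le> h1 l x"
proof -
  let ?r = "1 / g_fun 2"
  let ?P = "\<lambda>n x. \<Sum>k<n. h_term l k x"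
  have r: "0 < ?r" using g_pos by simp
  have "\<not> summable (\<lambda>k. h_term l k ?r)"
  proof
    assume "summable (\<lambda>k. h_term l k ?r)"
    then have "summable (\<lambda>k. D'_const k * ?r ^ k)"
      by (subst (asm) summable_iff_shift)
    then have "summable (\<lambda>k. 1 / (2 * real k))"
      by (rule summable_comparison_test[rotated])
        (use D'_radius_ge in \<open>auto intro!: exI[of _ 10]\<close>)
    then have "summable (\<lambda>k. 2 * (1 / (2 * real k)))" by (rule summable_mult)
    then have "summable (\<lambda>k. inverse (real k))" by (simp add: inverse_eq_divide)
    then show False using not_summable_harmonic[where 'a = real] by simp
  qed
  moreover have "0 \<le> h_term l k ?r" for k
    using D'_const_pos[of "k + (l + 1)"] r by simp
  ultimately obtain n where n: "c + 1 < ?P n ?r"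
    using summableI_nonneg_bounded[of "\<lambda>k. h_term l k ?r" "c + 1"]
    by (meson not_less)
  have "((\<lambda>x. ?P n x) \<longlongrightarrow> ?P n ?r) (at_left ?r)"
    by (intro tendsto_intros)
  then have "eventually (\<lambda>x. c < ?P n x) (at_left ?r)"
    using n by (intro order_tendstoD(1)) auto
  moreover have "eventually (\<lambda>x. 0 < x) (at_left ?r)" "eventually (\<lambda>x. x < ?r) (at_left ?r)"
    using eventually_at_left_real[OF r] by (auto elim: eventually_mono)
  ultimately have "eventually (\<lambda>x. 0 < x \<and> x < ?r \<and> c < ?P n x) (at_left ?r)"
    by eventually_elim auto
  then obtain x where x: "0 < x" "x < ?r" "c < ?P n x"
    by (metis (mono_tags, lifting) eventually_happens trivial_limit_at_left_real)
  show ?thesis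
  proof
    show "g_fun 2 * x < 1" using x(2) g_pos by (simp add: field_simps)
    show "ennreal c \<le> h1 l x"
      using sum_le_h1[of x l n] x by (meson ennreal_leI less_imp_le order_trans)
  qed (fact x(1))
qed

text \<open>The difference is negative at 0. At \<open>y\<close> the series reaches the value of
  \<open>h2\<close> at the radius and hence that of \<open>h2\<close> at \<open>y\<close>, so the
  intermediate value theorem gives a solution. Two solutions would contradict the opposite
  monotonicity after division by \<open>x ^ (l + 1)\<close>.\<close>

lemma ex1_h1_eq_h2: "\<exists>!x. 0 < x \<and> h1 l x = ennreal (h2 l x)"
proof -
  define a where "a k = D'_const (k + (l + 1))" for k
  have h1: "h1 l x = ennreal (x ^ (l + 1) * (\<Sum>k. a k * x ^ k))" and sm: "summable (\<lambda>k. a k * x ^ k)"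
    if x: "0 < x" "g_fun 2 * x < 1" for x
  proof -
    have 1: "summable (\<lambda>k. h_term l k x)"
      using summable_ignore_initial_segment[OF summable_D', of x "l + 1"] x by simp
    have 2: "h_term l k x = x ^ (l + 1) * (a k * x ^ k)" for k
      by (simp add: a_def power_add)
    show s: "summable (\<lambda>k. a k * x ^ k)"
      using 1 x(1) unfolding 2 by (subst (asm) summable_cmult_iff) auto
    show "h1 l x = ennreal (x ^ (l + 1) * (\<Sum>k. a k * x ^ k))"
      using x by (subst h1_eq_suminf) (simp_all only: 2 suminf_mult[OF s] less_imp_le)
  qed
  obtain y where y: "0 < y" "g_fun 2 * y < 1" "ennreal (h2 l (1 / g_fun 2)) \<le> h1 l y"
    by (rule exists_h1_above)
  have yr: "y \<le> 1 / g_fun 2" using y(2) g_pos by (simp add: field_simps)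
  \<comment> \<open>A point of convergence beyond \<open>y\<close> makes the power series continuous
    on all of \<open>{0..y}\<close>.\<close>
  obtain K where K: "y < K" "K < 1 / g_fun 2"
    using dense[of y "1 / g_fun 2"] y(2) g_pos by (auto simp: field_simps)
  have sK: "summable (\<lambda>k. a k * K ^ k)"
    using sm[of K] K y(1) g_pos by (auto simp: field_simps)
  define f where "f x = x ^ (l + 1) * (\<Sum>k. a k * x ^ k) - h2 l x" for x
  have "\<exists>x. 0 \<le> x \<and> x \<le> y \<and> f x = 0"
  proof (rule IVT')
    show "f 0 \<le> 0" using h2_ge_2[of 0 l] by (simp add: f_def)
    have "ennreal (h2 l y) \<le> ennreal (y ^ (l + 1) * (\<Sum>k. a k * y ^ k))"
      using y yr h2_mono[of y "1 / g_fun 2" l] by (metis ennreal_leI h1 less_imp_le order_trans)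
    moreover have "0 \<le> y ^ (l + 1) * (\<Sum>k. a k * y ^ k)"
      using y(1) D'_const_pos by (intro mult_nonneg_nonneg suminf_nonneg sm y) (auto simp: a_def less_imp_le)
    ultimately show "0 \<le> f y" by (simp add: f_def)
    have "isCont f x" if "0 \<le> x" "x \<le> y" for x
      unfolding f_def h2_def
      by (intro continuous_intros isCont_powser[OF sK]) (use that K in auto)
    then show "continuous_on {0..y} f"
      by (intro continuous_at_imp_continuous_on) auto
  qed (use y in simp)
  then obtain x where x: "0 \<le> x" "x \<le> y" "f x = 0" by blast
  have "x \<noteq> 0" using x(3) h2_ge_2[of 0 l] by (auto simp: f_def)
  have "g_fun 2 * x < 1"
    using g_pos by (intro le_less_trans[OF mult_left_mono[OF x(2)] y(2)]) simp
  then have sol: "0 < x \<and> h1 l x = ennreal (h2 l x)"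
    using x(1,3) \<open>x \<noteq> 0\<close> by (subst h1) (auto simp: f_def)
  have "\<not> (0 < x \<and> x < y \<and> h1 l x = ennreal (h2 l x) \<and> h1 l y = ennreal (h2 l y))" for x y
  proof (intro notI, elim conjE)
    assume xy: "0 < x" "x < y" and e: "h1 l x = ennreal (h2 l x)" "h1 l y = ennreal (h2 l y)"
    have "ennreal ((y / x) ^ (l + 1) * h2 l x) \<le> ennreal (h2 l y)"
      using h1_scale_le[of x y l] xy h2_ge_2[of x l] by (subst ennreal_mult) (auto simp: e simp del: power_Suc)
    then show False
      using h2_scale_less[OF xy, of l] h2_ge_2[of y l] xy by simp
  qed
  then show ?thesis using sol by (metis linorder_neqE_linordered_idom)
qed

lemma x_sol_pos: "0 < x_sol l" and h1_x_sol: "h1 l (x_sol l) = ennreal (h2 l (x_sol l))"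
  using theI'[OF ex1_h1_eq_h2[of l]] by (auto simp: x_sol_def)

text \<open>Up to \<open>x_sol\<close> the scaling of \<open>h1\<close> carries the common value at
  the solution over to \<open>b\<close>; from \<open>x_sol\<close> on, \<open>h2_le_c_const\<close>
  does so with \<open>h2\<close>. The two regimes meet in the constant
  \<open>c_const\<close>.\<close>

lemma sum_D'_le_c_const:
  assumes "0 \<le> b" "b \<le> x_sol l" 
  shows "(\<Sum>k\<in>{l + 1..n}. D'_const k * b ^ k) \<le> c_const l * b ^ (l + 1)"
proof -
  let ?x = "x_sol l"
  have x: "0 < ?x" by (rule x_sol_pos)
  have "ennreal (\<Sum>k<Suc n. h_term l k ?x) \<le> ennreal (h2 l ?x)"
    using sum_le_h1[of ?x l "Suc n"] x by (simp only: h1_x_sol less_imp_le)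
  then have le: "(\<Sum>k<Suc n. h_term l k ?x) \<le> h2 l ?x"
    using h2_ge_2[of ?x l] x by (subst (asm) ennreal_le_iff) auto
  have "(\<Sum>k\<in>{l + 1..n}. D'_const k * b ^ k) \<le> (\<Sum>k\<in>{l + 1..n + (l + 1)}. D'_const k * b ^ k)"
    using assms(1) D'_const_pos by (intro sum_mono2) (auto simp: less_imp_le)
  also have "\<dots> = (\<Sum>k<Suc n. h_term l k b)"
    by (rule sum.reindex_bij_witness[of _ "\<lambda>k. k + (l + 1)" "\<lambda>k. k - (l + 1)"]) auto
  also have "\<dots> \<le> (\<Sum>k<Suc n. (b / ?x) ^ (l + 1) * (h_term l k ?x))"
  proof (rule sum_mono)
    fix k
    have "D'_const (k + (l + 1)) * (b ^ (l + 1) * b ^ k) \<le> D'_const (k + (l + 1)) * (b ^ (l + 1) * ?x ^ k)"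
      using assms D'_const_pos by (intro mult_left_mono power_mono) (auto simp: less_imp_le)
    then show "h_term l k b
        \<le> (b / ?x) ^ (l + 1) * (h_term l k ?x)"
      using x by (simp add: power_add power_divide mult_ac)
  qed
  also have "\<dots> \<le> (b / ?x) ^ (l + 1) * h2 l ?x"
    unfolding sum_distrib_left[symmetric] using assms(1) x by (intro mult_left_mono le) auto
  also have "\<dots> = c_const l * b ^ (l + 1)" by (simp add: c_const_def power_divide)
  finally show ?thesis .
qed

lemma h2_le_c_const:
  assumes "x_sol l \<le> b"
  shows "h2 l b \<le> c_const l * b ^ (l + 1)"
proof (cases "x_sol l = b")
  case True
  then show ?thesis using x_sol_pos[of l] by (simp add: c_const_def)
next
  case False
  then have "h2 l b \<le> (b / x_sol l) ^ (l + 1) * h2 l (x_sol l)"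
    using h2_scale_less[OF x_sol_pos, of l b l] assms by simp
  also have "\<dots> = c_const l * b ^ (l + 1)" by (simp add: c_const_def power_divide)
  finally show ?thesis .
qed

text \<open>A certificate without the exact solution: \<open>h1 \<le> h2\<close> at \<open>y\<close>
  forces \<open>y \<le> x_sol l\<close>, and to the left of the solution the decreasing quotient is
  at least \<open>c_const l\<close>.\<close>

lemma c_const_le:
  assumes "0 < y" "h1 l y \<le> ennreal (h2 l y)"
  shows "c_const l \<le> h2 l y / y ^ (l + 1)"
proof (cases "y \<le> x_sol l")
  case True
  show ?thesis
  proof (cases "y = x_sol l")
    case False
    then have "h2 l (x_sol l) \<le> (x_sol l / y) ^ (l + 1) * h2 l y"
      using h2_scale_less[OF assms(1), of "x_sol l" l] True by simp
    then show ?thesis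
      using assms(1) x_sol_pos[of l] by (simp add: c_const_def power_divide divide_simps mult_ac)
  qed (simp add: c_const_def)
next
  case False
  let ?x = "x_sol l"
  have xy: "0 < ?x" "?x < y" using False x_sol_pos by auto
  have "ennreal ((y / ?x) ^ (l + 1) * h2 l ?x) \<le> ennreal (h2 l y)"
    using order_trans[OF h1_scale_le[of ?x y l] assms(2)] xy h2_ge_2[of ?x l]
    by (subst ennreal_mult) (auto simp: h1_x_sol simp del: power_Suc)
  then have "(y / ?x) ^ (l + 1) * h2 l ?x \<le> h2 l y"
    using h2_ge_2[of y l] xy by (subst (asm) ennreal_le_iff) auto
  then show ?thesis using h2_scale_less[OF xy, of l] by simp
qed


text \<open>Upper bounds, in units of \<open>10\<^sup>-\<^sup>1\<^sup>2\<close>, for the tails \<open>(\<Sum>i\<ge>k. D'\<^sub>i y\<^sup>i) / (D'\<^sub>k y\<^sup>k)\<close> at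
  \<open>k = K - m\<close>, when \<open>g(2) y \<le> z / 10\<^sup>9\<close>. The recursion starts with the crude bound \<open>1 / (1 - g(2) y)\<close>
  at \<open>k = K\<close>.\<close>

fun tail_bound :: "nat \<Rightarrow> int \<Rightarrow> nat \<Rightarrow> int" where
  "tail_bound K z 0 = 10 ^ 21 div (10 ^ 9 - z) + 1"
| "tail_bound K z (Suc m) = 10 ^ 12
    + (z * (8 * (int K - int m - 1) + 5) * tail_bound K z m) div (10 ^ 9 * (8 * (int K - int m - 1) + 7)) + 1"

lemma divide_le_div_add_1: "real_of_int a / real_of_int b \<le> real_of_int (a div b) + 1"
  using real_of_int_floor_add_one_ge[of "real_of_int a / real_of_int b"]
  by (simp add: floor_divide_of_int_eq)

lemma sum_le_geometric:
  fixes s :: "nat \<Rightarrow> real"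
  assumes "\<And>k. s (Suc k) \<le> s k * c" "\<And>k. 0 \<le> s k" "c < 1"
  shows "(\<Sum>k<n. s k) \<le> s 0 * (1 / (1 - c))"
  using assms(1,2)
proof (induction n arbitrary: s)
  case 0
  then show ?case using assms(3) by simp
next
  case (Suc n)
  have "(\<Sum>k<Suc n. s k) = s 0 + (\<Sum>k<n. s (Suc k))" by (rule sum.lessThan_Suc_shift)
  also have "\<dots> \<le> s 0 + s (Suc 0) * (1 / (1 - c))"
    by (intro add_left_mono Suc.IH) (rule Suc.prems)+
  also have "\<dots> \<le> s 0 + s 0 * c * (1 / (1 - c))"
    using assms(3) by (intro add_left_mono mult_right_mono Suc.prems) auto
  also have "\<dots> = s 0 * (1 / (1 - c))" using assms(3) by (simp add: field_simps)
  finally show ?case .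
qed

text \<open>A tail from \<open>j\<close> is its first term plus the tail from \<open>Suc j\<close>,
  and the ratio of the first terms is at most \<open>g_fun 2 * y * pade j\<close>. Rounding up to an
  integer at each stage keeps the computation small.\<close>

lemma sum_D'_le_tail_bound:
  fixes z :: int
  assumes z: "0 < z" "z < 10 ^ 9" and y: "0 < y" "g_fun 2 * y \<le> z / 10 ^ 9" and m: "m + 10 \<le> K"
  shows "(\<Sum>k<n. D'_const (K - m + k) * y ^ (K - m + k))
    \<le> D'_const (K - m) * y ^ (K - m) * (tail_bound K z m / 10 ^ 12)"
  using m
proof (induction m arbitrary: n)
  case 0
  let ?t = "\<lambda>k. D'_const k * y ^ k"
  define c where "c = real_of_int z / 10 ^ 9"
  have t: "0 \<le> ?t k" for k using y(1) D'_const_pos[of k] by simp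
  have c: "c < 1" using z(2) by (simp add: c_def)
  have "(\<Sum>k<n. ?t (K + k)) \<le> ?t (K + 0) * (1 / (1 - c))"
  proof (rule sum_le_geometric[OF _ _ c])
    fix k
    have "?t (Suc (K + k)) \<le> ?t (K + k) * (g_fun 2 * y * pade (K + k))"
      using y(1) 0 by (intro D'_term_Suc_le) auto
    also have "\<dots> \<le> ?t (K + k) * (c * 1)"
      using y g_pos z(1) pade_le_1[of "K + k"] less_imp_le[OF pade_pos[of "K + k"]] t[of "K + k"]
      unfolding c_def by (intro mult_left_mono mult_mono) auto
    finally show "?t (K + Suc k) \<le> ?t (K + k) * c" by simp
  qed (rule t)
  also have "\<dots> \<le> ?t K * (tail_bound K z 0 / 10 ^ 12)"
  proof -
    have "1 / (1 - c) = (10 ^ 21 / real_of_int (10 ^ 9 - z)) / 10 ^ 12"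
      using z(2) by (simp add: c_def field_simps)
    also have "\<dots> \<le> (real_of_int (10 ^ 21 div (10 ^ 9 - z)) + 1) / 10 ^ 12"
      using divide_le_div_add_1[of "10 ^ 21" "10 ^ 9 - z"] by (intro divide_right_mono) simp_all
    finally have "1 / (1 - c) \<le> tail_bound K z 0 / 10 ^ 12" by simp
    from mult_left_mono[OF this t[of K]] show ?thesis by simp
  qed
  finally show ?case by simp
next
  case (Suc m)
  let ?t = "\<lambda>k. D'_const k * y ^ k"
  define j where "j = K - Suc m"
  have j: "K - m = Suc j" "10 \<le> j" "int j = int K - int m - 1" using Suc.prems by (auto simp: j_def)
  have t: "0 \<le> ?t k" for k using y(1) D'_const_pos[of k] by simp
  define T where "T = tail_bound K z m"
  have T: "0 \<le> T"
    unfolding T_def using Suc.prems z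
  proof (induction m)
    case (Suc m)
    then have "0 \<le> z * (8 * (int K - int m - 1) + 5) * tail_bound K z m" "0 < 10 ^ 9 * (8 * (int K - int m - 1) + 7)" by auto
    then have "0 \<le> (z * (8 * (int K - int m - 1) + 5) * tail_bound K z m) div (10 ^ 9 * (8 * (int K - int m - 1) + 7))"
      by (simp only: pos_imp_zdiv_nonneg_iff)
    then show ?case by simp
  qed (simp add: pos_imp_zdiv_nonneg_iff)
  have step: "(\<Sum>k<n'. ?t (j + k)) \<le> ?t j * (tail_bound K z (Suc m) / 10 ^ 12)" if "n' = Suc n" for n' n
  proof -
    have "(\<Sum>k<n'. ?t (j + k)) = ?t j + (\<Sum>k<n. ?t (K - m + k))"
      unfolding that by (subst sum.lessThan_Suc_shift) (simp add: j)
    also have "\<dots> \<le> ?t j + ?t (Suc j) * (T / 10 ^ 12)"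
      using Suc.IH[of n] Suc.prems by (simp add: j T_def)
    also have "\<dots> \<le> ?t j + ?t j * (z / 10 ^ 9 * pade j) * (T / 10 ^ 12)"
    proof (intro add_left_mono mult_right_mono)
      have "?t (Suc j) \<le> ?t j * (g_fun 2 * y * pade j)"
        using y(1) j(2) by (intro D'_term_Suc_le) auto
      also have "\<dots> \<le> ?t j * (z / 10 ^ 9 * pade j)"
        using y(2) t[of j] pade_pos[of j] by (intro mult_left_mono mult_right_mono) auto
      finally show "?t (Suc j) \<le> ?t j * (z / 10 ^ 9 * pade j)" .
    qed (use T in simp)
    also have "\<dots> = ?t j * ((10 ^ 12 + real_of_int (z * (8 * int j + 5) * T) / real_of_int (10 ^ 9 * (8 * int j + 7))) / 10 ^ 12)"
      by (simp add: pade_def field_simps)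
    also have "\<dots> \<le> ?t j * ((10 ^ 12 + (real_of_int ((z * (8 * int j + 5) * T) div (10 ^ 9 * (8 * int j + 7))) + 1)) / 10 ^ 12)"
      using t[of j] by (intro mult_left_mono divide_right_mono add_left_mono divide_le_div_add_1) auto
    also have "\<dots> = ?t j * (tail_bound K z (Suc m) / 10 ^ 12)"
      by (simp add: T_def j(3))
    finally show ?thesis .
  qed
  \<comment> \<open>\<open>step\<close> peels off the first term and so needs a nonempty sum; adding
    one nonnegative term provides it.\<close>
  have "(\<Sum>k<n. ?t (j + k)) \<le> (\<Sum>k<Suc n. ?t (j + k))" using t by simp
  also note step[of "Suc n" n]
  finally show ?case by (simp only: j_def)
qed

section \<open>Numerical evaluation of \<open>c_const\<close>\<close>

primrec horner :: "real \<Rightarrow> real list \<Rightarrow> real" where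
  "horner v [] = 0"
| "horner v (a # as) = a + v * horner v as"

lemma horner_append: "horner v (as @ [c]) = horner v as + v ^ length as * c"
  by (induction as) (simp_all add: algebra_simps)

lemma sum_eq_horner: "i \<le> j \<Longrightarrow> (\<Sum>k\<in>{i..<j}. a k * v ^ k) = v ^ i * horner v (map a [i..<j])"
proof (induction j rule: dec_induct)
  case (step j)
  then show ?case by (simp add: horner_append distrib_left power_add[symmetric])
qed simp

text \<open>Coefficients for powers of \<open>v\<close>, an approximation of
  \<open>g_fun 2 / 2 * y\<close>. Only \<open>D'_const 1\<close> lacks the factor
  \<open>g_fun 2 / 2\<close>, so its power of \<open>v\<close> is divided out.\<close>

definition D_coeff :: "real \<Rightarrow> real \<Rightarrow> nat \<Rightarrow> real" where
  "D_coeff y v k = (if k = 1 then 3.11 * y / v else D_const k)"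

lemma D_const_10_le: "D_const 10 \<le> 429.832526"
proof -
  have "(fact 20 :: real) = 184756 * (fact 10 * fact 10)" by (simp add: fact_numeral)
  then have "D_const 10 = sqrt 184756"
    by (simp add: D_const_def real_sqrt_mult)
  also have "\<dots> \<le> 429.832526" by (rule real_le_lsqrt) (auto simp: power2_eq_square)
  finally show ?thesis .
qed

lemma D'_term_le:
  assumes "0 < y" "2.097264025 * y \<le> v"
  shows "D'_const k * y ^ k \<le> D_coeff y v k * v ^ k"
proof -
  have v: "0 < v" using assms by simp
  have "g_fun 2 / 2 * y \<le> v"
    by (rule order_trans[OF mult_right_mono[OF half_g_upper] assms(2)]) (use assms(1) in simp)
  then have "(g_fun 2 / 2 * y) ^ k \<le> v ^ k"
    using g_pos assms by (intro power_mono) auto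
  then have "D_const k * ((g_fun 2 / 2) ^ k * y ^ k) \<le> D_const k * v ^ k"
    unfolding power_mult_distrib using D_const_pos[of k] by (intro mult_left_mono) auto
  then show ?thesis
    using v by (cases "k = 1") (auto simp: D'_const_def D_coeff_def mult.assoc)
qed

lemma D'_term_ge:
  assumes "0 < v" "v \<le> 2.097264024 * y"
  shows "D_coeff y v k * v ^ k \<le> D'_const k * y ^ k"
proof -
  have y: "0 < y" using assms by simp
  have "v \<le> g_fun 2 / 2 * y"
    by (rule order_trans[OF assms(2) mult_right_mono[OF half_g_lower]]) (use y in simp)
  then have "v ^ k \<le> (g_fun 2 / 2 * y) ^ k"
    using assms by (intro power_mono) auto
  then have "D_const k * v ^ k \<le> D_const k * ((g_fun 2 / 2) ^ k * y ^ k)"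
    unfolding power_mult_distrib using D_const_pos[of k] by (intro mult_left_mono) auto
  then show ?thesis
    using assms(1) by (cases "k = 1") (auto simp: D'_const_def D_coeff_def mult.assoc)
qed

text \<open>\<open>v\<close> and \<open>v'\<close> enclose \<open>g_fun 2 / 2 * y\<close>. The
  comparison takes \<open>h1\<close> at the upper and \<open>h2\<close> at the lower end, the final
  quotient takes \<open>h2\<close> at the upper end. All terms from index 10 on enter as one last
  Horner coefficient, a bound for \<open>D_const 10\<close> times the tail bound.\<close>

lemma c_const_le_numeric:
  fixes z :: int
  assumes l: "l < 10" and z: "0 < z" "z < 10 ^ 9" and y: "0 < y" "2.097264025 * y \<le> v" "2 * v \<le> z / 10 ^ 9"
    and v': "0 < v'" "v' \<le> 2.097264024 * y"
    and K: "10 \<le> K" and T: "tail_bound K z (K - 10) \<le> T"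
    and sums: "v ^ (l + 1) * horner v (map (D_coeff y v) [l + 1..<10] @ [429.832526 * (T / 10 ^ 12)])
      \<le> 2 + v' * horner v' (map (D_coeff y v') [1..<l + 1])"
    and c: "2 + v * horner v (map (D_coeff y v) [1..<l + 1]) \<le> c * y ^ (l + 1)"
  shows "c_const l \<le> c"
proof -
  let ?t = "\<lambda>k. D'_const k * y ^ k"
  have v: "0 < v" using y by simp
  have t: "0 < ?t k" for k using y(1) D'_const_pos[of k] by simp
  note up = D'_term_le[OF y(1,2)]
  have gy: "g_fun 2 * y \<le> z / 10 ^ 9"
  proof -
    have "g_fun 2 / 2 * y \<le> v"
      by (rule order_trans[OF mult_right_mono[OF half_g_upper] y(2)]) (use y(1) in simp)
    then show ?thesis using y(3) by simp
  qed
  have tail: "(\<Sum>k<n. ?t (10 + k)) \<le> ?t 10 * (tail_bound K z (K - 10) / 10 ^ 12)" for n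
    using sum_D'_le_tail_bound[OF z y(1) gy, of "K - 10" K n] K by simp
  have T0: "0 \<le> tail_bound K z (K - 10)"
    using tail[of 0] t[of 10] by (simp add: zero_le_mult_iff zero_le_divide_iff del: zero_less_mult_iff)
  have "h1 l y \<le> ennreal (h2 l y)"
  proof (subst h1_eq_suminf)
    have gy1: "g_fun 2 * y < 1" using gy z(2) by simp
    then show "g_fun 2 * y < 1" .
    show "ennreal (\<Sum>k. ?t (k + (l + 1))) \<le> ennreal (h2 l y)"
    proof (intro ennreal_leI suminf_le_const)
      show "summable (\<lambda>k. ?t (k + (l + 1)))"
        using summable_ignore_initial_segment[OF summable_D', of y "l + 1"] y(1) gy1 by simp
      fix n
      have "(\<Sum>k<n. ?t (k + (l + 1))) = (\<Sum>k\<in>{l + 1..<n + (l + 1)}. ?t k)"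
        by (rule sum.reindex_bij_witness[of _ "\<lambda>k. k - (l + 1)" "\<lambda>k. k + (l + 1)"]) auto
      \<comment> \<open>The range is enlarged so that it always passes 10, where the tail bound
        takes over.\<close>
      also have "\<dots> \<le> (\<Sum>k\<in>{l + 1..<10 + (n + (l + 1))}. ?t k)"
        using t by (intro sum_mono2) (auto simp: less_imp_le)
      also have "\<dots> = (\<Sum>k\<in>{l + 1..<10}. ?t k) + (\<Sum>k\<in>{10..<10 + (n + (l + 1))}. ?t k)"
        using l by (intro sum.atLeastLessThan_concat[symmetric]) auto
      also have "(\<Sum>k\<in>{10..<10 + (n + (l + 1))}. ?t k) = (\<Sum>k<n + (l + 1). ?t (10 + k))"
        by (rule sum.reindex_bij_witness[of _ "\<lambda>k. 10 + k" "\<lambda>k. k - 10"]) auto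
      also have "\<dots> \<le> ?t 10 * (tail_bound K z (K - 10) / 10 ^ 12)"
        by (rule tail)
      also have "\<dots> \<le> (429.832526 * v ^ 10) * (T / 10 ^ 12)"
      proof (rule mult_mono)
        have "D_const 10 * v ^ 10 \<le> 429.832526 * v ^ 10"
          using v by (intro mult_right_mono D_const_10_le) auto
        then show "?t 10 \<le> 429.832526 * v ^ 10" using up[of 10] by (simp add: D_coeff_def)
      qed (use T T0 v in \<open>auto intro!: divide_right_mono\<close>)
      also have "(\<Sum>k\<in>{l + 1..<10}. ?t k) \<le> (\<Sum>k\<in>{l + 1..<10}. D_coeff y v k * v ^ k)"
        by (intro sum_mono up)
      also have "\<dots> = v ^ (l + 1) * horner v (map (D_coeff y v) [l + 1..<10])"
        using l by (intro sum_eq_horner) simp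
      also have "\<dots> + (429.832526 * v ^ 10) * (T / 10 ^ 12)
          = v ^ (l + 1) * horner v (map (D_coeff y v) [l + 1..<10] @ [429.832526 * (T / 10 ^ 12)])"
      proof -
        have "l + 1 + (9 - l) = 10" using l by simp
        then have "v ^ 10 = v ^ (l + 1) * v ^ (9 - l)" by (metis power_add)
        then show ?thesis unfolding horner_append by (simp add: distrib_left)
      qed
      also note sums
      also have "v' * horner v' (map (D_coeff y v') [1..<l + 1]) = (\<Sum>k\<in>{1..<l + 1}. D_coeff y v' k * v' ^ k)"
        by (subst sum_eq_horner) simp_all
      also have "\<dots> \<le> (\<Sum>k\<in>{1..<l + 1}. ?t k)"
        by (intro sum_mono D'_term_ge v')
      finally show "(\<Sum>k<n. ?t (k + (l + 1))) \<le> h2 l y"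
        by (simp add: h2_def atLeastLessThanSuc_atLeastAtMost)
    qed
  qed (use y in simp)
  then have "c_const l \<le> h2 l y / y ^ (l + 1)" by (rule c_const_le[OF y(1)])
  also have "h2 l y \<le> 2 + (\<Sum>k\<in>{1..<l + 1}. D_coeff y v k * v ^ k)"
    unfolding h2_def Suc_eq_plus1[symmetric] atLeastLessThanSuc_atLeastAtMost
    by (intro add_left_mono sum_mono up)
  also have "(\<Sum>k\<in>{1..<l + 1}. D_coeff y v k * v ^ k) = v * horner v (map (D_coeff y v) [1..<l + 1])"
    by (subst sum_eq_horner) simp_all
  also note c
  finally show ?thesis using y(1) by (simp add: divide_right_mono)
qed

text \<open>In this and the next four results \<open>y\<close> is a decimal not exceeding the
  solution, and \<open>z\<close> is \<open>2 * v\<close> in units of \<open>10^-9\<close>, rounded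
  up. The start of the recursion moves from 30 to 260 because its crude initial bound is damped by
  powers of \<open>g_fun 2 * y\<close>, which rises from 0.54 to 0.95.\<close>

lemma c_const_0: "c_const 0 \<le> 15.6"
proof (rule c_const_le_numeric[where l = 0 and y = "0.1283" and v = "0.2690789745" and v' = "0.2690789742"])
  show "tail_bound 30 538157949 (30 - 10) \<le> 2113206751572" by code_simp
qed (simp_all add: D_coeff_def D_const_def power_divide upt_rec)

lemma c_const_1: "c_const 1 \<le> 113.0"
proof (rule c_const_le_numeric[where l = 1 and y = "0.14751" and v = "0.3093674164" and v' = "0.3093674161"])
  show "tail_bound 30 618734833 (30 - 10) \<le> 2538223224986" by code_simp
qed (simp_all add: D_coeff_def D_const_def power_divide upt_rec)

lemma c_const_2: "c_const 2 \<le> 633.8"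
proof (rule c_const_le_numeric[where l = 2 and y = "0.18907" and v = "0.3965297093" and v' = "0.3965297090"])
  show "tail_bound 60 793059419 (60 - 10) \<le> 4514752374407" by code_simp
qed (simp_all add: D_coeff_def D_const_def power_divide upt_rec)

lemma c_const_3: "c_const 3 \<le> 3204.8"
proof (rule c_const_le_numeric[where l = 3 and y = "0.215063" and v = "0.4510438931" and v' = "0.4510438927"])
  show "tail_bound 120 902087787 (120 - 10) \<le> 8959991452670" by code_simp
qed (simp_all add: D_coeff_def D_const_def power_divide upt_rec)

lemma c_const_4: "c_const 4 \<le> 15945.6"
proof (rule c_const_le_numeric[where l = 4 and y = "0.2267734" and v = "0.4756036937" and v' = "0.4756036934"])
  show "tail_bound 260 951207388 (260 - 10) \<le> 16590666920272" by code_simp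
qed (simp_all add: D_coeff_def D_const_def power_divide upt_rec)

section \<open>Differences of finite measures\<close>

text \<open>Every signed measure that occurs is a difference of two finite measures. A Hahn set then
  comes from the decomposition for two such measures, and integrals can be computed from
  \<open>N1\<close> and \<open>N2\<close> instead of the chosen Jordan decomposition.\<close>

locale measure_difference =
  fixes M N1 N2 :: "'a measure"
  assumes finite_N1: "finite_measure N1" and finite_N2: "finite_measure N2"
    and sets_N1: "sets N1 = sets M" and sets_N2: "sets N2 = sets M"
begin

definition V :: "'a set \<Rightarrow> real" where "V A = measure N1 A - measure N2 A"

lemma space_N: "space N1 = space M" "space N2 = space M"
  using sets_N1 sets_N2 by (auto dest: sets_eq_imp_space_eq)

lemma V_sums:
  assumes "range A \<subseteq> sets M" "disjoint_family A"
  shows "(\<lambda>i. V (A i)) sums V (\<Union>i. A i)"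
  unfolding V_def
  using assms finite_measure.finite_measure_UNION[OF finite_N1, of A]
    finite_measure.finite_measure_UNION[OF finite_N2, of A]
  by (intro sums_diff) (auto simp: sets_N1 sets_N2)

lemma finite_signed_measure_V: "finite_signed_measure M V"
  unfolding finite_signed_measure_def
  using V_sums by (auto simp: V_def measure_notin_sets sets_N1 sets_N2)

definition P :: "'a set" where "P = hahn_set M V"

lemma hahn: "is_hahn_set M V P"
proof -
  obtain Y where Y: "Y \<in> sets N1" "\<forall>X\<in>sets N1. X \<subseteq> Y \<longrightarrow> N2 X \<le> N1 X"
      "\<forall>X\<in>sets N1. X \<inter> Y = {} \<longrightarrow> N1 X \<le> N2 X"
    using finite_unsigned_Hahn_decomposition[OF finite_N1 finite_N2] sets_N1 sets_N2 by auto
  have "is_hahn_set M V Y"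
    unfolding is_hahn_set_def
  proof (intro conjI ballI impI)
    show "Y \<in> sets M" using Y(1) sets_N1 by simp
    fix B assume B: "B \<in> sets M"
    show "0 \<le> V B" if "B \<subseteq> Y"
      using Y(2) B that finite_N1 finite_N2
      by (simp add: V_def sets_N1 finite_measure.emeasure_eq_measure)
    show "V B \<le> 0" if "B \<subseteq> space M - Y"
    proof -
      have "B \<inter> Y = {}" using that by blast
      then show ?thesis
        using Y(3) B finite_N1 finite_N2
        by (simp add: V_def sets_N1 finite_measure.emeasure_eq_measure)
    qed
  qed
  then show ?thesis unfolding P_def hahn_set_def by (rule someI)
qed

lemma P_sets [measurable]: "P \<in> sets M"
  and V_nonneg: "B \<in> sets M \<Longrightarrow> B \<subseteq> P \<Longrightarrow> 0 \<le> V B"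
  and V_nonpos: "B \<in> sets M \<Longrightarrow> B \<subseteq> space M - P \<Longrightarrow> V B \<le> 0"
  using hahn by (auto simp: is_hahn_set_def)

lemma V_split: "A \<in> sets M \<Longrightarrow> V A = V (A \<inter> P) + V (A - P)"
  using finite_measure.finite_measure_Union[OF finite_N1, of "A \<inter> P" "A - P"]
    finite_measure.finite_measure_Union[OF finite_N2, of "A \<inter> P" "A - P"]
  by (simp add: V_def sets_N1 sets_N2 Int_Diff_Un) (simp add: Int_Diff_disjoint)

lemma emeasure_jordan_pos: "A \<in> sets M \<Longrightarrow> emeasure (jordan_pos M V) A = ennreal (V (A \<inter> P))"
  and emeasure_jordan_neg: "A \<in> sets M \<Longrightarrow> emeasure (jordan_neg M V) A = ennreal (- V (A - P))"
proof -
  have 1: "countably_additive (sets M) (\<lambda>A. ennreal (V (A \<inter> P)))"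
  proof (rule countably_additiveI)
    fix A :: "nat \<Rightarrow> 'a set"
    assume A: "range A \<subseteq> sets M" "disjoint_family A"
    then have "(\<lambda>i. V (A i \<inter> P)) sums V (\<Union>i. A i \<inter> P)"
      by (intro V_sums) (auto simp: disjoint_family_on_def)
    then show "(\<Sum>i. ennreal (V (A i \<inter> P))) = ennreal (V ((\<Union>i. A i) \<inter> P))"
      using A(1) by (subst suminf_ennreal2) (auto intro!: V_nonneg simp: sums_iff)
  qed
  have 2: "countably_additive (sets M) (\<lambda>A. ennreal (- V (A - P)))"
  proof (rule countably_additiveI)
    fix A :: "nat \<Rightarrow> 'a set"
    assume A: "range A \<subseteq> sets M" "disjoint_family A"
    then have "(\<lambda>i. V (A i - P)) sums V (\<Union>i. A i - P)"
      by (intro V_sums) (auto simp: disjoint_family_on_def)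
    moreover have "(\<Union>i. A i - P) = (\<Union>i. A i) - P" by blast
    ultimately have s: "(\<lambda>i. - V (A i - P)) sums (- V ((\<Union>i. A i) - P))"
      by (simp only: sums_minus)
    have "0 \<le> - V (A i - P)" for i
      using A(1) sets.sets_into_space[of "A i" M] V_nonpos[of "A i - P"] by auto
    then show "(\<Sum>i. ennreal (- V (A i - P))) = ennreal (- V ((\<Union>i. A i) - P))"
      using s by (subst suminf_ennreal2) (auto simp: sums_iff)
  qed
  have "positive (sets M) (\<lambda>A. ennreal (V (A \<inter> P)))" "positive (sets M) (\<lambda>A. ennreal (- V (A - P)))"
    by (auto simp: positive_def V_def)
  then show "A \<in> sets M \<Longrightarrow> emeasure (jordan_pos M V) A = ennreal (V (A \<inter> P))"
    and "A \<in> sets M \<Longrightarrow> emeasure (jordan_neg M V) A = ennreal (- V (A - P))"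
    using 1 2 unfolding jordan_pos_def jordan_neg_def P_def[symmetric]
    by (simp_all add: emeasure_measure_of_sigma sets.sigma_algebra_axioms)
qed

lemma sets_jordan [simp]: "sets (jordan_pos M V) = sets M" "sets (jordan_neg M V) = sets M"
  and space_jordan [simp]: "space (jordan_pos M V) = space M" "space (jordan_neg M V) = space M"
  by (auto simp: jordan_pos_def jordan_neg_def)

lemma finite_jordan: "finite_measure (jordan_pos M V)" "finite_measure (jordan_neg M V)"
  by (auto intro!: finite_measureI simp: emeasure_jordan_pos emeasure_jordan_neg)

lemma tv_norm_le: "tv_norm M V \<le> measure N1 (space M) + measure N2 (space M)"
proof -
  have mono1: "measure N1 (space M \<inter> P) \<le> measure N1 (space M)"
    by (rule finite_measure.finite_measure_mono[OF finite_N1])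
      (use sets.sets_into_space[OF P_sets] in \<open>auto simp: sets_N1\<close>)
  have mono2: "measure N2 (space M - P) \<le> measure N2 (space M)"
    by (rule finite_measure.finite_measure_mono[OF finite_N2]) (auto simp: sets_N2)
  have "measure (jordan_pos M V) (space M) = V (space M \<inter> P)"
    unfolding measure_def by (simp add: emeasure_jordan_pos V_nonneg)
  moreover have "measure (jordan_neg M V) (space M) = - V (space M - P)"
    unfolding measure_def by (simp add: emeasure_jordan_neg V_nonpos)
  moreover have "V (space M \<inter> P) \<le> measure N1 (space M)"
    unfolding V_def
    using mono1 measure_nonneg[of N2 "space M \<inter> P"] by linarith
  moreover have "- V (space M - P) \<le> measure N2 (space M)"
    unfolding V_def using mono2 measure_nonneg[of N1 "space M - P"] by linarith
  ultimately show ?thesis by (simp add: tv_norm_def)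
qed

text \<open>The equality of the two differences is written with sums, so that it makes sense for
  infinite integrals and passes to monotone limits.\<close>

lemma nn_integral_jordan:
  assumes "h \<in> borel_measurable M"
  shows "(\<integral>\<^sup>+x. h x \<partial>jordan_pos M V) + (\<integral>\<^sup>+x. h x \<partial>N2) = (\<integral>\<^sup>+x. h x \<partial>jordan_neg M V) + (\<integral>\<^sup>+x. h x \<partial>N1)"
  using assms
proof (induction h rule: borel_measurable_induct)
  case (cong f g)
  then show ?case
    by (simp add: space_N cong: nn_integral_cong_simp)
next
  case (set A)
  have "V (A \<inter> P) + measure N2 A = - V (A - P) + measure N1 A"
    using V_split[OF set] by (simp add: V_def)
  moreover have "0 \<le> V (A \<inter> P)" "0 \<le> - V (A - P)"
    using set sets.sets_into_space[OF set] by (auto intro!: V_nonneg V_nonpos)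
  ultimately show ?case
    using set finite_N1 finite_N2
    by (simp add: emeasure_jordan_pos emeasure_jordan_neg sets_N1 sets_N2
        finite_measure.emeasure_eq_measure ennreal_plus[symmetric] del: ennreal_plus)
next
  case (mult u c)
  have int_mult: "(\<integral>\<^sup>+x. c * u x \<partial>N) = c * (\<integral>\<^sup>+x. u x \<partial>N)" if "sets N = sets M" for N
    using mult.hyps by (intro nn_integral_cmult) (auto simp: measurable_cong_sets[OF that refl])
  show ?case
    by (simp only: int_mult[OF sets_jordan(1)] int_mult[OF sets_jordan(2)] int_mult[OF sets_N1] int_mult[OF sets_N2]
        distrib_left[symmetric] mult.IH)
next
  case (add u v)
  have int_add: "(\<integral>\<^sup>+x. v x + u x \<partial>N) = (\<integral>\<^sup>+x. v x \<partial>N) + (\<integral>\<^sup>+x. u x \<partial>N)" if "sets N = sets M" for N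
    using add.hyps by (intro nn_integral_add) (auto simp: measurable_cong_sets[OF that refl])
  have swap: "(a + b) + (c + d) = (a + c) + (b + d)" for a b c d :: ennreal
    by (simp add: ac_simps)
  show ?case
    by (simp only: int_add[OF sets_jordan(1)] int_add[OF sets_jordan(2)] int_add[OF sets_N1] int_add[OF sets_N2]
        swap add.IH)
next
  case (seq U)
  have mct: "(\<integral>\<^sup>+x. (SUP i. U i) x \<partial>N) = (SUP i. \<integral>\<^sup>+x. U i x \<partial>N)"
    and inc: "incseq (\<lambda>i. \<integral>\<^sup>+x. U i x \<partial>N)" if "sets N = sets M" for N
  proof -
    show "(\<integral>\<^sup>+x. (SUP i. U i) x \<partial>N) = (SUP i. \<integral>\<^sup>+x. U i x \<partial>N)"
      unfolding SUP_apply using seq.hyps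
      by (intro nn_integral_monotone_convergence_SUP) (auto simp: measurable_cong_sets[OF that refl])
    show "incseq (\<lambda>i. \<integral>\<^sup>+x. U i x \<partial>N)"
      using seq.hyps by (intro incseq_nn_integral) auto
  qed
  have "(SUP i. \<integral>\<^sup>+x. U i x \<partial>jordan_pos M V) + (SUP i. \<integral>\<^sup>+x. U i x \<partial>N2)
      = (SUP i. (\<integral>\<^sup>+x. U i x \<partial>jordan_pos M V) + (\<integral>\<^sup>+x. U i x \<partial>N2))"
    by (intro ennreal_SUP_add[symmetric] inc sets_jordan sets_N2)
  also have "\<dots> = (SUP i. (\<integral>\<^sup>+x. U i x \<partial>jordan_neg M V) + (\<integral>\<^sup>+x. U i x \<partial>N1))"
    by (simp only: seq.IH)
  also have "\<dots> = (SUP i. \<integral>\<^sup>+x. U i x \<partial>jordan_neg M V) + (SUP i. \<integral>\<^sup>+x. U i x \<partial>N1)"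
    by (intro ennreal_SUP_add inc sets_jordan sets_N1)
  finally show ?case
    by (simp only: mct[OF sets_N1] mct[OF sets_N2] mct[OF sets_jordan(1)] mct[OF sets_jordan(2)])
qed

text \<open>Boundedness makes all integrals finite, so the preceding identity can be solved for the
  differences, separately for the positive and the negative part of \<open>h\<close>.\<close>

lemma signed_integral_eq:
  assumes h: "h \<in> borel_measurable M" and B: "\<And>x. x \<in> space M \<Longrightarrow> \<bar>h x\<bar> \<le> B"
  shows "signed_integral M V h = integral\<^sup>L N1 h - integral\<^sup>L N2 h"
proof -
  have int: "integrable N h" and fin: "(\<integral>\<^sup>+x. ennreal (h x) \<partial>N) < \<infinity>" "(\<integral>\<^sup>+x. ennreal (- h x) \<partial>N) < \<infinity>"
    if N: "finite_measure N" "sets N = sets M" for N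
  proof -
    have sp: "space N = space M" using N(2) by (rule sets_eq_imp_space_eq)
    have hN: "h \<in> borel_measurable N" using h by (simp only: measurable_cong_sets[OF N(2) refl])
    have "AE x in N. norm (h x) \<le> B" by (rule AE_I2) (simp add: sp B)
    then show int: "integrable N h" using hN by (rule finite_measure.integrable_const_bound[OF N(1)])
    then show "(\<integral>\<^sup>+x. ennreal (h x) \<partial>N) < \<infinity>" "(\<integral>\<^sup>+x. ennreal (- h x) \<partial>N) < \<infinity>"
      using int unfolding real_integrable_def by (simp_all add: less_top)
  qed
  have e: "enn2real a + enn2real b = enn2real c + enn2real d" if "a + b = c + d" "a < \<infinity>" "b < \<infinity>" "c < \<infinity>" "d < \<infinity>"
    for a b c d :: ennreal
  proof -
    have "enn2real (a + b) = enn2real (c + d)" using that(1) by simp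
    then show ?thesis using that(2-5) by (simp add: enn2real_plus)
  qed
  note f1 = fin[OF finite_jordan(1) sets_jordan(1)] and f2 = fin[OF finite_jordan(2) sets_jordan(2)]
    and f3 = fin[OF finite_N1 sets_N1] and f4 = fin[OF finite_N2 sets_N2]
  have m: "(\<lambda>x. ennreal (h x)) \<in> borel_measurable M" "(\<lambda>x. ennreal (- h x)) \<in> borel_measurable M"
    using h by auto
  have "enn2real (\<integral>\<^sup>+x. ennreal (h x) \<partial>jordan_pos M V) + enn2real (\<integral>\<^sup>+x. ennreal (h x) \<partial>N2)
      = enn2real (\<integral>\<^sup>+x. ennreal (h x) \<partial>jordan_neg M V) + enn2real (\<integral>\<^sup>+x. ennreal (h x) \<partial>N1)"
    by (rule e[OF nn_integral_jordan[OF m(1)] f1(1) f4(1) f2(1) f3(1)])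
  moreover have "enn2real (\<integral>\<^sup>+x. ennreal (- h x) \<partial>jordan_pos M V) + enn2real (\<integral>\<^sup>+x. ennreal (- h x) \<partial>N2)
      = enn2real (\<integral>\<^sup>+x. ennreal (- h x) \<partial>jordan_neg M V) + enn2real (\<integral>\<^sup>+x. ennreal (- h x) \<partial>N1)"
    by (rule e[OF nn_integral_jordan[OF m(2)] f1(2) f4(2) f2(2) f3(2)])
  ultimately show ?thesis
    unfolding signed_integral_def real_lebesgue_integral_def[OF int[OF finite_jordan(1) sets_jordan(1)]]
      real_lebesgue_integral_def[OF int[OF finite_jordan(2) sets_jordan(2)]]
      real_lebesgue_integral_def[OF int[OF finite_N1 sets_N1]]
      real_lebesgue_integral_def[OF int[OF finite_N2 sets_N2]]
    by linarith
qed

end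

section \<open>The algebra of signed measures\<close>

context measurable_abelian_semigroup
begin

definition dconv :: "'a measure \<Rightarrow> 'a measure \<Rightarrow> 'a measure" where
  "dconv A B = distr (A \<Otimes>\<^sub>M B) M (\<lambda>(x, y). x \<otimes> y)"

text \<open>Products of powers of the \<open>U r\<close> are formed here: for probability measures
  the monoid laws follow from Tonelli's theorem, and signed measures are reached later by
  linearity.\<close>

definition prob_monoid :: "'a measure monoid" where
  "prob_monoid = \<lparr>carrier = {N. prob_space N \<and> sets N = sets M}, mult = dconv, one = return M \<one>\<rparr>"

lemma one_space: "\<one> \<in> space M"
  by (simp add: space_eq_carrier)

lemma sets_dconv [simp]: "sets (dconv A B) = sets M"
  by (simp add: dconv_def)

lemma measurable_add': 
  assumes "sets A = sets M" "sets B = sets M"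
  shows "(\<lambda>(x, y). x \<otimes> y) \<in> measurable (A \<Otimes>\<^sub>M B) M"
  using measurable_add
  by (simp only: measurable_cong_sets[OF sets_pair_measure_cong[OF assms] refl])

lemma nn_integral_dconv:
  assumes A: "sets A = sets M" and B: "sets B = sets M" "sigma_finite_measure B"
    and h: "h \<in> borel_measurable M"
  shows "(\<integral>\<^sup>+z. h z \<partial>dconv A B) = (\<integral>\<^sup>+x. \<integral>\<^sup>+y. h (x \<otimes> y) \<partial>B \<partial>A)"
proof -
  note add = measurable_add'[OF A B(1)]
  have "(\<integral>\<^sup>+z. h z \<partial>dconv A B) = (\<integral>\<^sup>+p. h (case p of (x, y) \<Rightarrow> x \<otimes> y) \<partial>(A \<Otimes>\<^sub>M B))"
    unfolding dconv_def by (rule nn_integral_distr[OF add]) (use h in simp)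
  also have "\<dots> = (\<integral>\<^sup>+x. \<integral>\<^sup>+y. h (x \<otimes> y) \<partial>B \<partial>A)"
    using sigma_finite_measure.nn_integral_fst[OF B(2) measurable_compose[OF add h]] by simp
  finally show ?thesis .
qed

lemma prob_space_dconv:
  assumes "prob_space A" "prob_space B" "sets A = sets M" "sets B = sets M"
  shows "prob_space (dconv A B)"
proof -
  interpret A: prob_space A by fact
  interpret B: prob_space B by fact
  interpret AB: pair_prob_space A B ..
  show ?thesis unfolding dconv_def by (rule AB.prob_space_distr[OF measurable_add'[OF assms(3,4)]])
qed

lemma measure_eqI_nn_integral:
  assumes "sets A = sets M" "sets B = sets M"
    and "\<And>h. h \<in> borel_measurable M \<Longrightarrow> (\<integral>\<^sup>+x. h x \<partial>A) = (\<integral>\<^sup>+x. h x \<partial>B)"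
  shows "A = B"
proof (rule measure_eqI)
  fix S assume "S \<in> sets A"
  then have "S \<in> sets M" using assms(1) by simp
  then show "emeasure A S = emeasure B S"
    using assms(3)[of "indicator S"] by (simp add: assms(1,2))
qed (simp add: assms)

lemma measurable_inner:
  assumes "x \<in> space M" "h \<in> borel_measurable M"
  shows "(\<lambda>y. h (x \<otimes> y)) \<in> borel_measurable M"
  using measurable_compose[OF measurable_Pair1'[OF assms(1)] measurable_compose[OF measurable_add assms(2)]]
  by simp

lemma measurable_inner_nn_integral:
  assumes "h \<in> borel_measurable M" "sigma_finite_measure B" "sets B = sets M"
  shows "(\<lambda>x. \<integral>\<^sup>+y. h (x \<otimes> y) \<partial>B) \<in> borel_measurable M"
proof -
  have "(\<lambda>x. \<integral>\<^sup>+y. (\<lambda>p. h (case p of (x, y) \<Rightarrow> x \<otimes> y)) (x, y) \<partial>B) \<in> borel_measurable M"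
    by (rule sigma_finite_measure.borel_measurable_nn_integral_fst[OF assms(2)])
      (rule measurable_compose[OF measurable_add'[OF refl assms(3)] assms(1)])
  then show ?thesis by simp
qed

lemma comm_monoid_prob_monoid: "comm_monoid prob_monoid"
proof (rule comm_monoidI)
  fix A B assume "A \<in> carrier prob_monoid" "B \<in> carrier prob_monoid"
  then have A: "prob_space A" "sets A = sets M" and B: "prob_space B" "sets B = sets M"
    by (auto simp: prob_monoid_def)
  interpret A: prob_space A by fact
  interpret B: prob_space B by fact
  interpret AB: pair_sigma_finite A B ..
  have space: "space A = space M" "space B = space M" using A B by (auto dest: sets_eq_imp_space_eq)
  show "A \<otimes>\<^bsub>prob_monoid\<^esub> B \<in> carrier prob_monoid"
    using A B by (simp add: prob_monoid_def prob_space_dconv)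
  show "A \<otimes>\<^bsub>prob_monoid\<^esub> B = B \<otimes>\<^bsub>prob_monoid\<^esub> A"
  proof -
    have "dconv A B = dconv B A"
    proof (rule measure_eqI_nn_integral)
      fix h :: "'a \<Rightarrow> ennreal" assume h: "h \<in> borel_measurable M"
      have "(\<integral>\<^sup>+z. h z \<partial>dconv A B) = (\<integral>\<^sup>+x. \<integral>\<^sup>+y. h (x \<otimes> y) \<partial>B \<partial>A)"
        using A B h by (intro nn_integral_dconv) (auto intro: B.sigma_finite_measure_axioms)
      also have "\<dots> = (\<integral>\<^sup>+y. \<integral>\<^sup>+x. h (x \<otimes> y) \<partial>A \<partial>B)"
        using AB.Fubini[of "\<lambda>p. h (case p of (x, y) \<Rightarrow> x \<otimes> y)"]
          measurable_compose[OF measurable_add'[OF A(2) B(2)] h] by simp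
      also have "\<dots> = (\<integral>\<^sup>+y. \<integral>\<^sup>+x. h (y \<otimes> x) \<partial>A \<partial>B)"
        by (intro nn_integral_cong) (simp add: space space_eq_carrier m_comm)
      also have "\<dots> = (\<integral>\<^sup>+z. h z \<partial>dconv B A)"
        using A B h by (intro nn_integral_dconv[symmetric]) (auto intro: A.sigma_finite_measure_axioms)
      finally show "(\<integral>\<^sup>+z. h z \<partial>dconv A B) = (\<integral>\<^sup>+z. h z \<partial>dconv B A)" .
    qed simp_all
    then show ?thesis by (simp add: prob_monoid_def)
  qed
  show "\<one>\<^bsub>prob_monoid\<^esub> \<otimes>\<^bsub>prob_monoid\<^esub> A = A"
  proof -
    have "dconv (return M \<one>) A = A"
    proof (rule measure_eqI_nn_integral)
      fix h :: "'a \<Rightarrow> ennreal" assume h: "h \<in> borel_measurable M"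
      have "(\<integral>\<^sup>+z. h z \<partial>dconv (return M \<one>) A) = (\<integral>\<^sup>+x. \<integral>\<^sup>+y. h (x \<otimes> y) \<partial>A \<partial>return M \<one>)"
        using A h by (intro nn_integral_dconv) (auto intro: A.sigma_finite_measure_axioms)
      also have "\<dots> = (\<integral>\<^sup>+y. h (\<one> \<otimes> y) \<partial>A)"
        by (intro nn_integral_return one_space measurable_inner_nn_integral[OF h] A) unfold_locales
      also have "\<dots> = (\<integral>\<^sup>+y. h y \<partial>A)"
        by (intro nn_integral_cong) (simp add: space space_eq_carrier)
      finally show "(\<integral>\<^sup>+z. h z \<partial>dconv (return M \<one>) A) = (\<integral>\<^sup>+z. h z \<partial>A)" .
    qed (simp_all add: A)
    then show ?thesis by (simp add: prob_monoid_def)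
  qed
  fix C assume "C \<in> carrier prob_monoid"
  then have C: "prob_space C" "sets C = sets M"
    by (auto simp: prob_monoid_def)
  interpret C: prob_space C by fact
  have spaceC: "space C = space M" using C by (auto dest: sets_eq_imp_space_eq)
  show "(A \<otimes>\<^bsub>prob_monoid\<^esub> B) \<otimes>\<^bsub>prob_monoid\<^esub> C = A \<otimes>\<^bsub>prob_monoid\<^esub> (B \<otimes>\<^bsub>prob_monoid\<^esub> C)"
  proof -
    interpret BC: prob_space "dconv B C" by (rule prob_space_dconv[OF B(1) C(1) B(2) C(2)])
    have "dconv (dconv A B) C = dconv A (dconv B C)"
    proof (rule measure_eqI_nn_integral)
      fix h :: "'a \<Rightarrow> ennreal" assume h: "h \<in> borel_measurable M"
      have "(\<integral>\<^sup>+z. h z \<partial>dconv (dconv A B) C) = (\<integral>\<^sup>+u. \<integral>\<^sup>+z. h (u \<otimes> z) \<partial>C \<partial>dconv A B)"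
        using C h by (intro nn_integral_dconv) (auto intro: C.sigma_finite_measure_axioms)
      also have "\<dots> = (\<integral>\<^sup>+x. \<integral>\<^sup>+y. \<integral>\<^sup>+z. h (x \<otimes> y \<otimes> z) \<partial>C \<partial>B \<partial>A)"
        using A B C h
        by (intro nn_integral_dconv measurable_inner_nn_integral)
          (auto intro: C.sigma_finite_measure_axioms B.sigma_finite_measure_axioms)
      also have "\<dots> = (\<integral>\<^sup>+x. \<integral>\<^sup>+y. \<integral>\<^sup>+z. h (x \<otimes> (y \<otimes> z)) \<partial>C \<partial>B \<partial>A)"
        by (intro nn_integral_cong) (simp add: space spaceC space_eq_carrier m_assoc)
      also have "\<dots> = (\<integral>\<^sup>+x. \<integral>\<^sup>+u. h (x \<otimes> u) \<partial>dconv B C \<partial>A)"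
        using B C h
        by (intro nn_integral_cong nn_integral_dconv[symmetric] measurable_inner)
          (auto intro: C.sigma_finite_measure_axioms simp: space)
      also have "\<dots> = (\<integral>\<^sup>+z. h z \<partial>dconv A (dconv B C))"
        using A h by (intro nn_integral_dconv[symmetric]) (auto intro: BC.sigma_finite_measure_axioms)
      finally show "(\<integral>\<^sup>+z. h z \<partial>dconv (dconv A B) C) = (\<integral>\<^sup>+z. h z \<partial>dconv A (dconv B C))" .
    qed simp_all
    then show ?thesis by (simp add: prob_monoid_def)
  qed
next
  show "\<one>\<^bsub>prob_monoid\<^esub> \<in> carrier prob_monoid"
    by (simp add: prob_monoid_def prob_space_return one_space)
qed

end

section \<open>The homomorphism from the algebra to signed measures\<close>

lemma summable_imp_count_space_integrable:
  fixes g :: "'i \<Rightarrow> real"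
  assumes "(\<lambda>a. \<bar>g a\<bar>) summable_on UNIV"
  shows "integrable (count_space UNIV) g" and "integral\<^sup>L (count_space UNIV) g = (\<Sum>\<^sub>\<infinity>a. g a)"
proof -
  have s: "Infinite_Set_Sum.abs_summable_on g UNIV"
    by (rule abs_summable_equivalent[THEN iffD1]) (use assms in simp)
  then show "integrable (count_space UNIV) g" by (simp only: Infinite_Set_Sum.abs_summable_on_def)
  show "integral\<^sup>L (count_space UNIV) g = (\<Sum>\<^sub>\<infinity>a. g a)"
    using infsetsum_infsum[OF s] by (simp add: infsetsum_def)
qed

text \<open>Since \<open>ennreal\<close> sends negative reals to 0,
  \<open>ennreal (coeff f a)\<close> and \<open>ennreal (coeff (- f) a)\<close> are the positive and
  the negative part of the coefficient.\<close>

lemma pairing_eq_nn_integral: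
  fixes h :: "'i \<Rightarrow> ennreal" and f :: "'i l1"
  assumes h: "\<And>a. h a \<le> ennreal B" "0 \<le> B"
  shows "pairing f (\<lambda>a. enn2real (h a)) = enn2real (\<integral>\<^sup>+a. ennreal (coeff f a) * h a \<partial>count_space UNIV)
      - enn2real (\<integral>\<^sup>+a. ennreal (coeff (- f) a) * h a \<partial>count_space UNIV)"
    and "(\<integral>\<^sup>+a. ennreal (coeff f a) * h a \<partial>count_space UNIV) < \<infinity>"
proof -
  have top: "h a < \<infinity>" for a
    by (rule le_less_trans[OF h(1)]) simp
  have b: "\<bar>enn2real (h a)\<bar> \<le> B" for a
    using enn2real_leI[OF h(2,1)] by simp
  have e: "ennreal (coeff f a * enn2real (h a)) = ennreal (coeff f a) * h a" for f :: "'i l1" and a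
    using top[of a] by (simp add: ennreal_mult'')
  note int = summable_imp_count_space_integrable[OF pairing_abs_summable[of "\<lambda>a. enn2real (h a)", OF b]]
  have "pairing f (\<lambda>a. enn2real (h a)) = enn2real (\<integral>\<^sup>+a. ennreal (coeff f a * enn2real (h a)) \<partial>count_space UNIV)
      - enn2real (\<integral>\<^sup>+a. ennreal (coeff (- f) a * enn2real (h a)) \<partial>count_space UNIV)"
    unfolding pairing_def int(2)[symmetric] real_lebesgue_integral_def[OF int(1)] by simp
  then show "pairing f (\<lambda>a. enn2real (h a)) = enn2real (\<integral>\<^sup>+a. ennreal (coeff f a) * h a \<partial>count_space UNIV)
      - enn2real (\<integral>\<^sup>+a. ennreal (coeff (- f) a) * h a \<partial>count_space UNIV)"
    by (simp only: e)
  show "(\<integral>\<^sup>+a. ennreal (coeff f a) * h a \<partial>count_space UNIV) < \<infinity>"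
    using int(1)[of f] unfolding real_integrable_def e by (simp add: less_top)
qed

lemma nn_integral_coeff_add:
  "(\<integral>\<^sup>+a. ennreal (coeff f a) \<partial>count_space UNIV) + (\<integral>\<^sup>+a. ennreal (coeff (- f) a) \<partial>count_space UNIV)
    = ennreal (norm f)"
proof -
  have s: "(\<lambda>a. \<bar>\<bar>coeff f a\<bar>\<bar>) summable_on UNIV" using coeff_abs_summable[of f] by simp
  have "(\<integral>\<^sup>+a. ennreal (coeff f a) \<partial>count_space UNIV) + (\<integral>\<^sup>+a. ennreal (coeff (- f) a) \<partial>count_space UNIV)
      = (\<integral>\<^sup>+a. ennreal (coeff f a) + ennreal (coeff (- f) a) \<partial>count_space UNIV)"
    by (rule nn_integral_add[symmetric]) auto
  also have "\<dots> = (\<integral>\<^sup>+a. ennreal \<bar>coeff f a\<bar> \<partial>count_space UNIV)"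
    by (rule nn_integral_cong) (auto simp: abs_if ennreal_neg)
  also have "\<dots> = ennreal (integral\<^sup>L (count_space UNIV) (\<lambda>a. \<bar>coeff f a\<bar>))"
    by (rule nn_integral_eq_integral[OF summable_imp_count_space_integrable(1)[OF s]]) simp
  finally show ?thesis
    unfolding summable_imp_count_space_integrable(2)[OF s] norm_l1_def .
qed

locale convolution_representation = measurable_abelian_semigroup G M
  for G :: "('a, 'b) monoid_scheme" (structure) and M :: "'a measure" +
  fixes D :: "'r set" and U :: "'r \<Rightarrow> 'a measure"
  assumes finite_D: "finite D" and prob_U: "r \<in> D \<Longrightarrow> prob_space (U r)"
    and sets_U: "r \<in> D \<Longrightarrow> sets (U r) = sets M"
begin

sublocale P: comm_monoid prob_monoid
  by (rule comm_monoid_prob_monoid)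

text \<open>The law of a sum of independent summands, \<open>count a r\<close> of them with law
  \<open>U r\<close>. Types outside \<open>D\<close> are ignored, which keeps \<open>mu\<close>
  multiplicative on all multisets.\<close>

definition mu :: "'r multiset \<Rightarrow> 'a measure" where
  "mu a = finprod prob_monoid (\<lambda>r. U r [^]\<^bsub>prob_monoid\<^esub> count a r) D"

lemma U_carrier: "r \<in> D \<Longrightarrow> U r \<in> carrier prob_monoid"
  by (simp add: prob_monoid_def prob_U sets_U)

lemma mu_carrier: "mu a \<in> carrier prob_monoid"
  unfolding mu_def by (intro P.finprod_closed) (auto intro: U_carrier)

lemma prob_mu: "prob_space (mu a)" and sets_mu [simp]: "sets (mu a) = sets M"
  using mu_carrier[of a] by (auto simp: prob_monoid_def)

lemma space_mu [simp]: "space (mu a) = space M"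
  using sets_mu by (rule sets_eq_imp_space_eq)

lemma mu_add: "mu (a + b) = dconv (mu a) (mu b)"
proof -
  have "mu (a + b) = finprod prob_monoid
      (\<lambda>r. U r [^]\<^bsub>prob_monoid\<^esub> count a r \<otimes>\<^bsub>prob_monoid\<^esub> U r [^]\<^bsub>prob_monoid\<^esub> count b r) D"
    unfolding mu_def by (intro P.finprod_cong') (auto simp: P.nat_pow_mult U_carrier)
  also have "\<dots> = mu a \<otimes>\<^bsub>prob_monoid\<^esub> mu b"
    unfolding mu_def by (intro P.finprod_multf) (auto simp: U_carrier)
  finally show ?thesis by (simp add: prob_monoid_def)
qed

lemma mu_empty: "mu {#} = return M \<one>"
proof -
  have "mu {#} = \<one>\<^bsub>prob_monoid\<^esub>"
    unfolding mu_def by (intro P.finprod_one_eqI) simp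
  then show ?thesis by (simp add: prob_monoid_def)
qed

lemma mu_single: 
  assumes "r \<in> D"
  shows "mu {#r#} = U r"
proof -
  have "mu {#r#} = finprod prob_monoid (\<lambda>s. if r = s then U s else \<one>\<^bsub>prob_monoid\<^esub>) D"
    unfolding mu_def by (intro P.finprod_cong') (auto simp: U_carrier)
  also have "\<dots> = U r"
    by (rule P.finprod_singleton[OF assms finite_D]) (auto simp: U_carrier)
  finally show ?thesis .
qed

text \<open>The image of the positive part of \<open>f\<close> only, because negative coefficients
  become 0; the negative part is covered by \<open>mix (- f)\<close>. The two images need not be
  mutually singular, as the measures \<open>mu a\<close> may overlap.\<close>

definition mix :: "'r multiset l1 \<Rightarrow> 'a measure" where
  "mix f = density (count_space UNIV) (\<lambda>a. ennreal (coeff f a)) \<bind> mu"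

lemma mu_measurable: "mu \<in> measurable (density (count_space UNIV) k) (subprob_algebra M)"
  by (subst measurable_cong_sets[of _ "count_space UNIV"])
    (auto simp: space_subprob_algebra prob_space_imp_subprob_space[OF prob_mu])

lemma sets_mix [simp]: "sets (mix f) = sets M"
  unfolding mix_def by (intro sets_bind) auto

lemma space_mix [simp]: "space (mix f) = space M"
  using sets_mix by (rule sets_eq_imp_space_eq)

lemma nn_integral_mix:
  assumes "h \<in> borel_measurable M"
  shows "(\<integral>\<^sup>+x. h x \<partial>mix f) = (\<integral>\<^sup>+a. ennreal (coeff f a) * (\<integral>\<^sup>+x. h x \<partial>mu a) \<partial>count_space UNIV)"
  unfolding mix_def nn_integral_bind[OF assms mu_measurable]
  by (subst nn_integral_density) auto

lemma nn_integral_mix_diff: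
  assumes h: "h \<in> borel_measurable M" and B: "\<And>x. x \<in> space M \<Longrightarrow> h x \<le> ennreal B" "0 \<le> B"
  shows "enn2real (\<integral>\<^sup>+x. h x \<partial>mix f) - enn2real (\<integral>\<^sup>+x. h x \<partial>mix (- f))
      = pairing f (\<lambda>a. enn2real (\<integral>\<^sup>+x. h x \<partial>mu a))"
    and "(\<integral>\<^sup>+x. h x \<partial>mix f) < \<infinity>"
proof -
  have b: "(\<integral>\<^sup>+x. h x \<partial>mu a) \<le> ennreal B" for a
  proof -
    interpret prob_space "mu a" by (rule prob_mu)
    have "(\<integral>\<^sup>+x. h x \<partial>mu a) \<le> (\<integral>\<^sup>+x. ennreal B \<partial>mu a)"
      by (rule nn_integral_mono) (simp add: B)
    then show ?thesis using emeasure_space_1 by simp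
  qed
  show "enn2real (\<integral>\<^sup>+x. h x \<partial>mix f) - enn2real (\<integral>\<^sup>+x. h x \<partial>mix (- f))
      = pairing f (\<lambda>a. enn2real (\<integral>\<^sup>+x. h x \<partial>mu a))"
    and "(\<integral>\<^sup>+x. h x \<partial>mix f) < \<infinity>"
    using pairing_eq_nn_integral[OF b B(2), of f] by (simp_all add: nn_integral_mix[OF h])
qed

lemma finite_mix: "finite_measure (mix f)"
proof (rule finite_measureI)
  have "(\<integral>\<^sup>+x. 1 \<partial>mix f) < \<infinity>"
    by (rule nn_integral_mix_diff(2)[of _ 1]) simp_all
  then show "emeasure (mix f) (space (mix f)) \<noteq> \<infinity>" by simp
qed

lemma measure_difference_mix: "measure_difference M (mix f) (mix (- f))"
  by (simp add: measure_difference_def finite_mix)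

text \<open>The homomorphism, as a pairing for each set: linearity and the convergence of the
  exponential series are inherited from pairings.\<close>

definition Phi :: "'r multiset l1 \<Rightarrow> 'a set \<Rightarrow> real" where
  "Phi f A = pairing f (\<lambda>a. measure (mu a) A)"

lemma measure_mu_le: "\<bar>measure (mu a) A\<bar> \<le> 1"
  using prob_space.prob_le_1[OF prob_mu] by simp

lemma bounded_linear_Phi: "bounded_linear (\<lambda>f. Phi f A)"
  unfolding Phi_def by (rule bounded_linear_pairing) (rule measure_mu_le)

lemma Phi_eq: "Phi f = measure_difference.V (mix f) (mix (- f))"
proof
  fix A
  interpret measure_difference M "mix f" "mix (- f)" by (rule measure_difference_mix)
  show "Phi f A = V A"
  proof (cases "A \<in> sets M")
    case True
    then have "(\<integral>\<^sup>+x. indicator A x \<partial>N) = emeasure N A" if "sets N = sets M" for N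
      using that by simp
    moreover have "indicator A x \<le> ennreal 1" for x by (simp add: indicator_def)
    ultimately show ?thesis
      using nn_integral_mix_diff(1)[of "indicator A" 1 f] True
      by (simp add: Phi_def V_def measure_def)
  qed (simp add: Phi_def V_def measure_notin_sets pairing_def)
qed

lemma finite_signed_measure_Phi: "finite_signed_measure M (Phi f)"
  unfolding Phi_eq by (rule measure_difference.finite_signed_measure_V[OF measure_difference_mix])

text \<open>The masses of \<open>mix f\<close> and \<open>mix (- f)\<close> add up to exactly
  \<open>norm f\<close>; cancellation between them can only lower the total variation.\<close>

lemma tv_norm_Phi_le: "tv_norm M (Phi f) \<le> norm f"
proof -
  have e: "emeasure (mix f) (space M) = (\<integral>\<^sup>+a. ennreal (coeff f a) \<partial>count_space UNIV)" for f
    using nn_integral_mix[of "\<lambda>_. 1" f] prob_space.emeasure_space_1[OF prob_mu] by simp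
  have fin: "emeasure (mix f) (space M) < \<infinity>" for f
    using finite_measure.emeasure_finite[OF finite_mix, of f "space M"] by (simp add: less_top)
  have "tv_norm M (Phi f) \<le> measure (mix f) (space M) + measure (mix (- f)) (space M)"
    unfolding Phi_eq by (rule measure_difference.tv_norm_le[OF measure_difference_mix])
  also have "\<dots> = enn2real (emeasure (mix f) (space M) + emeasure (mix (- f)) (space M))"
    unfolding measure_def by (rule enn2real_plus[symmetric]) (use fin in simp_all)
  also have "\<dots> = norm f"
    unfolding e nn_integral_coeff_add by simp
  finally show ?thesis .
qed

lemma integral_mix_diff:
  assumes h: "h \<in> borel_measurable M" and B: "\<And>x. x \<in> space M \<Longrightarrow> h x \<le> B" and nn: "\<And>x. 0 \<le> h x" "0 \<le> B"
  shows "integral\<^sup>L (mix f) h - integral\<^sup>L (mix (- f)) h = pairing f (\<lambda>a. integral\<^sup>L (mu a) h)"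
proof -
  have e: "integral\<^sup>L N h = enn2real (\<integral>\<^sup>+x. ennreal (h x) \<partial>N)" if "sets N = sets M" for N
    by (rule integral_eq_nn_integral) (use h nn in \<open>auto simp: measurable_cong_sets[OF that refl]\<close>)
  have "(\<lambda>x. ennreal (h x)) \<in> borel_measurable M" using h by simp
  then show ?thesis
    unfolding e[OF sets_mix] e[OF sets_mu]
    by (rule nn_integral_mix_diff(1)[of _ B]) (use B nn in \<open>auto intro: ennreal_leI\<close>)
qed

text \<open>Made for the integrand in \<open>convolve\<close>, the mass of a section under a signed
  measure, which is a difference of two nonnegative bounded functions.\<close>

lemma signed_integral_Phi_diff:
  assumes h: "k1 \<in> borel_measurable M" "k2 \<in> borel_measurable M"
    and B: "\<And>x. x \<in> space M \<Longrightarrow> k1 x \<le> B" "\<And>x. x \<in> space M \<Longrightarrow> k2 x \<le> B"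
    and nn: "\<And>x. 0 \<le> k1 x" "\<And>x. 0 \<le> k2 x" "0 \<le> B"
  shows "signed_integral M (Phi g) (\<lambda>x. k1 x - k2 x) = pairing g (\<lambda>b. integral\<^sup>L (mu b) k1 - integral\<^sup>L (mu b) k2)"
proof -
  have int: "integrable N k1" "integrable N k2" if "finite_measure N" "sets N = sets M" for N
  proof -
    have sp: "space N = space M" using that(2) by (rule sets_eq_imp_space_eq)
    have "AE x in N. norm (k1 x) \<le> B" "AE x in N. norm (k2 x) \<le> B"
      by (auto intro!: AE_I2 simp: sp B nn)
    then show "integrable N k1" "integrable N k2"
      using h by (auto intro!: finite_measure.integrable_const_bound[OF that(1), of _ B]
          simp: measurable_cong_sets[OF that(2) refl])
  qed
  have fmu: "finite_measure (mu b)" for b using prob_mu by (rule prob_space.finite_measure)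
  have Bmu: "\<bar>integral\<^sup>L (mu b) k1\<bar> \<le> B" "\<bar>integral\<^sup>L (mu b) k2\<bar> \<le> B" for b
  proof -
    interpret prob_space "mu b" by (rule prob_mu)
    have "integral\<^sup>L (mu b) k1 \<le> integral\<^sup>L (mu b) (\<lambda>_. B)" "integral\<^sup>L (mu b) k2 \<le> integral\<^sup>L (mu b) (\<lambda>_. B)"
      by (intro integral_mono int fmu sets_mu integrable_const, simp add: B)+
    moreover have "0 \<le> integral\<^sup>L (mu b) k1" "0 \<le> integral\<^sup>L (mu b) k2"
      by (simp_all add: nn)
    ultimately show "\<bar>integral\<^sup>L (mu b) k1\<bar> \<le> B" "\<bar>integral\<^sup>L (mu b) k2\<bar> \<le> B"
      using prob_space by simp_all
  qed
  have "\<bar>k1 x - k2 x\<bar> \<le> B" if "x \<in> space M" for x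
    using B[OF that] nn(1,2)[of x] by linarith
  then have "signed_integral M (Phi g) (\<lambda>x. k1 x - k2 x)
      = integral\<^sup>L (mix g) (\<lambda>x. k1 x - k2 x) - integral\<^sup>L (mix (- g)) (\<lambda>x. k1 x - k2 x)"
    unfolding Phi_eq using h
    by (intro measure_difference.signed_integral_eq[OF measure_difference_mix]) auto
  also have "\<dots> = (integral\<^sup>L (mix g) k1 - integral\<^sup>L (mix (- g)) k1) - (integral\<^sup>L (mix g) k2 - integral\<^sup>L (mix (- g)) k2)"
    by (simp add: Bochner_Integration.integral_diff int[OF finite_mix sets_mix])
  also have "\<dots> = pairing g (\<lambda>b. integral\<^sup>L (mu b) k1) - pairing g (\<lambda>b. integral\<^sup>L (mu b) k2)"
    using integral_mix_diff[OF h(1) B(1) nn(1,3)] integral_mix_diff[OF h(2) B(2) nn(2,3)] by simp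
  also have "\<dots> = pairing g (\<lambda>b. integral\<^sup>L (mu b) k1 - integral\<^sup>L (mu b) k2)"
    unfolding pairing_def right_diff_distrib
    using infsum_add[OF pairing_summable[of "\<lambda>b. integral\<^sup>L (mu b) k1" B g, OF Bmu(1)]
        summable_on_uminus[THEN iffD2, OF pairing_summable[of "\<lambda>b. integral\<^sup>L (mu b) k2" B g, OF Bmu(2)]]]
    by (simp add: infsum_uminus)
  finally show ?thesis .
qed

text \<open>Expanded over the coefficients of \<open>f\<close> and \<open>g\<close>, the convolution
  becomes a double pairing with the masses \<open>measure (mu (b + a)) A\<close>, because
  \<open>mu\<close> turns sums of multisets into convolutions; \<open>pairing_times\<close>
  recognizes the product.\<close>

lemma convolve_Phi: "convolve G M (Phi f) (Phi g) = Phi (f * g)"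
proof
  fix A
  show "convolve G M (Phi f) (Phi g) A = Phi (f * g) A"
  proof (cases "A \<in> sets M")
    case False
    then show ?thesis by (simp add: convolve_def Phi_def measure_notin_sets pairing_def)
  next
    case A: True
    let ?S = "\<lambda>x. {y \<in> space M. x \<otimes> y \<in> A}"
    let ?k = "\<lambda>p. indicator A (case p of (x, y) \<Rightarrow> x \<otimes> y) :: ennreal"
    define h where "h f x = measure (mix f) (?S x)" for f x
    have S: "?S x \<in> sets M" if "x \<in> space M" for x
      using measurable_sets[OF measurable_compose[OF measurable_Pair1'[OF that] measurable_add] A]
      by (simp add: vimage_def Int_def conj_commute)
    have emeasure_S: "emeasure N (?S x) = (\<integral>\<^sup>+y. indicator A (x \<otimes> y) \<partial>N)"
      if "x \<in> space M" "sets N = sets M" for N x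
    proof -
      have "space N = space M" using that(2) by (rule sets_eq_imp_space_eq)
      then have "(\<integral>\<^sup>+y. indicator A (x \<otimes> y) \<partial>N) = (\<integral>\<^sup>+y. indicator (?S x) y \<partial>N)"
        by (intro nn_integral_cong) (simp add: indicator_def)
      then show ?thesis using S[OF that(1)] that(2) by simp
    qed
    have ind: "indicator A \<in> borel_measurable M" using A by simp
    have h_eq: "ennreal (h f x) = (\<integral>\<^sup>+y. indicator A (x \<otimes> y) \<partial>mix f)" if "x \<in> space M" for f x
      unfolding h_def emeasure_S[OF that sets_mix, symmetric]
      by (rule finite_measure.emeasure_eq_measure[OF finite_mix, symmetric])
    have h_meas: "h f \<in> borel_measurable M" for f
    proof -
      have "(\<lambda>x. \<integral>\<^sup>+y. indicator A (x \<otimes> y) \<partial>mix f) \<in> borel_measurable M"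
        by (intro measurable_inner_nn_integral[OF ind] finite_measure.axioms(1) finite_mix sets_mix)
      then have "(\<lambda>x. enn2real (\<integral>\<^sup>+y. indicator A (x \<otimes> y) \<partial>mix f)) \<in> borel_measurable M"
        by simp
      moreover have "enn2real (\<integral>\<^sup>+y. indicator A (x \<otimes> y) \<partial>mix f) = h f x" if "x \<in> space M" for x
        using h_eq[OF that, of f, symmetric] by (simp add: h_def)
      ultimately show ?thesis by (simp cong: measurable_cong)
    qed
    define B where "B = measure (mix f) (space M) + measure (mix (- f)) (space M)"
    have hB: "h f x \<le> B" "h (- f) x \<le> B" for x
      using finite_measure.bounded_measure[OF finite_mix, of f "?S x"]
        finite_measure.bounded_measure[OF finite_mix, of "- f" "?S x"]
      by (auto simp: h_def B_def add_increasing2 add_increasing)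
    \<comment> \<open>Tonelli's theorem for \<open>mu b\<close> and \<open>mix f\<close> turns the
      section masses under \<open>mix f\<close> into \<open>H\<close>, the section masses under
      \<open>mu b\<close>, whose integral against \<open>mu a\<close> is a convolution.\<close>
    have inner: "integral\<^sup>L (mu b) (h f) - integral\<^sup>L (mu b) (h (- f)) = pairing f (\<lambda>a. measure (mu (b + a)) A)" for b
    proof -
      interpret B: prob_space "mu b" by (rule prob_mu)
      define H where "H y = (\<integral>\<^sup>+x. indicator A (y \<otimes> x) \<partial>mu b)" for y
      have H: "H \<in> borel_measurable M"
        unfolding H_def by (rule measurable_inner_nn_integral[OF ind]) (unfold_locales, simp)
      have H1: "H y \<le> ennreal 1" for y
      proof -
        have "H y \<le> (\<integral>\<^sup>+x. 1 \<partial>mu b)"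
          unfolding H_def by (rule nn_integral_mono) (simp add: indicator_def)
        then show ?thesis using B.emeasure_space_1 by simp
      qed
      have e: "integral\<^sup>L (mu b) (h f) = enn2real (\<integral>\<^sup>+y. H y \<partial>mix f)" for f
      proof -
        interpret F: finite_measure "mix f" by (rule finite_mix)
        interpret BF: pair_sigma_finite "mu b" "mix f" ..
        have "integral\<^sup>L (mu b) (h f) = enn2real (\<integral>\<^sup>+x. ennreal (h f x) \<partial>mu b)"
          by (rule integral_eq_nn_integral)
            (simp_all only: measurable_cong_sets[OF sets_mu refl] h_meas, simp add: h_def)
        also have "(\<integral>\<^sup>+x. ennreal (h f x) \<partial>mu b) = (\<integral>\<^sup>+x. \<integral>\<^sup>+y. indicator A (x \<otimes> y) \<partial>mix f \<partial>mu b)"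
          by (rule nn_integral_cong) (simp add: h_eq)
        also have "\<dots> = (\<integral>\<^sup>+y. \<integral>\<^sup>+x. indicator A (x \<otimes> y) \<partial>mu b \<partial>mix f)"
          using BF.Fubini[OF measurable_compose[OF measurable_add'[OF sets_mu sets_mix] ind]] by simp
        also have "\<dots> = (\<integral>\<^sup>+y. H y \<partial>mix f)"
          unfolding H_def by (intro nn_integral_cong) (simp add: space_eq_carrier m_comm)
        finally show ?thesis .
      qed
      have "enn2real (\<integral>\<^sup>+y. H y \<partial>mu a) = measure (mu (b + a)) A" for a
      proof -
        have "(\<integral>\<^sup>+y. H y \<partial>mu a) = (\<integral>\<^sup>+z. indicator A z \<partial>dconv (mu a) (mu b))"
          unfolding H_def by (rule nn_integral_dconv[symmetric, OF sets_mu sets_mu _ ind]) unfold_locales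
        also have "\<dots> = emeasure (mu (b + a)) A"
          using A by (simp add: mu_add[symmetric] add.commute)
        finally show ?thesis by (simp add: measure_def)
      qed
      then show ?thesis
        unfolding e using nn_integral_mix_diff(1)[OF H H1, of f] by simp
    qed
    have "Phi f (?S x) = h f x - h (- f) x" for x
      unfolding Phi_eq measure_difference.V_def[OF measure_difference_mix] h_def ..
    then have "convolve G M (Phi f) (Phi g) A = signed_integral M (Phi g) (\<lambda>x. h f x - h (- f) x)"
      using A by (simp add: convolve_def)
    also have "\<dots> = pairing g (\<lambda>b. integral\<^sup>L (mu b) (h f) - integral\<^sup>L (mu b) (h (- f)))"
    proof (rule signed_integral_Phi_diff)
      show "0 \<le> h f x" "0 \<le> h (- f) x" for x by (simp_all add: h_def)
      show "0 \<le> B" by (simp add: B_def)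
    qed (rule h_meas hB)+
    also have "\<dots> = Phi (f * g) A"
      \<comment> \<open>\<open>convolve\<close> integrates over its second argument, so the outer
        pairing is with \<open>g\<close>.\<close>
      unfolding inner Phi_def mult.commute[of f g]
      by (rule pairing_times[symmetric]) (rule measure_mu_le)
    finally show ?thesis .
  qed
qed

lemma Phi_1: "Phi 1 = dirac M \<one>"
  by (simp add: fun_eq_iff Phi_def one_l1_def mu_empty dirac_def zero_multiset_def[symmetric] empty_neutral)

lemma Phi_single: "r \<in> D \<Longrightarrow> Phi (single {#r#}) = measure (U r)"
  by (simp add: fun_eq_iff Phi_def mu_single)

lemma pow_Phi: "Phi f [^]\<^bsub>conv_monoid G M\<^esub> (m :: nat) = Phi (f ^ m)"
proof (induction m)
  case 0
  show ?case by (simp add: nat_pow_def conv_monoid_def Phi_1)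
next
  case (Suc m)
  then show ?case by (simp add: nat_pow_def conv_monoid_def convolve_Phi mult.commute)
qed

lemma conv_exp_Phi: "conv_exp G M (Phi f) = Phi (exp f)"
proof
  fix A
  have "(\<lambda>m. Phi (f ^ m /\<^sub>R fact m) A) sums Phi (exp f) A"
    by (rule bounded_linear.sums[OF bounded_linear_Phi exp_converges])
  moreover have "Phi (f ^ m /\<^sub>R fact m) A = Phi (f ^ m) A / fact m" for m
    using linear_scale[OF bounded_linear.linear[OF bounded_linear_Phi]] by (simp add: divide_inverse mult.commute)
  ultimately show "conv_exp G M (Phi f) A = Phi (exp f) A"
    by (simp add: conv_exp_def pow_Phi sums_iff)
qed

text \<open>Multiplication in \<open>conv_monoid\<close> is controlled only on images under
  \<open>Phi\<close>, so the product is evaluated through the fold that defines it: every order of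
  the factors stays among these images and leads to the same element.\<close>

lemma finprod_Phi:
  assumes "finite J" and "\<And>j. j \<in> J \<Longrightarrow> F j = Phi (f j)"
  shows "finprod (conv_monoid G M) F J = Phi (\<Prod>j\<in>J. f j)"
proof -
  let ?fold = "foldSetD (carrier (conv_monoid G M)) (mult (conv_monoid G M) \<circ> F) \<one>\<^bsub>conv_monoid G M\<^esub>"
  have carrier: "Phi f \<in> carrier (conv_monoid G M)" for f
    by (simp add: conv_monoid_def finite_signed_measure_Phi)
  have mult: "Phi f \<otimes>\<^bsub>conv_monoid G M\<^esub> Phi g = Phi (f * g)" for f g
    by (simp add: conv_monoid_def convolve_Phi)
  have one: "\<one>\<^bsub>conv_monoid G M\<^esub> = Phi 1" by (simp add: conv_monoid_def Phi_1)
  have ex: "(J, Phi (prod f J)) \<in> ?fold"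
    using assms
  proof (induction J)
    case empty
    show ?case by (simp add: one carrier foldSetD.emptyI)
  next
    case (insert j J)
    have eq: "(mult (conv_monoid G M) \<circ> F) j (Phi (prod f J)) = Phi (prod f (insert j J))"
      using insert.hyps insert.prems by (simp add: mult)
    have IH: "(J, Phi (prod f J)) \<in> ?fold" by (rule insert.IH) (rule insert.prems, simp)
    have "(insert j J, (mult (conv_monoid G M) \<circ> F) j (Phi (prod f J))) \<in> ?fold"
      by (rule foldSetD.insertI[OF insert.hyps(2) _ IH]) (simp only: eq carrier)
    then show ?case by (simp only: eq)
  qed
  have unique: "x = Phi (prod f J)" if "(J, x) \<in> ?fold" for x
    using that assms(2)
  proof (induction J x)
    case emptyI
    show ?case by (simp add: one)
  next
    case (insertI j A y)
    have "finite A" by (rule foldSetD_imp_finite[OF insertI.hyps(3)])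
    then show ?case using insertI by (simp add: mult)
  qed
  have "(THE x. (J, x) \<in> ?fold) = Phi (prod f J)" using ex unique by (rule the_equality)
  then show ?thesis using assms(1) by (simp only: finprod_def foldD_def if_True)
qed

end

section \<open>Estimation of the remainder\<close>

lemma power_7_5_le_fact: "10 \<le> k \<Longrightarrow> (7.5 :: real) ^ (2 * k) \<le> fact (2 * k)"
proof (induction k rule: dec_induct)
  case base
  show ?case by (simp add: power_divide fact_numeral)
next
  case (step k)
  have "(7.5 :: real) ^ (2 * Suc k) = 7.5 ^ 2 * 7.5 ^ (2 * k)" by (simp add: power2_eq_square)
  also have "\<dots> \<le> (real (2 * k + 2) * real (2 * k + 1)) * fact (2 * k)"
  proof (rule mult_mono)
    have "(20 :: real) * 20 \<le> real (2 * k + 2) * real (2 * k + 1)"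
      using step by (intro mult_mono) auto
    then show "(7.5 :: real) ^ 2 \<le> real (2 * k + 2) * real (2 * k + 1)"
      by (simp add: power_divide)
  qed (use step in simp_all)
  also have "\<dots> = fact (2 * Suc k)" by (simp add: algebra_simps)
  finally show ?case .
qed

text \<open>The choice of \<open>s\<close> is the root of order \<open>2 k\<close> of
  \<open>fact (2 * k)\<close>, taken exactly from 10 on and rounded up to a decimal for the
  tabulated constants.\<close>

lemma D'_const_dominates:
  assumes "2 \<le> k"
  obtains s where "0 < s" "fact (2 * k) \<le> s ^ (2 * k)"
    "(kappa (3/5) * (5/2 * s + 4)) ^ k / fact k \<le> D'_const k"
proof -
  have kap: "(kappa (3/5) * (5/2 * s + 4)) ^ k \<le> (0.6864 * (5/2 * s + 4)) ^ k" if "0 < s" for s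
    using that kappa_3_5_le kappa_3_5_nonneg by (intro power_mono mult_right_mono) auto
  note intro = that
  show thesis
  proof (cases "k < 10")
    case True
    have "thesis" if s: "0 < s" "fact (2 * k) \<le> s ^ (2 * k)"
      "(0.6864 * (5/2 * s + 4)) ^ k / fact k \<le> D_const k * 2.097264024 ^ k" for s
    proof -
      have "(kappa (3/5) * (5/2 * s + 4)) ^ k / fact k \<le> D_const k * 2.097264024 ^ k"
        using divide_right_mono[OF kap[OF s(1)], of "fact k"] s(3) by simp
      also have "\<dots> \<le> D'_const k"
        unfolding D'_const_ge_2[OF assms] using half_g_lower less_imp_le[OF D_const_pos]
        by (intro mult_left_mono power_mono) auto
      finally show thesis by (rule intro[OF s(1,2)])
    qed
    note * = this
    consider "k = 2" | "k = 3" | "k = 4" | "k = 5" | "k = 6" | "k = 7" | "k = 8" | "k = 9"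
      using True assms by linarith
    then show thesis
    proof cases
      case 1 show ?thesis by (rule *[of "9/4"]) (simp_all add: 1 D_const_def fact_numeral power_divide)
    next
      case 2 show ?thesis by (rule *[of 3]) (simp_all add: 2 D_const_def fact_numeral power_divide)
    next
      case 3 show ?thesis by (rule *[of "3.8"]) (simp_all add: 3 D_const_def fact_numeral power_divide)
    next
      case 4 show ?thesis by (rule *[of "4.6"]) (simp_all add: 4 D_const_def fact_numeral power_divide)
    next
      case 5 show ?thesis by (rule *[of "5.3"]) (simp_all add: 5 D_const_def fact_numeral power_divide)
    next
      case 6 show ?thesis by (rule *[of "6.1"]) (simp_all add: 6 D_const_def fact_numeral power_divide)
    next
      case 7 show ?thesis by (rule *[of "6.85"]) (simp_all add: 7 D_const_def fact_numeral power_divide)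
    next
      case 8 show ?thesis by (rule *[of "7.6"]) (simp_all add: 8 D_const_def fact_numeral power_divide)
    qed
  next
    case False
    then have k: "10 \<le> k" "0 < k" by auto
    define s where "s = root (2 * k) (fact (2 * k))"
    have s: "0 < s" "s ^ (2 * k) = fact (2 * k)"
      using k by (auto simp: s_def real_root_pow_pos2)
    have "7.5 = root (2 * k) (7.5 ^ (2 * k))" using k by (simp add: real_root_power_cancel)
    also have "\<dots> \<le> s"
      unfolding s_def using k power_7_5_le_fact[OF k(1)] by (subst real_root_le_iff) auto
    finally have "7.5 \<le> s" .
    \<comment> \<open>The difference \<open>2.097264024 - 0.6864 * 5/2\<close> is about 0.381, so
      the constant \<open>0.6864 * 4\<close> is absorbed as soon as \<open>s\<close> is at least
      7.21.\<close>
    then have "0.6864 * (5/2 * s + 4) \<le> 2.097264024 * s" by simp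
    also have "\<dots> \<le> g_fun 2 / 2 * s"
      using half_g_lower s(1) by (intro mult_right_mono) auto
    finally have "(0.6864 * (5/2 * s + 4)) ^ k \<le> (g_fun 2 / 2 * s) ^ k"
      using s(1) by (intro power_mono) auto
    also have "\<dots> = (g_fun 2 / 2) ^ k * sqrt (fact (2 * k))"
    proof -
      have "(s ^ k)\<^sup>2 = fact (2 * k)"
        using s(2) by (simp only: power_mult[symmetric] mult.commute[of k 2])
      then have "sqrt (fact (2 * k)) = s ^ k"
        using s(1) by (intro real_sqrt_unique) auto
      then show ?thesis by (simp only: power_mult_distrib)
    qed
    finally have "(kappa (3/5) * (5/2 * s + 4)) ^ k \<le> (g_fun 2 / 2) ^ k * sqrt (fact (2 * k))"
      using kap[OF s(1)] by linarith
    then have "(kappa (3/5) * (5/2 * s + 4)) ^ k / fact k \<le> ((g_fun 2 / 2) ^ k * sqrt (fact (2 * k))) / fact k"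
      by (rule divide_right_mono) simp
    also have "\<dots> = D'_const k"
      using assms k by (simp add: D'_const_ge_2 D_const_ge_10 mult.commute)
    finally show thesis using intro[of s] s by simp
  qed
qed

section \<open>The error estimate in the algebra\<close>

context kerstan
begin

lemma norm_H_le_D':
  assumes "1 \<le> k"
  shows "norm (H k) \<le> D'_const k * beta ^ k"
proof (cases "k = 1")
  case True
  then show ?thesis using norm_H_1 by (simp add: D'_const_def)
next
  case False
  then obtain s where s: "0 < s" "fact (2 * k) \<le> s ^ (2 * k)"
    "(kappa (3/5) * (5/2 * s + 4)) ^ k / fact k \<le> D'_const k"
    using assms by (auto intro: D'_const_dominates[of k])
  show ?thesis
    using norm_H_le[OF s(1,2)] mult_right_mono[OF s(3), of "beta ^ k"] beta_nonneg by simp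
qed

theorem norm_expansion_error_le:
  assumes "l \<le> card N"
  shows "norm ((\<Prod>j\<in>N. 1 + R j) - (\<Sum>k = 0..l. H k)) \<le> c_const l * beta ^ (l + 1)"
proof (cases "beta \<le> x_sol l")
  case True
  have "{..card N} = {0..l} \<union> {l + 1..card N}" using assms by auto
  then have "(\<Prod>j\<in>N. 1 + R j) - (\<Sum>k = 0..l. H k) = (\<Sum>k\<in>{l + 1..card N}. H k)"
    unfolding prod_F by (simp add: sum.union_disjoint)
  then have "norm ((\<Prod>j\<in>N. 1 + R j) - (\<Sum>k = 0..l. H k)) \<le> (\<Sum>k\<in>{l + 1..card N}. D'_const k * beta ^ k)"
    by (auto intro!: sum_norm_le norm_H_le_D')
  also have "\<dots> \<le> c_const l * beta ^ (l + 1)"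
    by (rule sum_D'_le_c_const[OF beta_nonneg True])
  finally show ?thesis .
next
  case False
  have "norm (\<Sum>k = 0..l. H k) \<le> norm (H 0) + norm (\<Sum>k = 1..l. H k)"
    by (simp add: sum.atLeast_Suc_atMost norm_triangle_ineq)
  also have "\<dots> \<le> 1 + (\<Sum>k = 1..l. D'_const k * beta ^ k)"
    by (intro add_mono norm_H_0 sum_norm_le norm_H_le_D') auto
  \<comment> \<open>The summand 2 of \<open>h2\<close> consists of the bounds 1 for the full product
    and 1 for \<open>H 0\<close>.\<close>
  finally have "norm ((\<Prod>j\<in>N. 1 + R j) - (\<Sum>k = 0..l. H k)) \<le> h2 l beta"
    using norm_triangle_ineq4[of "\<Prod>j\<in>N. 1 + R j" "\<Sum>k = 0..l. H k"] norm_F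
    by (simp add: h2_def)
  also have "\<dots> \<le> c_const l * beta ^ (l + 1)"
    using False by (intro h2_le_c_const) simp
  finally show ?thesis .
qed

end

section \<open>Transfer to signed measures\<close>

context convolution_representation
begin

lemma Phi_add: "Phi (f + g) A = Phi f A + Phi g A"
  and Phi_diff: "Phi (f - g) A = Phi f A - Phi g A"
  and Phi_minus: "Phi (- f) A = - Phi f A"
  and Phi_scaleR: "Phi (c *\<^sub>R f) A = c * Phi f A"
  and Phi_sum: "Phi (\<Sum>i\<in>I. F i) A = (\<Sum>i\<in>I. Phi (F i) A)"
proof -
  interpret bounded_linear "\<lambda>f. Phi f A" by (rule bounded_linear_Phi)
  show "Phi (f + g) A = Phi f A + Phi g A" "Phi (f - g) A = Phi f A - Phi g A"
    "Phi (- f) A = - Phi f A" "Phi (c *\<^sub>R f) A = c * Phi f A"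
    "Phi (\<Sum>i\<in>I. F i) A = (\<Sum>i\<in>I. Phi (F i) A)"
    by (simp_all add: add diff neg scaleR sum)
qed

end

theorem theorem2p3:
  fixes G :: "('a, 'b) monoid_scheme" and M :: "'a measure"
    and d n l :: nat
    and p :: "nat \<Rightarrow> real" and q :: "nat \<Rightarrow> nat \<Rightarrow> real"
    and U :: "nat \<Rightarrow> 'a measure"
  defines "S \<equiv> conv_monoid G M"
    and "\<delta>0 \<equiv> dirac M \<one>\<^bsub>G\<^esub>"
    and "lamr \<equiv> \<lambda>r. \<Sum>j = 1..n. p j * q j r"
    and "lam \<equiv> \<Sum>j = 1..n. p j"
    and "Qj \<equiv> \<lambda>j A. \<Sum>r = 1..d. q j r * measure (U r) A"
  defines "Q \<equiv> \<lambda>A. 1 / lam * (\<Sum>j = 1..n. p j * Qj j A)"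
    and "R \<equiv> \<lambda>j A. p j * (Qj j A - \<delta>0 A)"
  defines "F \<equiv> \<lambda>j A. \<delta>0 A + R j A"
  defines "V \<equiv> \<lambda>j A. (F j \<otimes>\<^bsub>S\<^esub> conv_exp G M (\<lambda>B. - R j B)) A - \<delta>0 A"
    and "Fprod \<equiv> finprod S F {1..n}"
  defines "Mk \<equiv> \<lambda>k A. \<Sum>J | J \<subseteq> {1..n} \<and> card J = k. finprod S V J A"
  defines "H \<equiv> \<lambda>k. Mk k \<otimes>\<^bsub>S\<^esub> conv_exp G M (\<lambda>A. lam * (Q A - \<delta>0 A))"
  defines "Gl \<equiv> \<lambda>A. \<Sum>k = 0..l. H k A"
    and "\<beta>1 \<equiv> \<Sum>j = 1..n. (p j)\<^sup>2 * (\<Sum>r = 1..d. q j r * min (q j r / lamr r) 1)"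
  assumes "measurable_abelian_semigroup G M"
    and "1 \<le> d" and "1 \<le> n" and "l \<le> n"
    and "\<And>j. j \<in> {1..n} \<Longrightarrow> p j \<in> {0..1}"
    and "\<And>j r. j \<in> {1..n} \<Longrightarrow> r \<in> {1..d} \<Longrightarrow> q j r \<in> {0..1}"
    and "\<And>j. j \<in> {1..n} \<Longrightarrow> (\<Sum>r = 1..d. q j r) = 1"
    and "\<And>r. r \<in> {1..d} \<Longrightarrow> 0 < lamr r"
    and "\<And>r. r \<in> {1..d} \<Longrightarrow> prob_space (U r)"
    and "\<And>r. r \<in> {1..d} \<Longrightarrow> sets (U r) = sets M"
  shows "(\<exists>!x. 0 < x \<and> h1 l x = ennreal (h2 l x)) \<and>
    tv_norm M (\<lambda>A. Fprod A - Gl A) \<le> c_const l * \<beta>1 ^ (l + 1) \<and>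
    c_const 0 \<le> 15.6 \<and> c_const 1 \<le> 113.0 \<and> c_const 2 \<le> 633.8 \<and>
    c_const 3 \<le> 3204.8 \<and> c_const 4 \<le> 15945.6"
proof -
  \<comment> \<open>Keeps the index sets in the form \<open>{1..n}\<close>, as in the definitions to
    be matched.\<close>
  note One_nat_def [simp del]
  interpret K: kerstan "{1..n}" "{1..d}" p q
  proof
    show "0 \<le> p j" "p j \<le> 1" if "j \<in> {1..n}" for j using assms(19)[OF that] by simp_all
    show "0 \<le> q j r" if "j \<in> {1..n}" "r \<in> {1..d}" for j r using assms(20)[OF that] by simp
    show "(\<Sum>r = 1..d. q j r) = 1" if "j \<in> {1..n}" for j by (rule assms(21)[OF that])
    show "0 < (\<Sum>j = 1..n. p j * q j r)" if "r \<in> {1..d}" for r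
      using assms(22)[OF that] by (simp only: lamr_def)
  qed simp_all
  interpret measurable_abelian_semigroup G M by fact
  interpret C: convolution_representation G M "{1..d}" U
    by (intro convolution_representation.intro convolution_representation_axioms.intro)
      (simp_all add: assms(15,23,24))
  note linear = C.Phi_add C.Phi_diff C.Phi_minus C.Phi_scaleR C.Phi_sum
  have one: "C.Phi 1 = \<delta>0" by (simp add: \<delta>0_def C.Phi_1)
  have convolve: "C.Phi f \<otimes>\<^bsub>S\<^esub> C.Phi g = C.Phi (f * g)" for f g
    by (simp add: S_def conv_monoid_def C.convolve_Phi)
  have Qj: "C.Phi (K.Q j) = Qj j" for j
    by (simp add: fun_eq_iff Qj_def K.Q_def linear C.Phi_single)
  have R: "C.Phi (K.R j) = R j" for j
    by (simp add: fun_eq_iff R_def K.R_def linear Qj one)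
  have F: "C.Phi (1 + K.R j) = F j" for j
    by (simp add: fun_eq_iff F_def linear R one)
  have V: "C.Phi (K.V j) = V j" for j
  proof -
    have "(\<lambda>B. - R j B) = C.Phi (- K.R j)" by (simp add: fun_eq_iff linear R)
    then have "F j \<otimes>\<^bsub>S\<^esub> conv_exp G M (\<lambda>B. - R j B) = C.Phi ((1 + K.R j) * exp (- K.R j))"
      by (simp only: C.conv_exp_Phi F[symmetric] convolve)
    then show ?thesis by (simp add: fun_eq_iff V_def K.V_def linear one)
  qed
  have Fprod: "Fprod = C.Phi (\<Prod>j\<in>{1..n}. 1 + K.R j)"
    unfolding Fprod_def S_def by (rule C.finprod_Phi) (simp_all add: F)
  \<comment> \<open>\<open>Q\<close> contains the quotient \<open>1 / lam\<close>. As each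
    \<open>q j\<close> sums to 1, \<open>lam\<close> is the sum of the positive numbers
    \<open>lamr r\<close>, and there is at least one of them.\<close>
  have lam: "0 < lam"
  proof -
    have "lam = (\<Sum>r = 1..d. lamr r)"
      unfolding lamr_def by (subst sum.swap) (simp add: sum_distrib_left[symmetric] assms(21) lam_def)
    also have "\<dots> > 0" using assms(16,22) by (intro sum_pos) auto
    finally show ?thesis .
  qed
  have exponent: "(\<lambda>A. lam * (Q A - \<delta>0 A)) = C.Phi (\<Sum>j\<in>{1..n}. K.R j)"
  proof
    fix A
    have "lam * (Q A - \<delta>0 A) = (\<Sum>j = 1..n. p j * Qj j A) - lam * \<delta>0 A"
      using lam by (simp add: Q_def right_diff_distrib)
    then show "lam * (Q A - \<delta>0 A) = C.Phi (\<Sum>j\<in>{1..n}. K.R j) A"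
      by (simp add: linear R R_def lam_def sum_distrib_right right_diff_distrib sum_subtractf)
  qed
  have Mk: "Mk k = C.Phi (\<Sum>J | J \<subseteq> {1..n} \<and> card J = k. \<Prod>j\<in>J. K.V j)" for k
  proof
    fix A
    have "finprod S V J = C.Phi (\<Prod>j\<in>J. K.V j)" if "J \<subseteq> {1..n}" for J
      unfolding S_def by (rule C.finprod_Phi[OF finite_subset[OF that]]) (simp_all add: V)
    then show "Mk k A = C.Phi (\<Sum>J | J \<subseteq> {1..n} \<and> card J = k. \<Prod>j\<in>J. K.V j) A"
      unfolding Mk_def linear by (intro sum.cong) simp_all
  qed
  have H: "H k = C.Phi (K.H k)" for k
    unfolding H_def exponent Mk C.conv_exp_Phi convolve K.H_def ..
  have "(\<lambda>A. Fprod A - Gl A) = C.Phi ((\<Prod>j\<in>{1..n}. 1 + K.R j) - (\<Sum>k = 0..l. K.H k))"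
    by (simp add: fun_eq_iff linear Fprod Gl_def H)
  then have "tv_norm M (\<lambda>A. Fprod A - Gl A) \<le> norm ((\<Prod>j\<in>{1..n}. 1 + K.R j) - (\<Sum>k = 0..l. K.H k))"
    by (simp only: C.tv_norm_Phi_le)
  also have "\<dots> \<le> c_const l * K.beta ^ (l + 1)"
    by (rule K.norm_expansion_error_le) (simp add: assms(18))
  also have "K.beta = \<beta>1"
    by (simp add: K.beta_def \<beta>1_def K.m_def K.lam_def lamr_def)
  finally show ?thesis
    using ex1_h1_eq_h2 c_const_0 c_const_1 c_const_2 c_const_3 c_const_4 by blast
qed

end
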